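(* Let $\mathcal{H}$ be a separable Hilbert space, let $P_1,\dots,P_K$ be non-atomic Borel probability distributions on $\mathcal{H}$, and let $\mathbf{X}_{ki}$ ($k=1,\dots,K$, $i=1,\dots,n_k$) be independent random elements with $\mathbf{X}_{ki}\sim P_k$, where $n=\sum_{k=1}^K n_k$. Assume that $n^{-1}n_k\to\lambda_k\in(0,1)$ for all $k$ as $n\to\infty$. Suppose that $P_1=P_2=\cdots=P_K$. Then $E[\mathbf{U}_n]=\mathbf{0}$. Consequently, as $n\to\infty$, $\mathbf{U}_n$ converges weakly to $G(\mathbf{0},\boldsymbol{\Sigma})$, and $SS_n=\|\mathbf{U}_n\|^2$ converges weakly to $\|\mathbf{W}\|^2$, where $\mathbf{W}$ is a random element of $\mathcal{H}^K$ with distribution $G(\mathbf{0},\boldsymbol{\Sigma})$.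
   Context: $\mathcal{H}$ is a real separable Hilbert space with its Borel $\sigma$-field; $K\ge 2$ is fixed and the group sizes $n_k$ depend on $n$. Non-atomic means that every singleton has probability zero. Define $\mathbf{s}(\mathbf{x})=\mathbf{x}/\|\mathbf{x}\|$ for $\mathbf{x}\ne\mathbf{0}$ and $\mathbf{s}(\mathbf{0})=\mathbf{0}$. Put $\mathbf{R}(\mathbf{x})=n^{-1}\sum_{k=1}^K\sum_{i=1}^{n_k}\mathbf{s}(\mathbf{x}-\mathbf{X}_{ki})$, $\bar{\mathbf{R}}_k=n_k^{-1}\sum_{i=1}^{n_k}\mathbf{R}(\mathbf{X}_{ki})$, $\mathbf{U}_n=(\sqrt{n_1}\bar{\mathbf{R}}_1,\dots,\sqrt{n_K}\bar{\mathbf{R}}_K)\in\mathcal{H}^K$, where $\mathcal{H}^K$ is the product Hilbert space with $\|(\mathbf{u}_1,\dots,\mathbf{u}_K)\|^2=\sum_k\|\mathbf{u}_k\|^2$, and $SS_n=\|\mathbf{U}_n\|^2=\sum_{k=1}^K n_k\|\bar{\mathbf{R}}_k\|^2$. For $\mathbf{x},\mathbf{y}\in\mathcal{H}$, $\mathbf{x}\otimes\mathbf{y}$ is the operator $(\mathbf{x}\otimes\mathbf{y})(\mathbf{w})=\langle\mathbf{w},\mathbf{x}\rangle\mathbf{y}$, and $\mathrm{Cov}(\mathbf{A},\mathbf{B})=E[\mathbf{A}\otimes\mathbf{B}]-E[\mathbf{A}]\otimes E[\mathbf{B}]$. For $i,j,k\in\{1,\dots,K\}$ let $\mathbf{X}_i,\mathbf{Y}_j,\mathbf{Z}_k$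 be independent (even if indices coincide) with distributions $P_i,P_j,P_k$, and $\mathbf{C}(i,j,k)=\mathrm{Cov}(E[\mathbf{s}(\mathbf{X}_i-\mathbf{Z}_k)\mid\mathbf{Z}_k],E[\mathbf{s}(\mathbf{Y}_j-\mathbf{Z}_k)\mid\mathbf{Z}_k])$. The operator $\boldsymbol{\Sigma}=(\boldsymbol{\sigma}_{k_1k_2})_{K\times K}$ on $\mathcal{H}^K$ has blocks $$\boldsymbol{\sigma}_{k_1k_2}=\sqrt{\lambda_{k_1}\lambda_{k_2}}\sum_{l=1}^K\lambda_l[\mathbf{C}(k_1,k_2,l)-\mathbf{C}(l,k_2,k_1)-\mathbf{C}(k_1,l,k_2)]+\sum_{l_1=1}^K\sum_{l_2=1}^K\lambda_{l_1}\lambda_{l_2}\mathbf{C}(l_1,l_2,k_1)\mathbb{I}(k_1=k_2),$$ with $\boldsymbol{\sigma}_{k_1k_2}$ being the covariance $\mathrm{Cov}(\cdot,\cdot)$ between the $k_1$-th and $k_2$-th components. $G(\mathbf{0},\boldsymbol{\Sigma})$ is the Gaussian distribution on $\mathcal{H}^K$ with mean $\mathbf{0}$ and covariance operator $\boldsymbol{\Sigma}$. *)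

theory Defs
  imports "HOL-Probability.Probability"
begin

text \<open>
  A real separable Hilbert space is a type of sort
  \<open>{real_inner, banach, second_countable_topology}\<close>.  The groups are indexed by a finite type
  \<open>'k\<close> with \<open>CARD('k)\<close> elements, and the product Hilbert space is the type \<open>'h ^ 'k\<close>, whose norm
  is the Euclidean combination of the norms of the components.  The library lacks the
  following instance, which makes Bochner integration available on \<open>'h ^ 'k\<close>.
\<close>

instance vec :: ("{metric_space, second_countable_topology}", finite) second_countable_topology
proof
  obtain B :: "'a set set" where cB: "countable B" and tB: "topological_basis B"
    using ex_countable_basis by auto
  define D where "D = (\<lambda>F::'b \<Rightarrow> 'a set. {x::'a ^ 'b. \<forall>i. x $ i \<in> F i}) ` (PiE UNIV (\<lambda>_. B))"
  have "countable D"
    unfolding D_def by (intro countable_image countable_PiE) (auto simp: cB)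
  moreover have "topological_basis D"
  proof (rule topological_basisI)
    fix S assume "S \<in> D"
    then obtain F :: "'b \<Rightarrow> 'a set" where S: "S = {x. \<forall>i. x $ i \<in> F i}" and "\<And>i. F i \<in> B"
      unfolding D_def by (auto simp: PiE_iff)
    then have "\<And>i. open (F i)" using topological_basis_open[OF tB] by blast
    then show "open S" unfolding S open_vec_def by blast
  next
    fix S :: "('a ^ 'b) set" and x assume "open S" "x \<in> S"
    then obtain A where "(\<forall>i. open (A i) \<and> x $ i \<in> A i) \<and> (\<forall>y. (\<forall>i. y $ i \<in> A i) \<longrightarrow> y \<in> S)"
      unfolding open_vec_def by (drule_tac bspec) auto
    then have A: "\<And>i. open (A i)" "\<And>i. x $ i \<in> A i"
      and AS: "\<And>y. (\<And>i. y $ i \<in> A i) \<Longrightarrow> y \<in> S"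
      by auto
    have "\<forall>i. \<exists>b. b \<in> B \<and> x $ i \<in> b \<and> b \<subseteq> A i"
      using topological_basisE[OF tB A(1) A(2)] by metis
    then obtain F where F: "\<And>i. F i \<in> B" "\<And>i. x $ i \<in> F i" "\<And>i. F i \<subseteq> A i"
      by metis
    show "\<exists>S'\<in>D. x \<in> S' \<and> S' \<subseteq> S"
    proof (rule bexI)
      show "x \<in> {y. \<forall>i. y $ i \<in> F i} \<and> {y. \<forall>i. y $ i \<in> F i} \<subseteq> S"
        using F AS by blast
      show "{y. \<forall>i. y $ i \<in> F i} \<in> D"
        unfolding D_def using F(1) by (auto simp: PiE_iff)
    qed
  qed
  ultimately show "\<exists>D::('a ^ 'b) set set. countable D \<and> open = generate_topology D"
    using topological_basis_imp_subbasis by blast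
qed


subsection \<open>The statistic\<close>

text \<open>
  The map \<open>x \<mapsto> x / \<parallel>x\<parallel>\<close>, \<open>0 \<mapsto> 0\<close> is the library's \<^const>\<open>sgn\<close>.  Below, \<open>N k\<close> is the size of
  group \<open>k\<close>, and the observations \<open>x k i\<close> of group \<open>k\<close> are those with \<open>1 \<le> i \<le> N k\<close>.
  If \<open>N k = 0\<close> then \<open>rank_mean N x k = 0\<close>.
\<close>

definition rank_fun :: "('k::finite \<Rightarrow> nat) \<Rightarrow> ('k \<Rightarrow> nat \<Rightarrow> 'h::real_inner) \<Rightarrow> 'h \<Rightarrow> 'h" where
  "rank_fun N x y = (1 / real (\<Sum>k\<in>UNIV. N k)) *\<^sub>R (\<Sum>k\<in>UNIV. \<Sum>i=1..N k. sgn (y - x k i))"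

definition rank_mean :: "('k::finite \<Rightarrow> nat) \<Rightarrow> ('k \<Rightarrow> nat \<Rightarrow> 'h::real_inner) \<Rightarrow> 'k \<Rightarrow> 'h" where
  "rank_mean N x k = (1 / real (N k)) *\<^sub>R (\<Sum>i=1..N k. rank_fun N x (x k i))"

definition U_stat :: "('k::finite \<Rightarrow> nat) \<Rightarrow> ('k \<Rightarrow> nat \<Rightarrow> 'h::real_inner) \<Rightarrow> 'h ^ 'k" where
  "U_stat N x = (\<chi> k. sqrt (real (N k)) *\<^sub>R rank_mean N x k)"

definition SS_stat :: "('k::finite \<Rightarrow> nat) \<Rightarrow> ('k \<Rightarrow> nat \<Rightarrow> 'h::real_inner) \<Rightarrow> real" where
  "SS_stat N x = (norm (U_stat N x))\<^sup>2"

lemma SS_stat_eq_sum: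
  "SS_stat N x = (\<Sum>k\<in>UNIV. real (N k) * (norm (rank_mean N x k))\<^sup>2)"
proof -
  have "SS_stat N x = (\<Sum>k\<in>UNIV. (norm (U_stat N x $ k))\<^sup>2)"
    unfolding SS_stat_def norm_vec_def L2_set_def by (rule real_sqrt_pow2) (simp add: sum_nonneg)
  also have "\<dots> = (\<Sum>k\<in>UNIV. real (N k) * (norm (rank_mean N x k))\<^sup>2)"
    unfolding U_stat_def by (simp only: vec_lambda_beta norm_scaleR power_mult_distrib power2_abs)
      (simp only: of_nat_0_le_iff real_sqrt_pow2)
  finally show ?thesis .
qed


subsection \<open>Covariance operators\<close>

definition tensor :: "'h::real_inner \<Rightarrow> 'h \<Rightarrow> 'h \<Rightarrow> 'h" where
  "tensor x y w = (w \<bullet> x) *\<^sub>R y"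

text \<open>
  The space of bounded operators is not separable, so the expectation of an operator-valued
  random element \<open>T\<close> is taken pointwise: \<open>E[T] w = E[T w]\<close>.  For \<open>T = A \<otimes> B\<close> with
  \<open>E[\<parallel>A\<parallel> \<parallel>B\<parallel>] < \<infinity>\<close> this is the Bochner integral in the trace-class operators.
\<close>

definition Cov ::
  "'a measure \<Rightarrow> ('a \<Rightarrow> 'h::{real_inner, banach, second_countable_topology}) \<Rightarrow> ('a \<Rightarrow> 'h) \<Rightarrow> 'h \<Rightarrow> 'h"
  where
  "Cov M A B w = (LINT \<omega>|M. tensor (A \<omega>) (B \<omega>) w) - tensor (LINT \<omega>|M. A \<omega>) (LINT \<omega>|M. B \<omega>) w"

text \<open>
  The library has conditional expectations of real functions only.  \<open>cond_expectation M F f\<close> is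
  an arbitrary version; versions agree almost everywhere, hence yield the same \<^const>\<open>Cov\<close>.
\<close>

definition is_cond_expectation ::
  "'a measure \<Rightarrow> 'a measure \<Rightarrow> ('a \<Rightarrow> 'h::{real_inner, banach, second_countable_topology})
    \<Rightarrow> ('a \<Rightarrow> 'h) \<Rightarrow> bool" where
  "is_cond_expectation M F f g \<longleftrightarrow>
     g \<in> borel_measurable F \<and> integrable M g \<and>
     (\<forall>A\<in>sets F. (LINT \<omega>:A|M. g \<omega>) = (LINT \<omega>:A|M. f \<omega>))"

definition cond_expectation ::
  "'a measure \<Rightarrow> 'a measure \<Rightarrow> ('a \<Rightarrow> 'h::{real_inner, banach, second_countable_topology})
    \<Rightarrow> ('a \<Rightarrow> 'h)" where
  "cond_expectation M F f = (SOME g. is_cond_expectation M F f g)"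

text \<open>
  \<open>C_op P i j k\<close> is computed on the canonical space carrying independent \<open>X \<sim> P i\<close>,
  \<open>Y \<sim> P j\<close>, \<open>Z \<sim> P k\<close>, namely the product space with its coordinate maps.
\<close>

definition C_op ::
  "('k \<Rightarrow> 'h::{real_inner, banach, second_countable_topology} measure)
    \<Rightarrow> 'k \<Rightarrow> 'k \<Rightarrow> 'k \<Rightarrow> 'h \<Rightarrow> 'h" where
  "C_op P i j k =
    (let M = P i \<Otimes>\<^sub>M (P j \<Otimes>\<^sub>M P k);
         X = (\<lambda>(x, y, z). x); Y = (\<lambda>(x, y, z). y); Z = (\<lambda>(x, y, z). z);
         \<sigma>Z = vimage_algebra (space M) Z borel
     in Cov M (cond_expectation M \<sigma>Z (\<lambda>\<omega>. sgn (X \<omega> - Z \<omega>)))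
              (cond_expectation M \<sigma>Z (\<lambda>\<omega>. sgn (Y \<omega> - Z \<omega>))))"

definition Sigma_block ::
  "('k::finite \<Rightarrow> 'h::{real_inner, banach, second_countable_topology} measure) \<Rightarrow> ('k \<Rightarrow> real)
    \<Rightarrow> 'k \<Rightarrow> 'k \<Rightarrow> 'h \<Rightarrow> 'h" where
  "Sigma_block P lam k\<^sub>1 k\<^sub>2 u =
     sqrt (lam k\<^sub>1 * lam k\<^sub>2) *\<^sub>R
       (\<Sum>l\<in>UNIV. lam l *\<^sub>R (C_op P k\<^sub>1 k\<^sub>2 l u - C_op P l k\<^sub>2 k\<^sub>1 u - C_op P k\<^sub>1 l k\<^sub>2 u))
     + (if k\<^sub>1 = k\<^sub>2
        then \<Sum>l\<^sub>1\<in>UNIV. \<Sum>l\<^sub>2\<in>UNIV. (lam l\<^sub>1 * lam l\<^sub>2) *\<^sub>R C_op P l\<^sub>1 l\<^sub>2 k\<^sub>1 u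
        else 0)"

text \<open>
  Since \<open>x \<otimes> y\<close> sends \<open>w\<close> to \<open>\<langle>w, x\<rangle> y\<close>, the covariance of the components \<open>k\<^sub>1\<close> and \<open>k\<^sub>2\<close>
  maps component \<open>k\<^sub>1\<close> to component \<open>k\<^sub>2\<close>; so the block \<open>(k\<^sub>1, k\<^sub>2)\<close> contributes to the output
  component \<open>k\<^sub>2\<close>, as the lemma below confirms.
\<close>

definition Sigma_op ::
  "('k::finite \<Rightarrow> 'h::{real_inner, banach, second_countable_topology} measure) \<Rightarrow> ('k \<Rightarrow> real)
    \<Rightarrow> 'h ^ 'k \<Rightarrow> 'h ^ 'k" where
  "Sigma_op P lam u = (\<chi> k\<^sub>2. \<Sum>k\<^sub>1\<in>UNIV. Sigma_block P lam k\<^sub>1 k\<^sub>2 (u $ k\<^sub>1))"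

lemma tensor_vec_nth:
  "tensor x y u $ k\<^sub>2 = (\<Sum>k\<^sub>1\<in>UNIV. tensor (x $ k\<^sub>1) (y $ k\<^sub>2) (u $ k\<^sub>1))"
  by (simp add: tensor_def inner_vec_def scaleR_sum_left)


subsection \<open>Gaussian distributions and weak convergence\<close>

text \<open>
  A Borel probability measure is Gaussian if all continuous linear functionals (by Riesz, all
  inner products with a fixed vector) are normal, degenerate normal laws being admitted.
  Square integrability, automatic by Fernique's theorem, makes mean and covariance operator
  meaningful.
\<close>

definition gaussian_law ::
  "'h::{real_inner, banach, second_countable_topology} \<Rightarrow> ('h \<Rightarrow> 'h) \<Rightarrow> 'h measure \<Rightarrow> bool" where
  "gaussian_law m S G \<longleftrightarrow>
     prob_space G \<and> sets G = sets borel \<and>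
     (\<forall>h. (\<exists>\<mu> \<sigma>. 0 < \<sigma> \<and> distributed G lborel (\<lambda>x. x \<bullet> h) (normal_density \<mu> \<sigma>)) \<or>
          (\<exists>\<mu>. AE x in G. x \<bullet> h = \<mu>)) \<and>
     integrable G (\<lambda>x. (norm x)\<^sup>2) \<and>
     (LINT x|G. x) = m \<and>
     Cov G (\<lambda>x. x) (\<lambda>x. x) = S"

definition weakly_converges ::
  "(nat \<Rightarrow> 'b::topological_space measure) \<Rightarrow> 'b measure \<Rightarrow> bool" where
  "weakly_converges \<mu> \<nu> \<longleftrightarrow>
     (\<forall>f::'b \<Rightarrow> real. continuous_on UNIV f \<longrightarrow> bounded (range f) \<longrightarrow>
        (\<lambda>n. LINT x|\<mu> n. f x) \<longlonglongrightarrow> (LINT x|\<nu>. f x))"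

text \<open>On the real line this is the library's \<^const>\<open>weak_conv_m\<close>.\<close>

lemma weakly_converges_real_iff:
  fixes \<mu> :: "nat \<Rightarrow> real measure"
  assumes "\<And>n. real_distribution (\<mu> n)" and "real_distribution \<nu>"
  shows "weakly_converges \<mu> \<nu> \<longleftrightarrow> weak_conv_m \<mu> \<nu>"
proof
  assume w: "weakly_converges \<mu> \<nu>"
  show "weak_conv_m \<mu> \<nu>"
  proof (rule integral_bdd_continuous_conv_imp_weak_conv[OF assms])
    fix f :: "real \<Rightarrow> real"
    assume f: "\<And>x. isCont f x" "\<And>x. \<bar>f x\<bar> \<le> 1"
    have "continuous_on UNIV f" using f(1) by (simp add: continuous_at_imp_continuous_on)
    moreover have "bounded (range f)" using f(2) by (auto simp: bounded_iff)
    ultimately show "(\<lambda>n. integral\<^sup>L (\<mu> n) f) \<longlonglongrightarrow> integral\<^sup>L \<nu> f"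
      using w by (simp add: weakly_converges_def)
  qed
next
  assume w: "weak_conv_m \<mu> \<nu>"
  show "weakly_converges \<mu> \<nu>"
    unfolding weakly_converges_def
  proof (intro allI impI)
    fix f :: "real \<Rightarrow> real"
    assume f: "continuous_on UNIV f" "bounded (range f)"
    obtain B where "\<And>x. norm (f x) \<le> B" using f(2) by (auto simp: bounded_iff)
    then show "(\<lambda>n. LINT x|\<mu> n. f x) \<longlonglongrightarrow> (LINT x|\<nu>. f x)"
      using f(1) by (intro weak_conv_imp_integral_bdd_continuous_conv[OF assms w])
        (auto simp: continuous_on_eq_continuous_at)
  qed
qed

end

theory Submission
  imports Defs
begin

text \<open>
  Let \<open>\<psi> x = E sgn (x - Y)\<close> with \<open>Y \<sim> P\<close>.  By antisymmetry \<open>E \<psi>(Y) = 0\<close>, and the kernel splits as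
  \<open>sgn (x - y) = \<psi> x - \<psi> y + r x y\<close> with \<open>r\<close> degenerate.  Distinct pairs of observations give
  orthogonal values of \<open>r\<close>, so the contribution of \<open>r\<close> to the statistic has second moment \<open>O(1/n)\<close>.
  What remains is a weighted sum of independent bounded centered vectors \<open>\<psi>(X\<^sub>k\<^sub>i)\<close>.  Approximating
  \<open>\<psi>\<close> by simple functions shows that it is asymptotically tight, and a Lindeberg argument gives the
  limits of its one-dimensional characteristic functions.

  Tightness and characteristic functions together imply weak convergence without any
  finite-dimensional projections: on a compact set a continuous function is uniformly close to a
  trigonometric polynomial in finitely many functionals \<open>t \<bullet> x\<close>, whose expectations converge.

  The Gaussian limit is built as a random series \<open>\<Sum>j. g\<^sub>j a\<^sub>j\<close>.  No spectral theorem is needed: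
  vectors \<open>a\<^sub>j\<close> with \<open>\<Sum>j. a\<^sub>j \<otimes> a\<^sub>j\<close> equal to a given covariance come from Gram--Schmidt
  orthogonalization in \<open>L\<^sup>2\<close> of the functionals \<open>u\<^sub>j \<bullet> \<Psi>\<close>, for a dense sequence \<open>u\<^sub>j\<close>.
\<close>

subsection \<open>Weak convergence from tightness and trigonometric moments\<close>

text \<open>The argument runs for an arbitrary measurable, bounded, antisymmetric kernel; the
  spatial sign enters only at the end. Equality of the \<open>P k\<close> leaves a single function
  \<open>psi\<close>, and every \<open>C_op\<close> becomes the same operator C =
  E[psi \<otimes> psi]. Since the \<open>lam k\<close> sum to 1, the block (k, k') of
  \<open>Sigma_op\<close> collapses to \<open>proj k k'\<close> times C, where \<open>proj\<close>
  is the orthogonal projection onto the complement of the unit vector with entries sqrt(lam k). The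
  same matrix is the limit of the weights in the statistic, because the pooled mean of
  \<open>psi\<close> is subtracted from each group mean. The infinite-dimensional obstacle is
  tightness: limits of one-dimensional laws do not stop mass from escaping along infinitely many
  directions. A finitely valued approximation of \<open>psi\<close> confines the linear part to a
  fixed finite-dimensional subspace, up to a second moment that is small uniformly in n. As the
  probability spaces change with n, all approximations are second-moment bounds and none is an
  almost sure statement. Diagonal pairs cost nothing, because
  \<open>remainder x x = 0\<close>.\<close>

text \<open>The phase \<open>b\<close> yields sines, and frequency \<open>t = 0\<close> yields
  constants. So real and imaginary parts of characters belong to the class, and the real form of
  Stone--Weierstrass applies.\<close>

inductive trig_polynomial :: "('b::real_inner \<Rightarrow> real) \<Rightarrow> bool" where
  cosine: "trig_polynomial (\<lambda>x. a * cos (t \<bullet> x + b))"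
| sum: "trig_polynomial f \<Longrightarrow> trig_polynomial g \<Longrightarrow> trig_polynomial (\<lambda>x. f x + g x)"

lemma trig_polynomial_const: "trig_polynomial (\<lambda>_. c)"
  using trig_polynomial.cosine[of c 0 0] by simp

text \<open>The product-to-sum formula: frequencies and phases add and subtract, so a product of two
  generators is a sum of two generators.\<close>

lemma trig_polynomial_mult_cosine:
  assumes "trig_polynomial f"
  shows "trig_polynomial (\<lambda>x. f x * (a * cos (t \<bullet> x + b)))"
  using assms
proof induction
  case (cosine a' t' b')
  have "(\<lambda>x. a' * cos (t' \<bullet> x + b') * (a * cos (t \<bullet> x + b))) =
    (\<lambda>x. (a' * a / 2) * cos ((t' - t) \<bullet> x + (b' - b)) + (a' * a / 2) * cos ((t' + t) \<bullet> x + (b' + b)))"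
  proof
    fix x
    have "cos (t' \<bullet> x + b') * cos (t \<bullet> x + b)
        = (cos ((t' \<bullet> x + b') - (t \<bullet> x + b)) + cos ((t' \<bullet> x + b') + (t \<bullet> x + b))) / 2"
      by (simp add: cos_times_cos)
    also have "(t' \<bullet> x + b') - (t \<bullet> x + b) = (t' - t) \<bullet> x + (b' - b)"
      by (simp add: inner_diff_left)
    also have "(t' \<bullet> x + b') + (t \<bullet> x + b) = (t' + t) \<bullet> x + (b' + b)"
      by (simp add: inner_add_left)
    finally show "a' * cos (t' \<bullet> x + b') * (a * cos (t \<bullet> x + b)) =
      (a' * a / 2) * cos ((t' - t) \<bullet> x + (b' - b)) + (a' * a / 2) * cos ((t' + t) \<bullet> x + (b' + b))"
      by (simp add: field_simps)
  qed
  then show ?case by (simp only: trig_polynomial.intros)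
next
  case (sum f g)
  have "(\<lambda>x. (f x + g x) * (a * cos (t \<bullet> x + b))) =
     (\<lambda>x. f x * (a * cos (t \<bullet> x + b)) + g x * (a * cos (t \<bullet> x + b)))"
    by (simp add: distrib_right)
  then show ?case using trig_polynomial.sum[OF sum.IH] by simp
qed

lemma trig_polynomial_mult:
  assumes "trig_polynomial f" "trig_polynomial g"
  shows "trig_polynomial (\<lambda>x. f x * g x)"
  using assms(2)
proof induction
  case (cosine a t b)
  show ?case by (rule trig_polynomial_mult_cosine[OF assms(1)])
next
  case (sum g h)
  have "(\<lambda>x. f x * (g x + h x)) = (\<lambda>x. f x * g x + f x * h x)"
    by (simp add: distrib_left)
  then show ?case using trig_polynomial.sum[OF sum.IH] by simp
qed

lemma trig_polynomial_continuous: "trig_polynomial f \<Longrightarrow> continuous_on S f"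
  by (induction rule: trig_polynomial.induct) (auto intro!: continuous_intros)

lemma trig_polynomial_bounded:
  assumes "trig_polynomial f" obtains B where "\<And>x. \<bar>f x\<bar> \<le> B"
proof -
  from assms have "\<exists>B. \<forall>x. \<bar>f x\<bar> \<le> B"
  proof induction
    case (cosine a t b)
    have "\<bar>a * cos (t \<bullet> x + b)\<bar> \<le> \<bar>a\<bar>" for x
      by (simp add: abs_mult mult_left_le)
    then show ?case by blast
  next
    case (sum f g)
    then obtain B C where "\<And>x. \<bar>f x\<bar> \<le> B" "\<And>x. \<bar>g x\<bar> \<le> C" by auto
    then have "\<bar>f x + g x\<bar> \<le> B + C" for x
      by (meson abs_triangle_ineq add_mono order_trans)
    then show ?case by blast
  qed
  then show ?thesis using that by blast
qed

lemma trig_polynomial_compose: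
  assumes "real_polynomial_function q" "trig_polynomial p"
  shows "trig_polynomial (\<lambda>x. q (p x :: real))"
  using assms(1)
proof induction
  case (linear f)
  then obtain c where "f = (\<lambda>x. x * c)"
    by (metis real_bounded_linear)
  then show ?case
    using trig_polynomial_mult[OF assms(2) trig_polynomial_const[of c]] by simp
qed (auto intro: trig_polynomial_const trig_polynomial.sum trig_polynomial_mult)

lemma trig_polynomial_separates:
  fixes x y :: "'b::real_inner"
  assumes "x \<noteq> y"
  shows "\<exists>f. trig_polynomial f \<and> f x \<noteq> f y"
proof -
  define d where "d = x - y"
  \<comment> \<open>The scaling puts \<open>x\<close> and \<open>y\<close> a quarter turn apart, and
    the phase in \<open>f\<close> places \<open>y\<close> at angle 0, so the values are 0 and
    1.\<close>
  define t where "t = (pi / 2 / (d \<bullet> d)) *\<^sub>R d"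
  define f where "f = (\<lambda>z. 1 * cos (t \<bullet> z + (- (t \<bullet> y))))"
  have "d \<bullet> d \<noteq> 0" using assms by (simp add: d_def)
  moreover have "t \<bullet> x - t \<bullet> y = t \<bullet> d" by (simp add: d_def inner_diff_right)
  ultimately have "t \<bullet> x - t \<bullet> y = pi / 2" by (simp add: t_def)
  then have "t \<bullet> x + (- (t \<bullet> y)) = pi / 2" by simp
  then have "f x = 0" unfolding f_def by (simp only: cos_pi_half mult_zero_right)
  moreover have "f y = 1" by (simp add: f_def)
  ultimately
  show ?thesis
    unfolding f_def using trig_polynomial.cosine by (metis zero_neq_one)
qed

text \<open>The bound off \<open>K\<close> comes from clamping a Stone--Weierstrass approximant to \<open>{-B..B}\<close>;
  clamping preserves the algebra up to uniform error, since trigonometric polynomials are bounded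
  and are closed under composition with polynomials.\<close>

lemma trig_polynomial_approx_compact:
  fixes f :: "'b::real_inner \<Rightarrow> real"
  assumes f: "continuous_on UNIV f" and B: "\<And>x. \<bar>f x\<bar> \<le> B" and K: "compact K" and e: "0 < e"
  obtains g where "trig_polynomial g" "\<And>x. x \<in> K \<Longrightarrow> \<bar>f x - g x\<bar> \<le> e" "\<And>x. \<bar>g x\<bar> \<le> B + e"
proof -
  interpret function_ring_on "Collect (trig_polynomial :: ('b \<Rightarrow> real) \<Rightarrow> bool)" K
    by standard (auto intro: K trig_polynomial_continuous trig_polynomial.sum trig_polynomial_mult
        trig_polynomial_const trig_polynomial_separates)
  obtain p where p: "trig_polynomial p" "\<And>x. x \<in> K \<Longrightarrow> \<bar>f x - p x\<bar> < e / 2"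
    using Stone_Weierstrass_basic[of f "e/2"] f e continuous_on_subset[of UNIV f K] by auto
  obtain C where C: "\<And>x. \<bar>p x\<bar> \<le> C"
    using trig_polynomial_bounded[OF p(1)] by blast
  define clamp where "clamp = (\<lambda>r::real. max (-B) (min B r))"
  have "continuous_on {-C..C} clamp"
    unfolding clamp_def by (intro continuous_intros)
  then obtain q where q: "real_polynomial_function q" "\<And>r. r \<in> {-C..C} \<Longrightarrow> \<bar>clamp r - q r\<bar> < e / 2"
    using Stone_Weierstrass_real_polynomial_function[of "{-C..C}" clamp "e/2"] e by auto
  have pC: "p x \<in> {-C..C}" for x using C[of x] by auto
  have 1: "\<bar>clamp (p x) - q (p x)\<bar> < e / 2" for x using q(2)[OF pC] .
  have "B \<ge> 0" using B[of 0] by linarith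
  then have 2: "\<bar>clamp r\<bar> \<le> B" for r by (auto simp: clamp_def)
  have 3: "\<bar>f x - clamp r\<bar> \<le> \<bar>f x - r\<bar>" for x r
    using B[of x] by (auto simp: clamp_def)
  show ?thesis
  proof (rule that)
    show "trig_polynomial (\<lambda>x. q (p x))" by (rule trig_polynomial_compose[OF q(1) p(1)])
    show "\<bar>f x - q (p x)\<bar> \<le> e" if "x \<in> K" for x
      using p(2)[OF that] 1[of x] 3[of x "p x"] by linarith
    show "\<bar>q (p x)\<bar> \<le> B + e" for x
      using 1[of x] 2[of "p x"] e by linarith
  qed
qed

section \<open>Asymptotic tightness and compact containment\<close>

text \<open>Total boundedness in probability. Finite unions of balls, required only for large n,
  behave well under sums and small second-moment errors; compact sets are recovered in
  \<open>asymp_tight_compact\<close>.\<close>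

definition asymp_tight :: "(nat \<Rightarrow> 'a measure) \<Rightarrow> (nat \<Rightarrow> 'a \<Rightarrow> 'b::metric_space) \<Rightarrow> bool" where
  "asymp_tight M Y \<longleftrightarrow> (\<forall>e>0. \<forall>d>0. \<exists>F. finite F \<and>
     (\<forall>\<^sub>F n in sequentially. measure (M n) {\<omega>\<in>space (M n). Y n \<omega> \<notin> (\<Union>x\<in>F. ball x d)} \<le> e))"

lemma measurable_notin_sets:
  assumes "Y \<in> borel_measurable M" "B \<in> sets borel"
  shows "{\<omega>\<in>space M. Y \<omega> \<notin> B} \<in> sets M"
proof -
  have "{\<omega>\<in>space M. Y \<omega> \<notin> B} = Y -` (- B) \<inter> space M" by auto
  then show ?thesis using measurable_sets[OF assms(1), of "- B"] assms(2) by auto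
qed

text \<open>Separability: the events that \<open>Y\<close> avoids the balls around the first m
  points of a dense sequence decrease to the empty set.\<close>

lemma (in prob_space) ball_cover_prob:
  fixes Y :: "'a \<Rightarrow> 'b::{metric_space, second_countable_topology}"
  assumes [measurable]: "Y \<in> borel_measurable M" and e: "0 < e" and d: "0 < d"
  obtains F where "finite F" "prob {\<omega>\<in>space M. Y \<omega> \<notin> (\<Union>x\<in>F. ball x d)} \<le> e"
proof -
  obtain D :: "'b set" where D: "countable D" "\<And>X. open X \<Longrightarrow> X \<noteq> {} \<Longrightarrow> \<exists>z\<in>D. z \<in> X"
    using countable_dense_setE by blast
  have "D \<noteq> {}" using D(2)[of UNIV] by auto
  define u where "u = from_nat_into D"
  have u: "range u = D" unfolding u_def using D(1) \<open>D \<noteq> {}\<close> by (rule range_from_nat_into[rotated])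
  define A where "A = (\<lambda>m. {\<omega>\<in>space M. Y \<omega> \<notin> (\<Union>x\<in>u`{..<m}. ball x d)})"
  have A_meas: "A m \<in> sets M" for m
    unfolding A_def by (intro measurable_notin_sets assms(1) borel_open) auto
  have "decseq A" unfolding A_def by (rule decseq_SucI) auto
  moreover have "(\<Inter>m. A m) = {}"
  proof safe
    fix \<omega> assume w: "\<omega> \<in> (\<Inter>m. A m)"
    obtain z where "z \<in> D" "z \<in> ball (Y \<omega>) d" using D(2)[of "ball (Y \<omega>) d"] d by auto
    then obtain m where "u m = z" using u by auto
    then have "Y \<omega> \<in> ball (u m) d" using \<open>z \<in> ball (Y \<omega>) d\<close> by (simp add: dist_commute)
    moreover have "\<omega> \<in> A (Suc m)" using w by blast
    ultimately show "\<omega> \<in> {}" unfolding A_def by auto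
  qed
  ultimately have "(\<lambda>m. prob (A m)) \<longlonglongrightarrow> 0"
    using finite_Lim_measure_decseq[of A] A_meas by auto
  then have "\<forall>\<^sub>F m in sequentially. prob (A m) < e" using e by (rule order_tendstoD)
  then obtain m where "prob (A m) < e" by (auto simp: eventually_sequentially)
  then show ?thesis using that[of "u`{..<m}"] by (auto simp: A_def)
qed

text \<open>Completeness turns total boundedness in probability into one compact set that serves all
  n, including the initial ones.\<close>

lemma asymp_tight_compact:
  fixes Y :: "nat \<Rightarrow> 'a \<Rightarrow> 'b::{complete_space, second_countable_topology}"
  assumes M: "\<And>n. prob_space (M n)" and [measurable]: "\<And>n. Y n \<in> borel_measurable (M n)"
    and Y: "asymp_tight M Y" and e: "0 < e"
  obtains K where "compact K" "\<And>n. measure (M n) {\<omega>\<in>space (M n). Y n \<omega> \<notin> K} \<le> e"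
proof -
  have *: "\<exists>F. finite F \<and> (\<forall>n. measure (M n) {\<omega>\<in>space (M n). Y n \<omega> \<notin> (\<Union>x\<in>F. ball x d)} \<le> \<epsilon>)"
    if \<epsilon>: "0 < \<epsilon>" and d: "0 < d" for \<epsilon> d
  proof -
    obtain F m where F: "finite F"
      and m: "\<And>n. n \<ge> m \<Longrightarrow> measure (M n) {\<omega>\<in>space (M n). Y n \<omega> \<notin> (\<Union>x\<in>F. ball x d)} \<le> \<epsilon>"
      using Y \<epsilon> d unfolding asymp_tight_def eventually_sequentially by blast
    have "\<exists>F. finite F \<and> measure (M n) {\<omega>\<in>space (M n). Y n \<omega> \<notin> (\<Union>x\<in>F. ball x d)} \<le> \<epsilon>" for n
      using prob_space.ball_cover_prob[OF M, of "Y n" n \<epsilon> d] \<epsilon> d by (metis assms(2))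
    then obtain G where G: "\<And>n. finite (G n)"
      "\<And>n. measure (M n) {\<omega>\<in>space (M n). Y n \<omega> \<notin> (\<Union>x\<in>G n. ball x d)} \<le> \<epsilon>" by metis
    \<comment> \<open>Only finitely many n escape the control by \<open>F\<close>; each of these
      measures gets its own finite cover \<open>G n\<close>.\<close>
    define H where "H = F \<union> (\<Union>n<m. G n)"
    have mono: "measure (M n) {\<omega>\<in>space (M n). Y n \<omega> \<notin> (\<Union>x\<in>H. ball x d)}
        \<le> measure (M n) {\<omega>\<in>space (M n). Y n \<omega> \<notin> (\<Union>x\<in>F'. ball x d)}" if "F' \<subseteq> H" for F' n
    proof -
      interpret prob_space "M n" by (rule M)
      have "{\<omega>\<in>space (M n). Y n \<omega> \<notin> (\<Union>x\<in>F'. ball x d)} \<in> sets (M n)"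
        by (intro measurable_notin_sets assms(2) borel_open) auto
      then show ?thesis using that by (intro finite_measure_mono) auto
    qed
    have "measure (M n) {\<omega>\<in>space (M n). Y n \<omega> \<notin> (\<Union>x\<in>H. ball x d)} \<le> \<epsilon>" for n
    proof (cases "n < m")
      case True
      then have "G n \<subseteq> H" unfolding H_def by auto
      from mono[OF this] G(2) show ?thesis by (rule order_trans)
    next
      case False
      have "F \<subseteq> H" unfolding H_def by auto
      from mono[OF this] m[of n] False show ?thesis by (meson not_less order_trans)
    qed
    moreover have "finite H" using F G(1) by (auto simp: H_def)
    ultimately show ?thesis by blast
  qed
  \<comment> \<open>Radii 1/(j+1) are paired with errors e/2^(j+1): the errors add up to e, and the
    radii tend to 0, which makes the intersection totally bounded.\<close>
  define d where "d = (\<lambda>j::nat. 1 / real (Suc j))"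
  have d: "d j > 0" for j by (simp add: d_def)
  have "\<exists>F. finite F \<and> (\<forall>n. measure (M n) {\<omega>\<in>space (M n). Y n \<omega> \<notin> (\<Union>x\<in>F. ball x (d j))} \<le> e * (1/2)^Suc j)" for j
    using *[of "e * (1/2)^Suc j" "d j"] e d by simp
  then obtain F where F: "\<And>j. finite (F j)"
    "\<And>j n. measure (M n) {\<omega>\<in>space (M n). Y n \<omega> \<notin> (\<Union>x\<in>F j. ball x (d j))} \<le> e * (1/2)^Suc j"
    by metis
  \<comment> \<open>Passing to closed balls makes \<open>K\<close> closed, hence complete, and only
    shrinks the exceptional events.\<close>
  define K where "K = (\<Inter>j. \<Union>x\<in>F j. cball x (d j))"
  have "closed K" unfolding K_def using F(1) by (intro closed_INT ballI closed_UN) auto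
  have "\<exists>k. finite k \<and> K \<subseteq> (\<Union>x\<in>k. ball x \<epsilon>)" if eps: "0 < \<epsilon>" for \<epsilon>
  proof -
    obtain j where j: "d j < \<epsilon>" using nat_approx_posE[OF eps] unfolding d_def by blast
    have "K \<subseteq> (\<Union>x\<in>F j. cball x (d j))" unfolding K_def by auto
    also have "\<dots> \<subseteq> (\<Union>x\<in>F j. ball x \<epsilon>)" using j by fastforce
    finally show ?thesis using F(1) by blast
  qed
  with \<open>closed K\<close> have "compact K"
    by (simp add: compact_eq_totally_bounded complete_eq_closed)
  moreover have "measure (M n) {\<omega>\<in>space (M n). Y n \<omega> \<notin> K} \<le> e" for n
  proof -
    interpret prob_space "M n" by (rule M)
    define E where "E = (\<lambda>j. {\<omega>\<in>space (M n). Y n \<omega> \<notin> (\<Union>x\<in>F j. cball x (d j))})"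
    have E_meas: "E j \<in> sets (M n)" for j
      unfolding E_def using F(1) by (intro measurable_notin_sets assms(2) borel_closed closed_UN) auto
    have E_le: "prob (E j) \<le> e * (1/2)^Suc j" for j
    proof -
      have "{\<omega>\<in>space (M n). Y n \<omega> \<notin> (\<Union>x\<in>F j. ball x (d j))} \<in> sets (M n)"
        by (intro measurable_notin_sets assms(2) borel_open) auto
      then have "prob (E j) \<le> prob {\<omega>\<in>space (M n). Y n \<omega> \<notin> (\<Union>x\<in>F j. ball x (d j))}"
        unfolding E_def by (intro finite_measure_mono) (auto simp: less_le)
      then show ?thesis using F(2) by (rule order_trans)
    qed
    have s: "(\<lambda>j. e * (1/2)^Suc j) sums e"
      using sums_mult[OF power_half_series, of e] by simp
    have sm: "summable (\<lambda>j. prob (E j))"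
      by (rule summable_comparison_test'[OF sums_summable[OF s], of 0]) (simp only: real_norm_def abs_of_nonneg[OF measure_nonneg] E_le)
    have "prob (\<Union>j. E j) \<le> (\<Sum>j. prob (E j))"
      using E_meas sm by (intro finite_measure_subadditive_countably) auto
    also have "\<dots> \<le> (\<Sum>j. e * (1/2)^Suc j)"
      using E_le sm sums_summable[OF s] by (rule suminf_le)
    also have "\<dots> = e" using s by (simp add: sums_iff)
    also have "(\<Union>j. E j) = {\<omega>\<in>space (M n). Y n \<omega> \<notin> K}"
      unfolding E_def K_def by auto
    finally show ?thesis .
  qed
  ultimately show ?thesis using that by blast
qed


lemma (in prob_space) expectation_diff_le_off_set:
  fixes f g :: "'b::topological_space \<Rightarrow> real"
  assumes [measurable]: "Y \<in> borel_measurable M" "f \<in> borel_measurable borel" "g \<in> borel_measurable borel"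
    and f: "\<And>x. \<bar>f x\<bar> \<le> B" and g: "\<And>x. \<bar>g x\<bar> \<le> C" and K: "K \<in> sets borel"
    and fg: "\<And>x. x \<in> K \<Longrightarrow> \<bar>f x - g x\<bar> \<le> e" and e: "0 \<le> e"
  shows "\<bar>expectation (\<lambda>\<omega>. f (Y \<omega>)) - expectation (\<lambda>\<omega>. g (Y \<omega>))\<bar>
    \<le> e + (B + C) * prob {\<omega>\<in>space M. Y \<omega> \<notin> K}"
proof -
  define E where "E = {\<omega>\<in>space M. Y \<omega> \<notin> K}"
  have [measurable]: "E \<in> sets M" unfolding E_def using assms(1) K by (rule measurable_notin_sets)
  have int: "integrable M (\<lambda>\<omega>. f (Y \<omega>))" "integrable M (\<lambda>\<omega>. g (Y \<omega>))"
    by (rule integrable_const_bound[of _ B], use f in auto)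
       (rule integrable_const_bound[of _ C], use g in auto)
  have "\<bar>expectation (\<lambda>\<omega>. f (Y \<omega>)) - expectation (\<lambda>\<omega>. g (Y \<omega>))\<bar>
      = \<bar>expectation (\<lambda>\<omega>. f (Y \<omega>) - g (Y \<omega>))\<bar>"
    using int by simp
  also have "\<dots> \<le> expectation (\<lambda>\<omega>. \<bar>f (Y \<omega>) - g (Y \<omega>)\<bar>)"
    using int by (intro integral_abs_bound)
  also have "\<dots> \<le> expectation (\<lambda>\<omega>. e + (B + C) * indicator E \<omega>)"
  proof (rule integral_mono)
    show "integrable M (\<lambda>\<omega>. \<bar>f (Y \<omega>) - g (Y \<omega>)\<bar>)" using int by auto
    show "integrable M (\<lambda>\<omega>. e + (B + C) * indicator E \<omega>)" by (simp add: integrable_real_indicator emeasure_eq_measure)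
    fix \<omega> assume "\<omega> \<in> space M"
    then show "\<bar>f (Y \<omega>) - g (Y \<omega>)\<bar> \<le> e + (B + C) * indicator E \<omega>"
      using fg[of "Y \<omega>"] f[of "Y \<omega>"] g[of "Y \<omega>"] e by (auto simp: E_def indicator_def abs_le_iff)
  qed
  also have "\<dots> = e + (B + C) * prob E" by (simp add: prob_space emeasure_eq_measure)
  finally show ?thesis unfolding E_def .
qed

theorem weakly_converges_if_tight_and_cosines:
  fixes Y :: "nat \<Rightarrow> 'a \<Rightarrow> 'b::{real_inner, banach, second_countable_topology}"
  assumes M: "\<And>n. prob_space (M n)" and Y[measurable]: "\<And>n. Y n \<in> borel_measurable (M n)"
    and G: "prob_space G" "sets G = sets borel"
    and tight: "asymp_tight M Y"
    and cosines: "\<And>t b. (\<lambda>n. LINT \<omega>|M n. cos (t \<bullet> Y n \<omega> + b)) \<longlonglongrightarrow> (LINT x|G. cos (t \<bullet> x + b))"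
  shows "weakly_converges (\<lambda>n. distr (M n) borel (Y n)) G"
  unfolding weakly_converges_def
proof (intro allI impI)
  fix f :: "'b \<Rightarrow> real" assume f: "continuous_on UNIV f" and "bounded (range f)"
  then obtain B where B: "\<And>x. \<bar>f x\<bar> \<le> B" by (auto simp: bounded_iff)
  have "0 \<le> B" using B[of 0] by linarith
  interpret G: prob_space G by (rule G)
  have [measurable_cong]: "sets G = sets borel" by (rule G)
  have f_meas[measurable]: "f \<in> borel_measurable borel" using f by (rule borel_measurable_continuous_onI)
  have trig_conv: "(\<lambda>n. LINT \<omega>|M n. g (Y n \<omega>)) \<longlonglongrightarrow> (LINT x|G. g x)" if "trig_polynomial g" for g
    using that
  proof induction
    case (cosine a t b)
    show ?case using cosines by (auto intro!: tendsto_intros)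
  next
    case (sum g h)
    have int: "integrable N (\<lambda>\<omega>. g (Z \<omega>))"
      if g: "trig_polynomial g" and "prob_space N" and Z: "Z \<in> borel_measurable N" for g :: "'b \<Rightarrow> real" and N :: "'c measure" and Z
    proof -
      interpret prob_space N by fact
      obtain C where "\<And>x. \<bar>g x\<bar> \<le> C" using trig_polynomial_bounded[OF g] by blast
      moreover have "g \<in> borel_measurable borel"
        using trig_polynomial_continuous[OF g] by (rule borel_measurable_continuous_onI)
      ultimately show ?thesis
        using Z by (intro integrable_const_bound[of _ C]) auto
    qed
    have "(\<lambda>n. LINT \<omega>|M n. g (Y n \<omega>) + h (Y n \<omega>)) = (\<lambda>n. (LINT \<omega>|M n. g (Y n \<omega>)) + (LINT \<omega>|M n. h (Y n \<omega>)))"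
      using int[OF sum.hyps(1) M Y] int[OF sum.hyps(2) M Y] by (simp add: Bochner_Integration.integral_add)
    moreover have "(LINT x|G. g x + h x) = (LINT x|G. g x) + (LINT x|G. h x)"
      using int[OF sum.hyps(1) G(1), of "\<lambda>x. x"] int[OF sum.hyps(2) G(1), of "\<lambda>x. x"]
      by (intro Bochner_Integration.integral_add) auto
    ultimately show ?case using tendsto_add[OF sum.IH] by simp
  qed
  have "(\<lambda>n. LINT \<omega>|M n. f (Y n \<omega>)) \<longlonglongrightarrow> (LINT x|G. f x)"
  proof (rule LIMSEQ_I)
    fix e :: real assume e: "0 < e"
    \<comment> \<open>With \<eta> at most 1, the square of \<eta> is at most \<eta>, so twice the
      error \<eta> + (2B + \<eta>)\<eta> is at most 2\<eta>(2B + 2), hence at most e/2. The other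
      half of e is left for the convergence of the trigonometric moments.\<close>
    define \<eta> where "\<eta> = min 1 (e / (4 * (2 * B + 2)))"
    have \<eta>: "0 < \<eta>" "\<eta> \<le> 1" using e \<open>0 \<le> B\<close> by (auto simp: \<eta>_def)
    have "\<eta> \<le> e / (4 * (2 * B + 2))" by (simp add: \<eta>_def)
    then have "\<eta> * (4 * (2 * B + 2)) \<le> e" using \<open>0 \<le> B\<close> by (subst (asm) pos_le_divide_eq) auto
    moreover have "\<eta> * \<eta> \<le> \<eta>" using \<eta> by (simp add: mult_left_le)
    ultimately have \<eta>e: "2 * (\<eta> + (B + (B + \<eta>)) * \<eta>) \<le> e / 2"
      by (simp add: algebra_simps)
    obtain K1 where K1: "compact K1" "\<And>n. measure (M n) {\<omega>\<in>space (M n). Y n \<omega> \<notin> K1} \<le> \<eta>"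
      using asymp_tight_compact[OF M Y tight \<eta>(1)] by blast
    \<comment> \<open>The limit is treated as a constant sequence, so that the same lemma supplies a
      compact set for it.\<close>
    have "asymp_tight (\<lambda>_. G) (\<lambda>_ x. x)"
      unfolding asymp_tight_def
    proof (intro allI impI)
      fix e d :: real assume "0 < e" "0 < d"
      then obtain F where "finite F" "measure G {x\<in>space G. x \<notin> (\<Union>y\<in>F. ball y d)} \<le> e"
        using G.ball_cover_prob[of "\<lambda>x. x" e d] by (auto simp: measurable_ident_sets G(2))
      then show "\<exists>F. finite F \<and> (\<forall>\<^sub>F n in sequentially. measure G {x\<in>space G. x \<notin> (\<Union>y\<in>F. ball y d)} \<le> e)"
        by (intro exI[of _ F]) simp
    qed
    then obtain K2 where K2: "compact K2" "measure G {x\<in>space G. x \<notin> K2} \<le> \<eta>"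
      using asymp_tight_compact[of "\<lambda>_. G" "\<lambda>_ x. x" \<eta>] G \<eta>(1) by (auto cong: measurable_cong_sets)
    define K where "K = K1 \<union> K2"
    have "compact K" unfolding K_def using K1 K2 by (intro compact_Un)
    then have K_sets: "K \<in> sets borel" by (intro borel_closed compact_imp_closed)
    have KM: "measure (M n) {\<omega>\<in>space (M n). Y n \<omega> \<notin> K} \<le> \<eta>" for n
    proof -
      interpret prob_space "M n" by (rule M)
      have "measure (M n) {\<omega>\<in>space (M n). Y n \<omega> \<notin> K} \<le> measure (M n) {\<omega>\<in>space (M n). Y n \<omega> \<notin> K1}"
        using K1(1) by (intro finite_measure_mono measurable_notin_sets Y borel_closed compact_imp_closed) (auto simp: K_def)
      with K1(2)[of n] show ?thesis by linarith
    qed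
    have KG: "measure G {x\<in>space G. x \<notin> K} \<le> \<eta>"
    proof -
      have "measure G {x\<in>space G. x \<notin> K} \<le> measure G {x\<in>space G. x \<notin> K2}"
        using K2(1) by (intro G.finite_measure_mono measurable_notin_sets borel_closed compact_imp_closed) (auto simp: K_def)
      with K2(2) show ?thesis by linarith
    qed
    obtain g where g: "trig_polynomial g" "\<And>x. x \<in> K \<Longrightarrow> \<bar>f x - g x\<bar> \<le> \<eta>" "\<And>x. \<bar>g x\<bar> \<le> B + \<eta>"
      using trig_polynomial_approx_compact[OF f B \<open>compact K\<close> \<eta>(1)] by blast
    have g_meas: "g \<in> borel_measurable borel"
      using trig_polynomial_continuous[OF g(1)] by (rule borel_measurable_continuous_onI)
    have BB: "0 \<le> B + (B + \<eta>)" using \<open>0 \<le> B\<close> \<eta> by simp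
    have 1: "\<bar>(LINT \<omega>|M n. f (Y n \<omega>)) - (LINT \<omega>|M n. g (Y n \<omega>))\<bar> \<le> \<eta> + (B + (B + \<eta>)) * \<eta>" for n
      using prob_space.expectation_diff_le_off_set[OF M Y f_meas g_meas B g(3) K_sets g(2), of n] \<eta>(1)
        mult_left_mono[OF KM[of n] BB] by linarith
    have 2: "\<bar>(LINT x|G. f x) - (LINT x|G. g x)\<bar> \<le> \<eta> + (B + (B + \<eta>)) * \<eta>"
      using G.expectation_diff_le_off_set[OF _ f_meas g_meas B g(3) K_sets g(2), of "\<lambda>x. x"] \<eta>(1)
        mult_left_mono[OF KG BB] by (auto simp: measurable_ident_sets G(2))
    obtain m where m: "\<And>n. n \<ge> m \<Longrightarrow> \<bar>(LINT \<omega>|M n. g (Y n \<omega>)) - (LINT x|G. g x)\<bar> < e / 2"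
      using LIMSEQ_D[OF trig_conv[OF g(1)], of "e/2"] e by auto
    have triangle: "\<bar>a - c\<bar> < e"
      if "\<bar>a - b\<bar> \<le> z" "\<bar>c - d\<bar> \<le> z" "\<bar>b - d\<bar> < e / 2" "2 * z \<le> e / 2" for a b c d z :: real
      using that by linarith
    show "\<exists>m. \<forall>n\<ge>m. norm ((LINT \<omega>|M n. f (Y n \<omega>)) - (LINT x|G. f x)) < e"
    proof (intro exI allI impI)
      fix n assume "m \<le> n"
      from m[OF this] show "norm ((LINT \<omega>|M n. f (Y n \<omega>)) - (LINT x|G. f x)) < e"
        unfolding real_norm_def by (rule triangle[OF 1 2 _ \<eta>e])
    qed
  qed
  then show "(\<lambda>n. LINT x|distr (M n) borel (Y n). f x) \<longlonglongrightarrow> (LINT x|G. f x)"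
    by (simp add: integral_distr)
qed

subsection \<open>Gaussian laws on Hilbert spaces\<close>

text \<open>Cosine moments are real parts of rotated characteristic functions. The frequency is
  fixed at 1 because \<open>Z\<close> already contains the functional.\<close>

lemma (in prob_space) expectation_cos_eq_char:
  assumes [measurable]: "Z \<in> borel_measurable M"
  shows "expectation (\<lambda>\<omega>. cos (Z \<omega> + b)) = Re (iexp b * char (distr M borel Z) 1)"
proof -
  have int: "integrable M (\<lambda>\<omega>. iexp (Z \<omega>))"
    by (rule integrable_const_bound[of _ 1]) auto
  have "expectation (\<lambda>\<omega>. cos (Z \<omega> + b)) = expectation (\<lambda>\<omega>. Re (iexp b * iexp (Z \<omega>)))"
    by (intro Bochner_Integration.integral_cong refl) (simp add: Re_exp Im_exp cos_add mult.commute)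
  also have "\<dots> = Re (expectation (\<lambda>\<omega>. iexp b * iexp (Z \<omega>)))"
    using int by (intro integral_Re) auto
  also have "\<dots> = Re (iexp b * char (distr M borel Z) 1)"
    unfolding char_def using int by (simp add: integral_distr)
  finally show ?thesis .
qed

lemma char_density_normal:
  assumes "distributed M lborel Z (normal_density 0 s)" "0 < s" "prob_space M"
  shows "char (distr M borel Z) t = exp (- (t * s)\<^sup>2 / 2)"
proof -
  interpret prob_space M by fact
  have Z[measurable]: "Z \<in> borel_measurable M"
    using distributed_measurable[OF assms(1)] by simp
  have D: "distributed M lborel (\<lambda>x. Z x / s) std_normal_density"
    using normal_standard_normal_convert[OF assms(2), of Z 0] assms(1) by simp
  have "distr M borel (\<lambda>x. Z x / s) = distr M lborel (\<lambda>x. Z x / s)"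
    by (rule distr_cong) auto
  also have "\<dots> = std_normal_distribution"
    using D by (simp add: distributed_def)
  finally have "char (distr M borel (\<lambda>x. Z x / s)) (t * s) = exp (- (t * s)\<^sup>2 / 2)"
    by (simp add: char_std_normal_distribution)
  then show ?thesis using assms(2) by (simp add: char_def integral_distr)
qed

lemma integrable_inner_mult:
  fixes x :: "'a \<Rightarrow> 'b::{real_inner, second_countable_topology}"
  assumes [measurable]: "x \<in> borel_measurable M" and "integrable M (\<lambda>\<omega>. (norm (x \<omega>))\<^sup>2)"
  shows "integrable M (\<lambda>\<omega>. (x \<omega> \<bullet> u) * (x \<omega> \<bullet> v))"
proof (rule Bochner_Integration.integrable_bound)
  show "integrable M (\<lambda>\<omega>. norm u * norm v * (norm (x \<omega>))\<^sup>2)" using assms(2) by simp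
  show "AE \<omega> in M. norm ((x \<omega> \<bullet> u) * (x \<omega> \<bullet> v)) \<le> norm (norm u * norm v * (norm (x \<omega>))\<^sup>2)"
  proof (intro AE_I2)
    fix \<omega>
    have "\<bar>x \<omega> \<bullet> u\<bar> * \<bar>x \<omega> \<bullet> v\<bar> \<le> (norm (x \<omega>) * norm u) * (norm (x \<omega>) * norm v)"
      by (intro mult_mono Cauchy_Schwarz_ineq2) auto
    then show "norm ((x \<omega> \<bullet> u) * (x \<omega> \<bullet> v)) \<le> norm (norm u * norm v * (norm (x \<omega>))\<^sup>2)"
      by (simp add: abs_mult power2_eq_square algebra_simps)
  qed
qed measurable

lemma (in prob_space) integrable_of_square:
  fixes x :: "'a \<Rightarrow> 'b::{real_normed_vector, second_countable_topology}"
  assumes [measurable]: "x \<in> borel_measurable M" and "integrable M (\<lambda>\<omega>. (norm (x \<omega>))\<^sup>2)"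
  shows "integrable M (\<lambda>\<omega>. norm (x \<omega>))"
proof (rule Bochner_Integration.integrable_bound)
  show "integrable M (\<lambda>\<omega>. 1 + (norm (x \<omega>))\<^sup>2)" using assms(2) by simp
  have "norm (x \<omega>) \<le> 1 + (norm (x \<omega>))\<^sup>2" for \<omega>
    using zero_le_power2[of "norm (x \<omega>) - 1/2"] by (simp add: power2_eq_square algebra_simps)
  then show "AE \<omega> in M. norm (norm (x \<omega>)) \<le> norm (1 + (norm (x \<omega>))\<^sup>2)"
    by (intro AE_I2) (simp add: order_trans[OF _ abs_ge_self])
qed measurable

lemma Cov_centered_inner:
  fixes G :: "'b::{real_inner, banach, second_countable_topology} measure"
  assumes "sets G = sets borel" "integrable G (\<lambda>x. (norm x)\<^sup>2)" "(LINT x|G. x) = 0"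
  shows "Cov G (\<lambda>x. x) (\<lambda>x. x) u \<bullet> v = (LINT x|G. (x \<bullet> u) * (x \<bullet> v))"
proof -
  have [measurable_cong]: "sets G = sets borel" by (rule assms)
  have "integrable G (\<lambda>x. (u \<bullet> x) *\<^sub>R x)"
  proof (rule Bochner_Integration.integrable_bound)
    show "integrable G (\<lambda>x. norm u * (norm x)\<^sup>2)" using assms(2) by simp
    have "\<bar>u \<bullet> x\<bar> * norm x \<le> (norm u * norm x) * norm x" for x
      by (intro mult_right_mono Cauchy_Schwarz_ineq2) auto
    then show "AE x in G. norm ((u \<bullet> x) *\<^sub>R x) \<le> norm (norm u * (norm x)\<^sup>2)"
      by (intro AE_I2) (simp add: power2_eq_square algebra_simps)
  qed measurable
  from integral_inner_left[OF this, of v] show ?thesis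
    by (simp add: Cov_def tensor_def assms(3) inner_commute)
qed

text \<open>Since the law is centered, \<open>x \<bullet> t\<close> has variance
  \<open>S t \<bullet> t\<close> and a real characteristic function; the phase then contributes only
  its cosine. The degenerate case fits the same formula with variance 0.\<close>

lemma gaussian_law_cosine:
  assumes "gaussian_law 0 S G"
  shows "(LINT x|G. cos (t \<bullet> x + b)) = cos b * exp (- (S t \<bullet> t) / 2)"
proof -
  have G: "prob_space G" "sets G = sets borel" "integrable G (\<lambda>x. (norm x)\<^sup>2)" "(LINT x|G. x) = 0"
    "Cov G (\<lambda>x. x) (\<lambda>x. x) = S"
    and normal: "(\<exists>\<mu> \<sigma>. 0 < \<sigma> \<and> distributed G lborel (\<lambda>x. x \<bullet> t) (normal_density \<mu> \<sigma>)) \<or> (\<exists>\<mu>. AE x in G. x \<bullet> t = \<mu>)"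
    using assms unfolding gaussian_law_def by auto
  interpret prob_space G by (rule G)
  have [measurable_cong]: "sets G = sets borel" by (rule G)
  have int: "integrable G (\<lambda>x. x)"
    using integrable_of_square[of "\<lambda>x. x"] G(3) by (subst integrable_norm_iff[symmetric]) auto
  have mean: "expectation (\<lambda>x. x \<bullet> t) = 0"
    using integral_inner_left[OF int, of t] G(4) by simp
  have St: "S t \<bullet> t = expectation (\<lambda>x. (x \<bullet> t)\<^sup>2)"
    using Cov_centered_inner[OF G(2,3,4), of t t] G(5) by (simp add: power2_eq_square)
  from normal show ?thesis
  proof (elim disjE exE conjE)
    fix \<mu> \<sigma> assume D: "0 < \<sigma>" "distributed G lborel (\<lambda>x. x \<bullet> t) (normal_density \<mu> \<sigma>)"
    have "\<mu> = 0" using normal_distributed_expectation[OF D] mean by simp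
    then have "S t \<bullet> t = \<sigma>\<^sup>2" using normal_distributed_variance[OF D] mean St by simp
    moreover have "char (distr G borel (\<lambda>x. x \<bullet> t)) 1 = exp (- (1 * \<sigma>)\<^sup>2 / 2)"
      using char_density_normal[of G "\<lambda>x. x \<bullet> t" \<sigma> 1] D \<open>\<mu> = 0\<close> prob_space_axioms by simp
    ultimately show ?thesis
      using expectation_cos_eq_char[of "\<lambda>x. x \<bullet> t" b] by (simp add: inner_commute Re_exp)
  next
    fix \<mu> assume \<mu>: "AE x in G. x \<bullet> t = \<mu>"
    then have "expectation (\<lambda>x. x \<bullet> t) = expectation (\<lambda>x. \<mu>)" by (intro integral_cong_AE) auto
    then have "\<mu> = 0" using mean by (simp add: prob_space)
    then have "expectation (\<lambda>x. (x \<bullet> t)\<^sup>2) = expectation (\<lambda>x. 0)" 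
      using \<mu> by (intro integral_cong_AE) auto
    moreover have "(LINT x|G. cos (t \<bullet> x + b)) = expectation (\<lambda>x. cos b)"
      using \<mu> \<open>\<mu> = 0\<close> by (intro integral_cong_AE) (auto simp: inner_commute)
    ultimately show ?thesis using St by (simp add: prob_space)
  qed
qed

text \<open>Step \<open>j\<close> of the Gram--Schmidt recursion removes from the residual \<open>R j\<close> its regression on the scalar
  \<open>R j \<bullet> u j\<close>, where \<open>u\<close> is dense; the regression coefficient is \<open>a j\<close>.  If \<open>R j \<bullet> u j\<close> vanishes almost
  surely, then the division by \<open>0\<close> in \<open>f\<close> makes \<open>a j = 0\<close>.\<close>

lemma (in prob_space) covariance_factorization:
  fixes \<Psi> :: "'a \<Rightarrow> 'b::{real_inner, banach, second_countable_topology}"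
  assumes [measurable]: "\<Psi> \<in> borel_measurable M" and bdd: "\<And>\<omega>. norm (\<Psi> \<omega>) \<le> B"
  obtains a :: "nat \<Rightarrow> 'b" where "summable (\<lambda>j. (norm (a j))\<^sup>2)"
    "\<And>u v. (\<lambda>j. (a j \<bullet> u) * (a j \<bullet> v)) sums expectation (\<lambda>\<omega>. (\<Psi> \<omega> \<bullet> u) * (\<Psi> \<omega> \<bullet> v))"
proof -
  obtain D :: "'b set" where D: "countable D" "\<And>X. open X \<Longrightarrow> X \<noteq> {} \<Longrightarrow> \<exists>z\<in>D. z \<in> X"
    using countable_dense_setE by blast
  have "D \<noteq> {}" using D(2)[of UNIV] by auto
  define u where "u = from_nat_into D"
  have u: "range u = D" unfolding u_def using D(1) \<open>D \<noteq> {}\<close> by (rule range_from_nat_into[rotated])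
  \<comment> \<open>Scaling to second moment 1 (or 0) makes each step lower the variance in every
    direction v by exactly the square of \<open>a j \<bullet> v\<close>.\<close>
  define f where "f = (\<lambda>(R::'a \<Rightarrow> 'b) v \<omega>. (R \<omega> \<bullet> v) / sqrt (expectation (\<lambda>\<omega>. (R \<omega> \<bullet> v)\<^sup>2)))"
  define c where "c = (\<lambda>(R::'a \<Rightarrow> 'b) v. expectation (\<lambda>\<omega>. f R v \<omega> *\<^sub>R R \<omega>))"
  define R where "R = rec_nat \<Psi> (\<lambda>j R \<omega>. R \<omega> - f R (u j) \<omega> *\<^sub>R c R (u j))"
  define a where "a = (\<lambda>j. c (R j) (u j))"
  have R0: "R 0 = \<Psi>" and RS: "\<And>j. R (Suc j) = (\<lambda>\<omega>. R j \<omega> - f (R j) (u j) \<omega> *\<^sub>R a j)"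
    by (simp_all add: R_def a_def)
  define bm where "bm = (\<lambda>R::'a \<Rightarrow> 'b. R \<in> borel_measurable M \<and> (\<exists>B. \<forall>\<omega>. norm (R \<omega>) \<le> B))"
  have bm_inner: "(\<lambda>\<omega>. R \<omega> \<bullet> v) \<in> borel_measurable M \<and> (\<exists>B. \<forall>\<omega>. \<bar>R \<omega> \<bullet> v\<bar> \<le> B)" if bm: "bm R" for R v
  proof -
    obtain B where B: "\<And>\<omega>. norm (R \<omega>) \<le> B" using bm unfolding bm_def by auto
    have "\<bar>R \<omega> \<bullet> v\<bar> \<le> B * norm v" for \<omega>
      by (rule order_trans[OF Cauchy_Schwarz_ineq2 mult_right_mono[OF B]]) simp
    then show ?thesis using bm unfolding bm_def by auto
  qed
  have bm_f: "f R v \<in> borel_measurable M \<and> (\<exists>B. \<forall>\<omega>. \<bar>f R v \<omega>\<bar> \<le> B)" if bm: "bm R" for R v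
  proof -
    obtain B where B: "\<And>\<omega>. \<bar>R \<omega> \<bullet> v\<bar> \<le> B" using bm_inner[OF bm, of v] by auto
    define s where "s = sqrt (expectation (\<lambda>\<omega>. (R \<omega> \<bullet> v)\<^sup>2))"
    have "s \<ge> 0" unfolding s_def by simp
    then have "\<bar>f R v \<omega>\<bar> \<le> B / s" for \<omega>
      unfolding f_def s_def[symmetric] using divide_right_mono[OF B] by simp
    moreover have "f R v \<in> borel_measurable M"
      unfolding f_def using conjunct1[OF bm_inner[OF bm, of v]] by (rule borel_measurable_divide) (rule borel_measurable_const)
    ultimately show ?thesis by blast
  qed
  have bm_R: "bm (R j)" for j
  proof (induction j)
    case 0 then show ?case using bdd by (auto simp: bm_def R0)
  next
    case (Suc j)
    obtain B C where B: "\<And>\<omega>. norm (R j \<omega>) \<le> B" and C: "\<And>\<omega>. \<bar>f (R j) (u j) \<omega>\<bar> \<le> C"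
      using bm_f[OF Suc, of "u j"] Suc unfolding bm_def by auto
    have "norm (R (Suc j) \<omega>) \<le> B + C * norm (a j)" for \<omega>
      unfolding RS by (rule order_trans[OF norm_triangle_ineq4])
        (auto intro!: add_mono B mult_right_mono C)
    moreover have "R (Suc j) \<in> borel_measurable M"
      unfolding RS using bm_f[OF Suc, of "u j"] Suc unfolding bm_def by auto
    ultimately show ?case unfolding bm_def by auto
  qed
  have [measurable]: "R j \<in> borel_measurable M" "f (R j) v \<in> borel_measurable M" for j v
    using bm_R[of j] bm_f[OF bm_R] by (auto simp: bm_def)
  have int_b: "integrable M g" if "g \<in> borel_measurable M" "\<exists>B. \<forall>\<omega>. norm (g \<omega>) \<le> B" for g :: "'a \<Rightarrow> 'c::{banach, second_countable_topology}"
    using that by (auto intro!: integrable_const_bound)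
  have bdd_mult: "\<exists>B. \<forall>\<omega>. norm (g \<omega> *\<^sub>R h \<omega>) \<le> B"
    if "\<exists>B. \<forall>\<omega>. \<bar>g \<omega>\<bar> \<le> B" "\<exists>B. \<forall>\<omega>. norm (h \<omega>) \<le> B" for g :: "'a \<Rightarrow> real" and h :: "'a \<Rightarrow> 'c::real_normed_vector"
  proof -
    obtain B C where "\<And>\<omega>. \<bar>g \<omega>\<bar> \<le> B" "\<And>\<omega>. norm (h \<omega>) \<le> C" using \<open>\<exists>B. \<forall>\<omega>. \<bar>g \<omega>\<bar> \<le> B\<close> \<open>\<exists>B. \<forall>\<omega>. norm (h \<omega>) \<le> B\<close> by auto
    then have "norm (g \<omega> *\<^sub>R h \<omega>) \<le> B * C" for \<omega>
      by (simp add: mult_mono')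
    then show ?thesis by blast
  qed
  define q where "q = (\<lambda>j v. expectation (\<lambda>\<omega>. (R j \<omega> \<bullet> v)\<^sup>2))"
  have q_eq: "q j v = expectation (\<lambda>\<omega>. (R j \<omega> \<bullet> v)\<^sup>2)" for j v by (simp add: q_def)
  have int_RR: "integrable M (\<lambda>\<omega>. (R j \<omega> \<bullet> v)\<^sup>2)" for j v
    using bdd_mult[of "\<lambda>\<omega>. R j \<omega> \<bullet> v" "\<lambda>\<omega>. R j \<omega> \<bullet> v"] bm_inner[OF bm_R, of j v]
    by (intro int_b) (auto simp: power2_eq_square)
  have int_fR: "integrable M (\<lambda>\<omega>. f (R j) v \<omega> *\<^sub>R R j \<omega>)" for j v
    using bdd_mult[of "f (R j) v" "R j"] bm_f[OF bm_R, of j v] bm_R[of j]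
    by (intro int_b) (auto simp: bm_def)
  have int_ff: "integrable M (\<lambda>\<omega>. (f (R j) v \<omega>)\<^sup>2)" for j v
    using bdd_mult[of "f (R j) v" "f (R j) v"] bm_f[OF bm_R, of j v]
    by (intro int_b) (auto simp: power2_eq_square)
  have int_nR: "integrable M (\<lambda>\<omega>. (norm (R j \<omega>))\<^sup>2)" for j
    using bdd_mult[of "\<lambda>\<omega>. norm (R j \<omega>)" "\<lambda>\<omega>. norm (R j \<omega>)"] bm_R[of j]
    by (intro int_b) (auto simp: bm_def power2_eq_square)
  have Eff: "expectation (\<lambda>\<omega>. (f (R j) v \<omega>)\<^sup>2) = (if q j v = 0 then 0 else 1)" for j v
  proof -
    have "q j v \<ge> 0" unfolding q_def by simp
    then have "(\<lambda>\<omega>. (f (R j) v \<omega>)\<^sup>2) = (\<lambda>\<omega>. (R j \<omega> \<bullet> v)\<^sup>2 / q j v)"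
      by (simp add: f_def q_def power_divide)
    then have "expectation (\<lambda>\<omega>. (f (R j) v \<omega>)\<^sup>2) = q j v / q j v"
      by (simp add: q_def)
    then show ?thesis by simp
  qed
  have a0: "a j = 0" if "q j (u j) = 0" for j
    using that by (simp add: a_def c_def f_def q_def)
  have inner_a: "expectation (\<lambda>\<omega>. f (R j) (u j) \<omega> * (R j \<omega> \<bullet> v)) = a j \<bullet> v" for j v
    using integral_inner_left[OF int_fR[of j "u j"], of v] by (simp add: a_def c_def)
  have step: "q (Suc j) v = q j v - (a j \<bullet> v)\<^sup>2" for j v
  proof -
    have int: "integrable M (\<lambda>\<omega>. f (R j) (u j) \<omega> * (R j \<omega> \<bullet> v))"
      using integrable_inner_left[OF int_fR[of j "u j"], of v] by simp
    have "q (Suc j) v = expectation (\<lambda>\<omega>. (R j \<omega> \<bullet> v)\<^sup>2 - 2 * (a j \<bullet> v) * (f (R j) (u j) \<omega> * (R j \<omega> \<bullet> v))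
        + (a j \<bullet> v)\<^sup>2 * (f (R j) (u j) \<omega>)\<^sup>2)"
      unfolding q_def RS
      by (intro Bochner_Integration.integral_cong refl) (simp add: inner_diff_left power2_eq_square algebra_simps)
    also have "\<dots> = q j v - 2 * (a j \<bullet> v)\<^sup>2 + (a j \<bullet> v)\<^sup>2 * expectation (\<lambda>\<omega>. (f (R j) (u j) \<omega>)\<^sup>2)"
      using int int_RR[of j v] int_ff[of j "u j"] inner_a[of j v] by (simp add: q_def power2_eq_square)
    also have "\<dots> = q j v - (a j \<bullet> v)\<^sup>2" using a0[of j] by (simp add: Eff)
    finally show ?thesis .
  qed
  have norm_diff_scaleR: "(norm (x - r *\<^sub>R y))\<^sup>2 = (norm x)\<^sup>2 - 2 * (r * (x \<bullet> y)) + (norm y)\<^sup>2 * r\<^sup>2" for x y :: 'b and r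
    unfolding power2_norm_eq_inner
    by (simp add: inner_diff_left inner_diff_right inner_commute power2_eq_square algebra_simps)
  have step_norm: "expectation (\<lambda>\<omega>. (norm (R (Suc j) \<omega>))\<^sup>2) = expectation (\<lambda>\<omega>. (norm (R j \<omega>))\<^sup>2) - (norm (a j))\<^sup>2" for j
  proof -
    have int: "integrable M (\<lambda>\<omega>. f (R j) (u j) \<omega> * (R j \<omega> \<bullet> a j))"
      using integrable_inner_left[OF int_fR[of j "u j"], of "a j"] by simp
    have "expectation (\<lambda>\<omega>. (norm (R (Suc j) \<omega>))\<^sup>2) = expectation (\<lambda>\<omega>. (norm (R j \<omega>))\<^sup>2 - 2 * (f (R j) (u j) \<omega> * (R j \<omega> \<bullet> a j))
        + (norm (a j))\<^sup>2 * (f (R j) (u j) \<omega>)\<^sup>2)"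
      unfolding RS norm_diff_scaleR ..
    also have "\<dots> = expectation (\<lambda>\<omega>. (norm (R j \<omega>))\<^sup>2) - 2 * (norm (a j))\<^sup>2 + (norm (a j))\<^sup>2 * expectation (\<lambda>\<omega>. (f (R j) (u j) \<omega>)\<^sup>2)"
      using int int_nR[of j] int_ff[of j "u j"] inner_a[of j "a j"] by (simp add: power2_norm_eq_inner)
    also have "\<dots> = expectation (\<lambda>\<omega>. (norm (R j \<omega>))\<^sup>2) - (norm (a j))\<^sup>2" using a0[of j] by (simp add: Eff)
    finally show ?thesis .
  qed
  have q_sum: "(\<Sum>j<m. (a j \<bullet> v)\<^sup>2) = q 0 v - q m v" for m v
    by (induction m) (simp_all add: step)
  have norm_sum: "(\<Sum>j<m. (norm (a j))\<^sup>2) = expectation (\<lambda>\<omega>. (norm (\<Psi> \<omega>))\<^sup>2) - expectation (\<lambda>\<omega>. (norm (R m \<omega>))\<^sup>2)" for m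
    by (induction m) (simp_all add: step_norm R0)
  have q_nonneg: "0 \<le> q m v" for m v unfolding q_def by simp
  \<comment> \<open>Step i removes all variance in direction \<open>u i\<close>. Later steps can
    only decrease \<open>q\<close>, which is nonnegative, so the value stays 0.\<close>
  have q_zero: "q m (u i) = 0" if "i < m" for i m
  proof -
    have "q (Suc i) (u i) = 0"
    proof (cases "q i (u i) = 0")
      case True then show ?thesis using step[of i "u i"] a0[of i] by simp
    next
      case False
      have "(a i \<bullet> u i) = expectation (\<lambda>\<omega>. (R i \<omega> \<bullet> u i)\<^sup>2 / sqrt (q i (u i)))"
        unfolding inner_a[symmetric] f_def q_eq[symmetric]
        by (intro Bochner_Integration.integral_cong refl) (simp add: power2_eq_square)
      also have "\<dots> = q i (u i) / sqrt (q i (u i))"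
        unfolding q_eq[of i] by (rule integral_divide_zero)
      finally have "(a i \<bullet> u i)\<^sup>2 = q i (u i)" using q_nonneg[of i "u i"] by (simp add: real_div_sqrt)
      then show ?thesis using step by simp
    qed
    with \<open>i < m\<close> show ?thesis
    proof (induction m)
      case (Suc m)
      show ?case
      proof (cases "i = m")
        case False
        then have "q m (u i) = 0" using Suc by auto
        then show ?thesis using step[of m "u i"] q_nonneg[of "Suc m" "u i"] zero_le_power2[of "a m \<bullet> u i"] by linarith
      qed (use Suc in auto)
    qed simp
  qed
  define V where "V = expectation (\<lambda>\<omega>. (norm (\<Psi> \<omega>))\<^sup>2)"
  have R_le: "expectation (\<lambda>\<omega>. (norm (R m \<omega>))\<^sup>2) \<le> V" for m
    using norm_sum[of m] sum_nonneg[of "{..<m}" "\<lambda>j. (norm (a j))\<^sup>2"] by (simp add: V_def)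
  have V: "0 \<le> V" by (simp add: V_def)
  \<comment> \<open>Along the dense sequence \<open>q\<close> is eventually 0. The uniform bound
    \<open>V\<close> on the second moments of the residuals carries this to every v as a
    limit.\<close>
  have q_lim: "(\<lambda>m. q m v) \<longlonglongrightarrow> 0" for v
  proof (rule LIMSEQ_I)
    fix e :: real assume e: "0 < e"
    \<comment> \<open>The error is at most 2 d^2 V, and this choice makes it e V / (2 (V + 1)),
      which is below e; the summand 1 guards against V = 0.\<close>
    define d where "d = sqrt (e / (4 * (V + 1)))"
    have d: "0 < d" "d\<^sup>2 = e / (4 * (V + 1))" using e V by (auto simp: d_def)
    obtain i where i: "dist v (u i) < d" using D(2)[of "ball v d"] d u by fastforce
    have "q m v < e" if "i < m" for m
    proof -
      have "q m v \<le> expectation (\<lambda>\<omega>. 2 * (R m \<omega> \<bullet> u i)\<^sup>2 + 2 * ((norm (v - u i))\<^sup>2 * (norm (R m \<omega>))\<^sup>2))"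
        unfolding q_def
      proof (rule integral_mono)
        show "integrable M (\<lambda>\<omega>. 2 * (R m \<omega> \<bullet> u i)\<^sup>2 + 2 * ((norm (v - u i))\<^sup>2 * (norm (R m \<omega>))\<^sup>2))"
          using int_RR int_nR by auto
        fix \<omega>
        have "(R m \<omega> \<bullet> v)\<^sup>2 = (R m \<omega> \<bullet> u i + R m \<omega> \<bullet> (v - u i))\<^sup>2" by (simp add: inner_diff_right)
        also have "\<dots> \<le> 2 * (R m \<omega> \<bullet> u i)\<^sup>2 + 2 * (R m \<omega> \<bullet> (v - u i))\<^sup>2"
          using zero_le_power2[of "R m \<omega> \<bullet> u i - R m \<omega> \<bullet> (v - u i)"] by (simp add: power2_eq_square algebra_simps)
        also have "(R m \<omega> \<bullet> (v - u i))\<^sup>2 \<le> (norm (R m \<omega>) * norm (v - u i))\<^sup>2"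
          using Cauchy_Schwarz_ineq2[of "R m \<omega>" "v - u i"] by (simp add: abs_le_square_iff[symmetric] abs_mult)
        finally show "(R m \<omega> \<bullet> v)\<^sup>2 \<le> 2 * (R m \<omega> \<bullet> u i)\<^sup>2 + 2 * ((norm (v - u i))\<^sup>2 * (norm (R m \<omega>))\<^sup>2)"
          by (simp add: power_mult_distrib mult.commute)
      qed (rule int_RR)
      also have "\<dots> = 2 * q m (u i) + 2 * ((norm (v - u i))\<^sup>2 * expectation (\<lambda>\<omega>. (norm (R m \<omega>))\<^sup>2))"
        using int_RR int_nR by (simp add: q_def)
      also have "\<dots> \<le> 2 * (d\<^sup>2 * V)"
        using i q_zero[OF that] R_le[of m] by (simp add: dist_norm) (intro mult_mono power_mono, auto)
      also have "\<dots> = e * (V / (2 * (V + 1)))" using V by (simp add: d(2) field_simps)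
      also have "\<dots> < e * 1" using e V by (intro mult_strict_left_mono) auto
      finally show ?thesis by simp
    qed
    then show "\<exists>n. \<forall>m\<ge>n. norm (q m v - 0) < e"
      using q_nonneg by (intro exI[of _ "Suc i"]) auto
  qed
  have sums: "(\<lambda>j. (a j \<bullet> v)\<^sup>2) sums q 0 v" for v
    unfolding sums_def q_sum using tendsto_diff[OF tendsto_const q_lim, of "q 0 v"] by simp
  show ?thesis
  proof (rule that)
    have "(\<Sum>j<m. (norm (a j))\<^sup>2) \<le> V" for m
      unfolding norm_sum V_def by simp
    then show "summable (\<lambda>j. (norm (a j))\<^sup>2)"
      by (intro bounded_imp_summable[of _ V]) (auto simp: lessThan_Suc_atMost[symmetric] simp del: sum.lessThan_Suc)
    fix v w
    \<comment> \<open>So far the expansion is known only on the diagonal; polarization yields the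
      mixed terms.\<close>
    have pol: "(x \<bullet> v) * (x \<bullet> w) = ((x \<bullet> (v + w))\<^sup>2 - (x \<bullet> (v - w))\<^sup>2) / 4" for x :: 'b
      by (simp add: inner_add_right inner_diff_right power2_eq_square algebra_simps)
    have "(\<lambda>j. ((a j \<bullet> (v + w))\<^sup>2 - (a j \<bullet> (v - w))\<^sup>2) / 4) sums ((q 0 (v + w) - q 0 (v - w)) / 4)"
      by (intro sums_divide sums_diff sums)
    moreover have "expectation (\<lambda>\<omega>. ((\<Psi> \<omega> \<bullet> (v + w))\<^sup>2 - (\<Psi> \<omega> \<bullet> (v - w))\<^sup>2) / 4) = (q 0 (v + w) - q 0 (v - w)) / 4"
      using int_RR[of 0] by (simp add: q_def R0)
    ultimately show "(\<lambda>j. (a j \<bullet> v) * (a j \<bullet> w)) sums expectation (\<lambda>\<omega>. (\<Psi> \<omega> \<bullet> v) * (\<Psi> \<omega> \<bullet> w))"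
      unfolding pol by simp
  qed
qed

lemma (in prob_space) expectation_norm_sum_orthogonal:
  fixes \<xi> :: "'i \<Rightarrow> 'a \<Rightarrow> 'b::real_inner"
  assumes int: "\<And>i j. i \<in> I \<Longrightarrow> j \<in> I \<Longrightarrow> integrable M (\<lambda>\<omega>. \<xi> i \<omega> \<bullet> \<xi> j \<omega>)"
    and orth: "\<And>i j. i \<in> I \<Longrightarrow> j \<in> I \<Longrightarrow> i \<noteq> j \<Longrightarrow> expectation (\<lambda>\<omega>. \<xi> i \<omega> \<bullet> \<xi> j \<omega>) = 0"
    and fin: "finite I"
  shows "expectation (\<lambda>\<omega>. (norm (\<Sum>i\<in>I. \<xi> i \<omega>))\<^sup>2) = (\<Sum>i\<in>I. expectation (\<lambda>\<omega>. (norm (\<xi> i \<omega>))\<^sup>2))"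
    and "integrable M (\<lambda>\<omega>. (norm (\<Sum>i\<in>I. \<xi> i \<omega>))\<^sup>2)"
proof -
  have *: "(norm (\<Sum>i\<in>I. \<xi> i \<omega>))\<^sup>2 = (\<Sum>i\<in>I. \<Sum>j\<in>I. \<xi> i \<omega> \<bullet> \<xi> j \<omega>)" for \<omega>
    unfolding power2_norm_eq_inner inner_sum_left inner_sum_right by (rule sum.swap)
  show "integrable M (\<lambda>\<omega>. (norm (\<Sum>i\<in>I. \<xi> i \<omega>))\<^sup>2)"
    unfolding * using int by (intro Bochner_Integration.integrable_sum)
  have "expectation (\<lambda>\<omega>. (norm (\<Sum>i\<in>I. \<xi> i \<omega>))\<^sup>2) = (\<Sum>i\<in>I. \<Sum>j\<in>I. expectation (\<lambda>\<omega>. \<xi> i \<omega> \<bullet> \<xi> j \<omega>))"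
    unfolding * using int by (simp add: Bochner_Integration.integral_sum Bochner_Integration.integrable_sum)
  also have "\<dots> = (\<Sum>i\<in>I. expectation (\<lambda>\<omega>. \<xi> i \<omega> \<bullet> \<xi> i \<omega>))"
  proof (intro sum.cong refl)
    fix i assume i: "i \<in> I"
    show "(\<Sum>j\<in>I. expectation (\<lambda>\<omega>. \<xi> i \<omega> \<bullet> \<xi> j \<omega>)) = expectation (\<lambda>\<omega>. \<xi> i \<omega> \<bullet> \<xi> i \<omega>)"
    proof -
      have "(\<Sum>j\<in>I. expectation (\<lambda>\<omega>. \<xi> i \<omega> \<bullet> \<xi> j \<omega>)) = (\<Sum>j\<in>I. if j = i then expectation (\<lambda>\<omega>. \<xi> i \<omega> \<bullet> \<xi> i \<omega>) else 0)"
        using orth[OF i] by (intro sum.cong) auto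
      then show ?thesis using fin i by simp
    qed
  qed
  finally show "expectation (\<lambda>\<omega>. (norm (\<Sum>i\<in>I. \<xi> i \<omega>))\<^sup>2) = (\<Sum>i\<in>I. expectation (\<lambda>\<omega>. (norm (\<xi> i \<omega>))\<^sup>2))"
    by (simp add: power2_norm_eq_inner)
qed

text \<open>Characteristic functions of the projections determine their normal laws by Levy
  uniqueness, but see only the quadratic form of \<open>S\<close>. The condition
  \<open>polar\<close> lifts this to the operator identity in the definition of a Gaussian
  law.\<close>

lemma gaussian_law_from_covariance:
  fixes G :: "'b::{real_inner, banach, second_countable_topology} measure"
  assumes G: "prob_space G" "sets G = sets borel" "integrable G (\<lambda>x. (norm x)\<^sup>2)"
    and char: "\<And>u t. char (distr G borel (\<lambda>x. x \<bullet> u)) t = exp (- (t\<^sup>2 * (S u \<bullet> u)) / 2)"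
    and nonneg: "\<And>u. 0 \<le> S u \<bullet> u"
    and polar: "\<And>u v. S u \<bullet> v = (S (u + v) \<bullet> (u + v) - S (u - v) \<bullet> (u - v)) / 4"
  shows "gaussian_law 0 S G"
proof -
  interpret prob_space G by (rule G)
  have [measurable_cong]: "sets G = sets borel" by (rule G)
  have normal: "distributed G lborel (\<lambda>x. x \<bullet> u) (normal_density 0 (sqrt (S u \<bullet> u)))" if pos: "0 < S u \<bullet> u" for u
  proof -
    define s where "s = sqrt (S u \<bullet> u)"
    have s: "0 < s" "s\<^sup>2 = S u \<bullet> u" using pos by (auto simp: s_def)
    have "distr G borel (\<lambda>x. x \<bullet> u / s) = std_normal_distribution"
    proof (rule Levy_uniqueness)
      show "real_distribution (distr G borel (\<lambda>x. x \<bullet> u / s))" by (rule real_distribution_distr) simp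
      show "real_distribution std_normal_distribution" by (rule real_dist_normal_dist)
      show "char (distr G borel (\<lambda>x. x \<bullet> u / s)) = char std_normal_distribution"
      proof
        fix t
        have "char (distr G borel (\<lambda>x. x \<bullet> u / s)) t = char (distr G borel (\<lambda>x. x \<bullet> u)) (t / s)"
          by (simp add: char_def integral_distr)
        also have "\<dots> = exp (- (t\<^sup>2) / 2)"
          unfolding char using s pos by (simp add: power_divide)
        finally show "char (distr G borel (\<lambda>x. x \<bullet> u / s)) t = char std_normal_distribution t"
          by (simp add: char_std_normal_distribution)
      qed
    qed
    moreover have "distr G lborel (\<lambda>x. x \<bullet> u / s) = distr G borel (\<lambda>x. x \<bullet> u / s)"
      by (rule distr_cong) auto
    ultimately have "distributed G lborel (\<lambda>x. (x \<bullet> u - 0) / s) std_normal_density"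
      by (auto simp: distributed_def)
    then show ?thesis using normal_standard_normal_convert[OF s(1), of "\<lambda>x. x \<bullet> u" 0] by (simp add: s_def)
  qed
  have degenerate: "AE x in G. x \<bullet> u = 0" if zero: "S u \<bullet> u = 0" for u
  proof -
    have "distr G borel (\<lambda>x. x \<bullet> u) = return borel 0"
    proof (rule Levy_uniqueness)
      show "real_distribution (distr G borel (\<lambda>x. x \<bullet> u))" by (rule real_distribution_distr) simp
      show "real_distribution (return borel (0::real))"
        by (intro real_distribution.intro prob_space_return real_distribution_axioms.intro) auto
      show "char (distr G borel (\<lambda>x. x \<bullet> u)) = char (return borel 0)"
        unfolding char zero by (auto simp: char_def integral_return fun_eq_iff)
    qed
    then have "AE y in distr G borel (\<lambda>x. x \<bullet> u). y = 0"
      by (simp only:) (simp add: AE_return)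
    then show ?thesis by (subst (asm) AE_distr_iff) auto
  qed
  have int: "integrable G (\<lambda>x. x)"
    using integrable_of_square[of "\<lambda>x. x"] G(3) by (subst integrable_norm_iff[symmetric]) auto
  have moments: "expectation (\<lambda>x. x \<bullet> u) = 0 \<and> expectation (\<lambda>x. (x \<bullet> u)\<^sup>2) = S u \<bullet> u" for u
  proof (cases "S u \<bullet> u = 0")
    case True
    have "expectation (\<lambda>x. x \<bullet> u) = expectation (\<lambda>x. 0)" "expectation (\<lambda>x. (x \<bullet> u)\<^sup>2) = expectation (\<lambda>x. 0)"
      by (rule integral_cong_AE; use degenerate[OF True] in simp)+
    then show ?thesis using True by simp
  next
    case False
    then have pos: "0 < S u \<bullet> u" using nonneg[of u] by simp
    then have "0 < sqrt (S u \<bullet> u)" by simp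
    from normal_distributed_expectation[OF this normal[OF pos]] normal_distributed_variance[OF this normal[OF pos]]
    show ?thesis using pos by simp
  qed
  have mean: "(LINT x|G. x) = 0"
    using integral_inner_left[OF int, of "LINT x|G. x"] moments by simp
  have "Cov G (\<lambda>x. x) (\<lambda>x. x) u = S u" for u
  proof (subst vector_eq_rdot[symmetric], intro allI)
    fix v
    have int: "integrable G (\<lambda>x. (x \<bullet> w)\<^sup>2)" for w
      using integrable_inner_mult[of "\<lambda>x. x" G w w] G(3) by (simp add: power2_eq_square)
    have "Cov G (\<lambda>x. x) (\<lambda>x. x) u \<bullet> v = expectation (\<lambda>x. (x \<bullet> u) * (x \<bullet> v))"
      by (rule Cov_centered_inner[OF G(2,3) mean])
    also have "\<dots> = expectation (\<lambda>x. ((x \<bullet> (u + v))\<^sup>2 - (x \<bullet> (u - v))\<^sup>2) / 4)"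
      by (intro Bochner_Integration.integral_cong refl)
        (simp add: inner_add_right inner_diff_right power2_eq_square algebra_simps)
    also have "\<dots> = S u \<bullet> v"
      using int moments by (simp add: polar[of u v])
    finally show "Cov G (\<lambda>x. x) (\<lambda>x. x) u \<bullet> v = S u \<bullet> v" .
  qed
  moreover have "(\<exists>\<mu> \<sigma>. 0 < \<sigma> \<and> distributed G lborel (\<lambda>x. x \<bullet> u) (normal_density \<mu> \<sigma>)) \<or> (\<exists>\<mu>. AE x in G. x \<bullet> u = \<mu>)" for u
  proof (cases "S u \<bullet> u = 0")
    case False
    then have pos: "0 < S u \<bullet> u" using nonneg[of u] by simp
    then have "0 < sqrt (S u \<bullet> u)" by simp
    with normal[OF pos] show ?thesis by blast
  qed (use degenerate in blast)
  ultimately show ?thesis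
    unfolding gaussian_law_def using G mean by auto
qed

section \<open>Gaussian random series\<close>

lemma std_normal_coordinates:
  defines "\<Omega> \<equiv> PiM (UNIV :: nat set) (\<lambda>_. std_normal_distribution)"
  shows "prob_space \<Omega>" and "prob_space.indep_vars \<Omega> (\<lambda>_. borel) (\<lambda>j \<omega>. \<omega> j) UNIV"
    and "\<And>j. distr \<Omega> borel (\<lambda>\<omega>. \<omega> j) = std_normal_distribution"
    and "\<And>j. (\<lambda>\<omega>. \<omega> j) \<in> borel_measurable \<Omega>"
proof -
  interpret N: real_distribution std_normal_distribution by (rule real_dist_normal_dist)
  interpret P: product_prob_space "\<lambda>_. std_normal_distribution" "UNIV :: nat set"
    by unfold_locales
  show "prob_space \<Omega>" unfolding \<Omega>_def by (rule P.P.prob_space_axioms)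
  then interpret prob_space \<Omega> .
  have sets: "sets \<Omega> = sets (PiM UNIV (\<lambda>_. borel))"
    unfolding \<Omega>_def by (rule sets_PiM_cong) auto
  show [measurable]: "(\<lambda>\<omega>. \<omega> j) \<in> borel_measurable \<Omega>" for j
    unfolding measurable_cong_sets[OF sets refl] by (rule measurable_component_singleton) simp
  show d: "distr \<Omega> borel (\<lambda>\<omega>. \<omega> j) = std_normal_distribution" for j
  proof -
    have "distr \<Omega> borel (\<lambda>\<omega>. \<omega> j) = distr \<Omega> std_normal_distribution (\<lambda>\<omega>. \<omega> j)"
      by (rule distr_cong) auto
    then show ?thesis unfolding \<Omega>_def by (simp add: P.PiM_component)
  qed
  show "indep_vars (\<lambda>_. borel) (\<lambda>j \<omega>. \<omega> j) UNIV"
  proof (subst indep_vars_iff_distr_eq_PiM)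
    show "distr \<Omega> (PiM UNIV (\<lambda>_. borel)) (\<lambda>x. \<lambda>i\<in>UNIV. x i) = PiM UNIV (\<lambda>i. distr \<Omega> borel (\<lambda>\<omega>. \<omega> i))"
      unfolding d restrict_UNIV using distr_id2[OF sets[symmetric]] by (simp add: \<Omega>_def)
  qed simp_all
qed

text \<open>Almost sure convergence is proved only along a sparse subsequence of the partial sums.
  This suffices, because the law of the limit is identified through characteristic functions, which
  converge along any subsequence.\<close>

theorem gaussian_law_exists:
  fixes a :: "nat \<Rightarrow> 'b::{real_inner, banach, second_countable_topology}"
  assumes sm: "summable (\<lambda>j. (norm (a j))\<^sup>2)"
    and S: "\<And>u v. (\<lambda>j. (a j \<bullet> u) * (a j \<bullet> v)) sums (S u \<bullet> v)"
  obtains G where "gaussian_law 0 S G"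
proof -
  define \<Omega> where "\<Omega> = PiM (UNIV :: nat set) (\<lambda>_. std_normal_distribution)"
  note coord = std_normal_coordinates[folded \<Omega>_def]
  interpret prob_space \<Omega> by (rule coord)
  note [measurable] = coord(4)
  have int_coord: "integrable \<Omega> (\<lambda>\<omega>. \<omega> j)" "integrable \<Omega> (\<lambda>\<omega>. (\<omega> j)\<^sup>2)" for j
    using integrable_std_normal_distribution_moment[of 1] integrable_std_normal_distribution_moment[of 2]
    unfolding coord(3)[of j, symmetric] by (simp_all add: integrable_distr_eq)
  have mean: "expectation (\<lambda>\<omega>. \<omega> j) = 0" for j
    using integral_std_normal_distribution_moment_odd[of 1]
    unfolding coord(3)[of j, symmetric] by (simp add: integral_distr)
  have var: "expectation (\<lambda>\<omega>. (\<omega> j)\<^sup>2) = 1" for j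
    using std_normal_distribution_even_moments(1)[of 1]
    unfolding coord(3)[of j, symmetric] by (simp add: integral_distr)
  have cross: "integrable \<Omega> (\<lambda>\<omega>. \<omega> i * \<omega> j) \<and> expectation (\<lambda>\<omega>. \<omega> i * \<omega> j) = 0" if "i \<noteq> j" for i j
  proof -
    have ind: "indep_vars (\<lambda>_. borel) (\<lambda>j \<omega>. \<omega> j) {i, j}"
      using indep_vars_subset[OF coord(2), of "{i, j}"] by simp
    show ?thesis
      using indep_vars_lebesgue_integral[OF _ ind] indep_vars_integrable[OF _ ind] int_coord(1) mean that
      by simp
  qed
  define T where "T = (\<lambda>m \<omega>. \<Sum>j<m. \<omega> j *\<^sub>R a j)"
  have [measurable]: "T m \<in> borel_measurable \<Omega>" for m unfolding T_def by measurable
  have inner_int: "integrable \<Omega> (\<lambda>\<omega>. (\<omega> i *\<^sub>R a i) \<bullet> (\<omega> j *\<^sub>R a j))" for i j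
    using cross[of j i] int_coord(2)[of i] by (cases "i = j") (auto simp: power2_eq_square mult.assoc[symmetric])
  have inner_zero: "expectation (\<lambda>\<omega>. (\<omega> i *\<^sub>R a i) \<bullet> (\<omega> j *\<^sub>R a j)) = 0" if "i \<noteq> j" for i j
    using cross[OF that] cross[OF that[symmetric]] by (simp add: mult.assoc[symmetric])
  have block: "expectation (\<lambda>\<omega>. (norm (\<Sum>j\<in>J. \<omega> j *\<^sub>R a j))\<^sup>2) = (\<Sum>j\<in>J. (norm (a j))\<^sup>2)"
    "integrable \<Omega> (\<lambda>\<omega>. (norm (\<Sum>j\<in>J. \<omega> j *\<^sub>R a j))\<^sup>2)" if "finite J" for J
  proof -
    show "integrable \<Omega> (\<lambda>\<omega>. (norm (\<Sum>j\<in>J. \<omega> j *\<^sub>R a j))\<^sup>2)"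
      by (rule expectation_norm_sum_orthogonal(2)) (rule inner_int, rule inner_zero, assumption, rule that)
    have "expectation (\<lambda>\<omega>. (norm (\<Sum>j\<in>J. \<omega> j *\<^sub>R a j))\<^sup>2) = (\<Sum>j\<in>J. expectation (\<lambda>\<omega>. (norm (\<omega> j *\<^sub>R a j))\<^sup>2))"
      by (rule expectation_norm_sum_orthogonal(1)) (rule inner_int, rule inner_zero, assumption, rule that)
    then show "expectation (\<lambda>\<omega>. (norm (\<Sum>j\<in>J. \<omega> j *\<^sub>R a j))\<^sup>2) = (\<Sum>j\<in>J. (norm (a j))\<^sup>2)"
      by (simp add: power_mult_distrib var)
  qed
  have "\<exists>N. \<forall>m\<ge>N. \<forall>n. (\<Sum>j\<in>{m..<n}. (norm (a j))\<^sup>2) < (1/4)^k" for k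
  proof -
    have "(1/4::real)^k > 0" by simp
    from sm[unfolded summable_Cauchy, rule_format, OF this] show ?thesis
      unfolding real_norm_def by (meson abs_ge_self le_less_trans)
  qed
  then obtain N where N: "\<And>k m n. N k \<le> m \<Longrightarrow> (\<Sum>j\<in>{m..<n}. (norm (a j))\<^sup>2) < (1/4)^k" by metis
  \<comment> \<open>Adding k makes \<open>r\<close> strictly increasing, and adding all earlier
    thresholds keeps it above \<open>N k\<close>. Each block \<open>D k\<close> then has second
    moment below 4^-k.\<close>
  define r where "r = (\<lambda>k. k + (\<Sum>i\<le>k. N i))"
  have rN: "N k \<le> r k" for k unfolding r_def by (simp add: member_le_sum trans_le_add2)
  have r_mono: "strict_mono r" by (rule strict_monoI_Suc) (simp add: r_def)
  define D where "D = (\<lambda>k \<omega>. T (r (Suc k)) \<omega> - T (r k) \<omega>)"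
  have [measurable]: "D k \<in> borel_measurable \<Omega>" for k unfolding D_def by measurable
  have D_eq: "D k \<omega> = (\<Sum>j\<in>{r k..<r (Suc k)}. \<omega> j *\<^sub>R a j)" for k \<omega>
    unfolding D_def T_def lessThan_atLeast0 using strict_mono_less_eq[OF r_mono, of k "Suc k"]
    by (intro sum_diff_nat_ivl) auto
  have D_int: "integrable \<Omega> (\<lambda>\<omega>. norm (D k \<omega>))" for k
    using block(2)[of "{r k..<r (Suc k)}"] by (intro integrable_of_square) (auto simp: D_eq)
  have D_le: "expectation (\<lambda>\<omega>. norm (D k \<omega>)) \<le> (1/2)^k" for k
  proof -
    have "expectation (\<lambda>\<omega>. norm (D k \<omega>)) \<le> expectation (\<lambda>\<omega>. (2^k * (norm (D k \<omega>))\<^sup>2 + (1/2)^k) / 2)"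
    proof (rule integral_mono[OF D_int])
      show "integrable \<Omega> (\<lambda>\<omega>. (2^k * (norm (D k \<omega>))\<^sup>2 + (1/2)^k) / 2)"
        using block(2)[of "{r k..<r (Suc k)}"] by (simp add: D_eq)
      fix \<omega>
      \<comment> \<open>Arithmetic-geometric mean with weight 2^k: a second moment below 4^-k
        becomes a first moment of at most 2^-k, which is summable.\<close>
      have "0 \<le> (2^k * norm (D k \<omega>) - 1)\<^sup>2 / 2^k" by simp
      also have "\<dots> = 2^k * (norm (D k \<omega>))\<^sup>2 - 2 * norm (D k \<omega>) + (1/2)^k"
        by (simp add: power2_eq_square field_simps)
      finally show "norm (D k \<omega>) \<le> (2^k * (norm (D k \<omega>))\<^sup>2 + (1/2)^k) / 2" by simp
    qed
    also have "\<dots> = (2^k * (\<Sum>j\<in>{r k..<r (Suc k)}. (norm (a j))\<^sup>2) + (1/2)^k) / 2"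
      using block[of "{r k..<r (Suc k)}"] by (simp add: D_eq prob_space)
    also have "\<dots> \<le> (2^k * (1/4)^k + (1/2)^k) / 2"
      using less_imp_le[OF N[OF rN, of k "r (Suc k)"]] by (intro divide_right_mono add_mono mult_left_mono) auto
    also have "\<dots> = (1/2)^k" by (simp add: power_mult_distrib[symmetric])
    finally show ?thesis .
  qed
  have "(\<integral>\<^sup>+\<omega>. (\<Sum>k. ennreal (norm (D k \<omega>))) \<partial>\<Omega>) = (\<Sum>k. \<integral>\<^sup>+\<omega>. ennreal (norm (D k \<omega>)) \<partial>\<Omega>)"
    by (rule nn_integral_suminf) measurable
  also have "\<dots> = (\<Sum>k. ennreal (expectation (\<lambda>\<omega>. norm (D k \<omega>))))"
    using D_int by (simp add: nn_integral_eq_integral)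
  also have "\<dots> \<le> (\<Sum>k. ennreal ((1/2)^k))"
    using D_le by (intro suminf_le summableI ennreal_leI)
  also have "\<dots> < \<infinity>" by (subst suminf_ennreal2) (auto simp: summable_geometric)
  finally have "(\<integral>\<^sup>+\<omega>. (\<Sum>k. ennreal (norm (D k \<omega>))) \<partial>\<Omega>) \<noteq> \<infinity>" by simp
  then have "AE \<omega> in \<Omega>. (\<Sum>k. ennreal (norm (D k \<omega>))) \<noteq> \<infinity>"
    by (intro nn_integral_PInf_AE) auto
  then have conv: "AE \<omega> in \<Omega>. convergent (\<lambda>k. T (r k) \<omega>)"
  proof eventually_elim
    case (elim \<omega>)
    then have "summable (\<lambda>k. norm (D k \<omega>))" by (intro summable_suminf_not_top) auto
    then have "summable (\<lambda>k. D k \<omega>)" by (rule summable_norm_cancel)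
    then have "(\<lambda>k. T (r 0) \<omega> + (\<Sum>i<k. D i \<omega>)) \<longlonglongrightarrow> T (r 0) \<omega> + (\<Sum>i. D i \<omega>)"
      by (intro tendsto_intros) (rule summable_LIMSEQ)
    moreover have "T (r 0) \<omega> + (\<Sum>i<k. D i \<omega>) = T (r k) \<omega>" for k
      unfolding D_def using sum_lessThan_telescope[of "\<lambda>i. T (r i) \<omega>" k] by simp
    ultimately show ?case by (auto simp: convergent_def)
  qed
  \<comment> \<open>On the null set of divergence \<open>lim\<close> is some unspecified vector;
    measurability is unaffected.\<close>
  define W where "W = (\<lambda>\<omega>. lim (\<lambda>k. T (r k) \<omega>))"
  have [measurable]: "W \<in> borel_measurable \<Omega>" unfolding W_def by measurable
  have lim: "AE \<omega> in \<Omega>. (\<lambda>k. T (r k) \<omega>) \<longlonglongrightarrow> W \<omega>"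
    using conv unfolding W_def convergent_LIMSEQ_iff .
  have W_sq: "integrable \<Omega> (\<lambda>\<omega>. (norm (W \<omega>))\<^sup>2)"
  proof (rule integrableI_bounded)
    \<comment> \<open>Fatou's lemma transfers the uniform second-moment bound of the partial sums to
      their almost sure limit.\<close>
    have "(\<integral>\<^sup>+\<omega>. ennreal (norm ((norm (W \<omega>))\<^sup>2)) \<partial>\<Omega>) = (\<integral>\<^sup>+\<omega>. liminf (\<lambda>k. ennreal ((norm (T (r k) \<omega>))\<^sup>2)) \<partial>\<Omega>)"
    proof (rule nn_integral_cong_AE, use lim in eventually_elim)
      case (elim \<omega>)
      then have "(\<lambda>k. ennreal ((norm (T (r k) \<omega>))\<^sup>2)) \<longlonglongrightarrow> ennreal ((norm (W \<omega>))\<^sup>2)"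
        by (intro tendsto_intros)
      from lim_imp_Liminf[OF _ this] show ?case by simp
    qed
    also have "\<dots> \<le> liminf (\<lambda>k. \<integral>\<^sup>+\<omega>. ennreal ((norm (T (r k) \<omega>))\<^sup>2) \<partial>\<Omega>)"
      by (rule nn_integral_liminf) measurable
    also have "\<dots> \<le> liminf (\<lambda>k::nat. ennreal (\<Sum>j. (norm (a j))\<^sup>2))"
    proof (intro Liminf_mono always_eventually allI)
      fix k
      have "(\<integral>\<^sup>+\<omega>. ennreal ((norm (T (r k) \<omega>))\<^sup>2) \<partial>\<Omega>) = ennreal (\<Sum>j<r k. (norm (a j))\<^sup>2)"
        using block[of "{..<r k}"] by (simp add: T_def nn_integral_eq_integral)
      also have "\<dots> \<le> ennreal (\<Sum>j. (norm (a j))\<^sup>2)"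
        using sm by (intro ennreal_leI sum_le_suminf) auto
      finally show "(\<integral>\<^sup>+\<omega>. ennreal ((norm (T (r k) \<omega>))\<^sup>2) \<partial>\<Omega>) \<le> ennreal (\<Sum>j. (norm (a j))\<^sup>2)" .
    qed
    also have "\<dots> < \<infinity>" by (simp add: Liminf_const)
    finally show "(\<integral>\<^sup>+\<omega>. ennreal (norm ((norm (W \<omega>))\<^sup>2)) \<partial>\<Omega>) < \<infinity>" .
  qed measurable
  have char_T: "char (distr \<Omega> borel (\<lambda>\<omega>. T m \<omega> \<bullet> u)) t = exp (- (t\<^sup>2 * (\<Sum>j<m. (a j \<bullet> u)\<^sup>2)) / 2)" for m u t
  proof -
    have "indep_vars (\<lambda>_. borel) (\<lambda>j \<omega>. \<omega> j * (a j \<bullet> u)) {..<m}"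
      by (rule indep_vars_compose2[OF indep_vars_subset[OF coord(2)]]) auto
    then have "char (distr \<Omega> borel (\<lambda>\<omega>. \<Sum>j<m. \<omega> j * (a j \<bullet> u))) t = (\<Prod>j<m. char (distr \<Omega> borel (\<lambda>\<omega>. \<omega> j * (a j \<bullet> u))) t)"
      by (rule char_distr_sum)
    also have "\<dots> = (\<Prod>j<m. complex_of_real (exp (- (t\<^sup>2 * (a j \<bullet> u)\<^sup>2) / 2)))"
    proof (intro prod.cong refl)
      fix j
      have "char (distr \<Omega> borel (\<lambda>\<omega>. \<omega> j * (a j \<bullet> u))) t = char (distr \<Omega> borel (\<lambda>\<omega>. \<omega> j)) (t * (a j \<bullet> u))"
        by (simp add: char_def integral_distr mult.assoc mult.commute mult.left_commute)
      then show "char (distr \<Omega> borel (\<lambda>\<omega>. \<omega> j * (a j \<bullet> u))) t = complex_of_real (exp (- (t\<^sup>2 * (a j \<bullet> u)\<^sup>2) / 2))"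
        by (simp add: coord(3) char_std_normal_distribution power_mult_distrib)
    qed
    also have "\<dots> = complex_of_real (exp (\<Sum>j<m. - (t\<^sup>2 * (a j \<bullet> u)\<^sup>2) / 2))"
      by (simp add: exp_sum of_real_prod[symmetric] del: of_real_prod)
    also have "(\<Sum>j<m. - (t\<^sup>2 * (a j \<bullet> u)\<^sup>2) / 2) = - (t\<^sup>2 * (\<Sum>j<m. (a j \<bullet> u)\<^sup>2)) / 2"
      by (simp add: sum_distrib_left sum_negf sum_divide_distrib)
    finally show ?thesis by (simp add: T_def inner_sum_left)
  qed
  have S_sq: "(\<lambda>j. (a j \<bullet> u)\<^sup>2) sums (S u \<bullet> u)" for u
    using S[of u u] by (simp add: power2_eq_square)
  have char_W: "char (distr \<Omega> borel (\<lambda>\<omega>. W \<omega> \<bullet> u)) t = exp (- (t\<^sup>2 * (S u \<bullet> u)) / 2)" for u t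
  proof (rule LIMSEQ_unique)
    show "(\<lambda>k. char (distr \<Omega> borel (\<lambda>\<omega>. T (r k) \<omega> \<bullet> u)) t) \<longlonglongrightarrow> char (distr \<Omega> borel (\<lambda>\<omega>. W \<omega> \<bullet> u)) t"
    proof -
      have "(\<lambda>k. expectation (\<lambda>\<omega>. iexp (t * (T (r k) \<omega> \<bullet> u)))) \<longlonglongrightarrow> expectation (\<lambda>\<omega>. iexp (t * (W \<omega> \<bullet> u)))"
      proof (rule integral_dominated_convergence[where w="\<lambda>_. 1"])
        show "AE \<omega> in \<Omega>. (\<lambda>k. iexp (t * (T (r k) \<omega> \<bullet> u))) \<longlonglongrightarrow> iexp (t * (W \<omega> \<bullet> u))"
          using lim by eventually_elim (intro tendsto_intros)
      qed auto
      then show ?thesis by (simp add: char_def integral_distr)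
    qed
    have "(\<lambda>k. (\<Sum>j<r k. (a j \<bullet> u)\<^sup>2)) \<longlonglongrightarrow> S u \<bullet> u"
      using LIMSEQ_subseq_LIMSEQ[OF S_sq[of u, unfolded sums_def] r_mono] by (simp add: o_def)
    then show "(\<lambda>k. char (distr \<Omega> borel (\<lambda>\<omega>. T (r k) \<omega> \<bullet> u)) t) \<longlonglongrightarrow> exp (- (t\<^sup>2 * (S u \<bullet> u)) / 2)"
      unfolding char_T by (intro tendsto_intros) auto
  qed
  show ?thesis
  proof (rule that, rule gaussian_law_from_covariance)
    show "prob_space (distr \<Omega> borel W)" by (rule prob_space_distr) simp
    show "integrable (distr \<Omega> borel W) (\<lambda>x. (norm x)\<^sup>2)" using W_sq by (simp add: integrable_distr_eq)
    show "char (distr (distr \<Omega> borel W) borel (\<lambda>x. x \<bullet> u)) t = exp (- (t\<^sup>2 * (S u \<bullet> u)) / 2)" for u t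
      using char_W[of u t] by (simp add: distr_distr o_def)
    show "0 \<le> S u \<bullet> u" for u
      using S_sq[of u] by (metis sums_iff suminf_nonneg zero_le_power2)
    show "S u \<bullet> v = (S (u + v) \<bullet> (u + v) - S (u - v) \<bullet> (u - v)) / 4" for u v
    proof (rule sums_unique2[OF S])
      have polar: "(a j \<bullet> u) * (a j \<bullet> v) = ((a j \<bullet> (u + v))\<^sup>2 - (a j \<bullet> (u - v))\<^sup>2) / 4" for j
        by (simp add: inner_add_right inner_diff_right power2_eq_square algebra_simps)
      show "(\<lambda>j. (a j \<bullet> u) * (a j \<bullet> v)) sums ((S (u + v) \<bullet> (u + v) - S (u - v) \<bullet> (u - v)) / 4)"
        unfolding polar by (intro sums_divide sums_diff S_sq)
    qed
  qed simp
qed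

subsection \<open>Closure properties of asymptotic tightness\<close>

lemma (in prob_space) second_moment_tail:
  fixes D :: "'a \<Rightarrow> 'b::{real_normed_vector, second_countable_topology}"
  assumes [measurable]: "D \<in> borel_measurable M" and int: "integrable M (\<lambda>\<omega>. (norm (D \<omega>))\<^sup>2)" and c: "0 < c"
  shows "prob {\<omega>\<in>space M. c \<le> norm (D \<omega>)} \<le> expectation (\<lambda>\<omega>. (norm (D \<omega>))\<^sup>2) / c\<^sup>2"
proof -
  have "{\<omega>\<in>space M. c \<le> norm (D \<omega>)} = {\<omega>\<in>space M. c\<^sup>2 \<le> (norm (D \<omega>))\<^sup>2}"
    using c by (auto simp: abs_le_square_iff[symmetric])
  moreover have "prob {\<omega>\<in>space M. c\<^sup>2 \<le> (norm (D \<omega>))\<^sup>2} \<le> expectation (\<lambda>\<omega>. (norm (D \<omega>))\<^sup>2) / c\<^sup>2"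
    using c int by (intro integral_Markov_inequality_measure[where A="space M"]) auto
  ultimately show ?thesis by simp
qed

lemma asymp_tight_add:
  fixes Y Z :: "nat \<Rightarrow> 'a \<Rightarrow> 'b::{real_normed_vector, second_countable_topology}"
  assumes M: "\<And>n. prob_space (M n)"
    and Y: "\<And>n. Y n \<in> borel_measurable (M n)" "asymp_tight M Y"
    and Z: "\<And>n. Z n \<in> borel_measurable (M n)" "asymp_tight M Z"
  shows "asymp_tight M (\<lambda>n \<omega>. Y n \<omega> + Z n \<omega>)"
  unfolding asymp_tight_def
proof (intro allI impI)
  fix e d :: real assume e: "0 < e" "0 < d"
  then have e2: "0 < e / 2" "0 < d / 2" by auto
  obtain F where F: "finite F" "\<forall>\<^sub>F n in sequentially. measure (M n) {\<omega>\<in>space (M n). Y n \<omega> \<notin> (\<Union>x\<in>F. ball x (d/2))} \<le> e/2"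
    using Y(2) e2 unfolding asymp_tight_def by meson
  obtain H where H: "finite H" "\<forall>\<^sub>F n in sequentially. measure (M n) {\<omega>\<in>space (M n). Z n \<omega> \<notin> (\<Union>x\<in>H. ball x (d/2))} \<le> e/2"
    using Z(2) e2 unfolding asymp_tight_def by meson
  define L where "L = (\<lambda>(x, y). x + y) ` (F \<times> H)"
  have "\<forall>\<^sub>F n in sequentially. measure (M n) {\<omega>\<in>space (M n). Y n \<omega> + Z n \<omega> \<notin> (\<Union>x\<in>L. ball x d)} \<le> e"
    using F(2) H(2)
  proof eventually_elim
    case (elim n)
    interpret prob_space "M n" by (rule M)
    let ?A = "{\<omega>\<in>space (M n). Y n \<omega> \<notin> (\<Union>x\<in>F. ball x (d/2))}"
    let ?B = "{\<omega>\<in>space (M n). Z n \<omega> \<notin> (\<Union>x\<in>H. ball x (d/2))}"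
    have AB: "?A \<in> sets (M n)" "?B \<in> sets (M n)"
      by (intro measurable_notin_sets Y Z borel_open; auto)+
    have "{\<omega>\<in>space (M n). Y n \<omega> + Z n \<omega> \<notin> (\<Union>x\<in>L. ball x d)} \<subseteq> ?A \<union> ?B"
    proof
      fix \<omega> assume w: "\<omega> \<in> {\<omega>\<in>space (M n). Y n \<omega> + Z n \<omega> \<notin> (\<Union>x\<in>L. ball x d)}"
      show "\<omega> \<in> ?A \<union> ?B"
      proof (rule ccontr)
        assume "\<omega> \<notin> ?A \<union> ?B"
        with w obtain x y where xy: "x \<in> F" "y \<in> H" "dist x (Y n \<omega>) < d/2" "dist y (Z n \<omega>) < d/2" by auto
        have "dist (x + y) (Y n \<omega> + Z n \<omega>) < d"
          using dist_triangle_add[of x y "Y n \<omega>" "Z n \<omega>"] xy by linarith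
        moreover have "x + y \<in> L" using xy by (auto simp: L_def)
        ultimately show False using w by auto
      qed
    qed
    then have "measure (M n) {\<omega>\<in>space (M n). Y n \<omega> + Z n \<omega> \<notin> (\<Union>x\<in>L. ball x d)} \<le> prob (?A \<union> ?B)"
      by (rule finite_measure_mono) (intro sets.Un AB)
    also have "\<dots> \<le> prob ?A + prob ?B" by (rule measure_Un_le[OF AB])
    finally show ?case using elim by linarith
  qed
  moreover have "finite L" using F H by (simp add: L_def)
  ultimately show "\<exists>F. finite F \<and> (\<forall>\<^sub>F n in sequentially. measure (M n) {\<omega>\<in>space (M n). Y n \<omega> + Z n \<omega> \<notin> (\<Union>x\<in>F. ball x d)} \<le> e)"
    by blast
qed

lemma asymp_tight_sum:
  fixes Y :: "'i \<Rightarrow> nat \<Rightarrow> 'a \<Rightarrow> 'b::{real_normed_vector, second_countable_topology}"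
  assumes M: "\<And>n. prob_space (M n)" and "finite A"
    and Y: "\<And>a n. a \<in> A \<Longrightarrow> Y a n \<in> borel_measurable (M n)" "\<And>a. a \<in> A \<Longrightarrow> asymp_tight M (Y a)"
  shows "asymp_tight M (\<lambda>n \<omega>. \<Sum>a\<in>A. Y a n \<omega>)"
  using \<open>finite A\<close> Y
proof (induction A)
  case empty
  show ?case unfolding asymp_tight_def by (auto intro!: exI[of _ "{0}"])
next
  case (insert a A)
  then have "asymp_tight M (\<lambda>n \<omega>. Y a n \<omega> + (\<Sum>a\<in>A. Y a n \<omega>))"
    by (intro asymp_tight_add M insert.IH borel_measurable_sum) auto
  with insert.hyps show ?case by simp
qed

text \<open>Chebyshev confines the scalar to a bounded interval, whose image under multiplication by
  \<open>v\<close> is a compact segment.\<close>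

lemma asymp_tight_scaleR:
  fixes v :: "'b::{real_normed_vector, second_countable_topology}"
  assumes M: "\<And>n. prob_space (M n)" and b[measurable]: "\<And>n. \<beta> n \<in> borel_measurable (M n)"
    and int: "\<And>n. integrable (M n) (\<lambda>\<omega>. (\<beta> n \<omega>)\<^sup>2)" and C: "\<And>n. (LINT \<omega>|M n. (\<beta> n \<omega>)\<^sup>2) \<le> C"
  shows "asymp_tight M (\<lambda>n \<omega>. \<beta> n \<omega> *\<^sub>R v)"
  unfolding asymp_tight_def
proof (intro allI impI)
  fix e d :: real assume e: "0 < e" "0 < d"
  \<comment> \<open>The square of \<open>R\<close> dominates |C|/e, as Chebyshev requires; the added
    1 keeps \<open>R\<close> positive when C = 0.\<close>
  define R where "R = sqrt (\<bar>C\<bar> / e) + 1"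
  have R: "0 < R" unfolding R_def using e by (simp add: add_nonneg_pos)
  have "\<bar>C\<bar> / e \<le> R\<^sup>2"
    unfolding R_def using e by (simp add: power2_eq_square algebra_simps)
  then have CR: "C / R\<^sup>2 \<le> e" using e R by (simp add: field_simps)
  define S where "S = (\<lambda>r. r *\<^sub>R v) ` {-R..R}"
  have "compact S" unfolding S_def by (intro compact_continuous_image continuous_intros) auto
  then obtain F where F: "finite F" "S \<subseteq> (\<Union>x\<in>F. ball x d)"
    using e(2) unfolding compact_eq_totally_bounded by meson
  have "measure (M n) {\<omega>\<in>space (M n). \<beta> n \<omega> *\<^sub>R v \<notin> (\<Union>x\<in>F. ball x d)} \<le> e" for n
  proof -
    interpret prob_space "M n" by (rule M)
    have "measure (M n) {\<omega>\<in>space (M n). \<beta> n \<omega> *\<^sub>R v \<notin> (\<Union>x\<in>F. ball x d)} \<le> prob {\<omega>\<in>space (M n). R \<le> norm (\<beta> n \<omega>)}"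
    proof (intro finite_measure_mono subsetI)
      fix \<omega> assume w: "\<omega> \<in> {\<omega>\<in>space (M n). \<beta> n \<omega> *\<^sub>R v \<notin> (\<Union>x\<in>F. ball x d)}"
      then have "\<beta> n \<omega> \<notin> {-R..R}" using F(2) unfolding S_def by blast
      then show "\<omega> \<in> {\<omega>\<in>space (M n). R \<le> norm (\<beta> n \<omega>)}" using w by auto
    qed measurable
    also have "\<dots> \<le> (LINT \<omega>|M n. (norm (\<beta> n \<omega>))\<^sup>2) / R\<^sup>2"
      using int[of n] R by (intro second_moment_tail) auto
    also have "\<dots> \<le> C / R\<^sup>2" using C[of n] by (intro divide_right_mono) auto
    finally show ?thesis using CR by linarith
  qed
  then show "\<exists>F. finite F \<and> (\<forall>\<^sub>F n in sequentially. measure (M n) {\<omega>\<in>space (M n). \<beta> n \<omega> *\<^sub>R v \<notin> (\<Union>x\<in>F. ball x d)} \<le> e)"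
    using F(1) by (intro exI[of _ F]) simp
qed

text \<open>The approximant may change with the tolerance but serves all n at once. It is used
  twice: to replace \<open>psi\<close> by simple functions and to discard the degenerate
  part.\<close>

lemma asymp_tight_approx:
  fixes Y :: "nat \<Rightarrow> 'a \<Rightarrow> 'b::{real_normed_vector, second_countable_topology}"
  assumes M: "\<And>n. prob_space (M n)" and [measurable]: "\<And>n. Y n \<in> borel_measurable (M n)"
    and approx: "\<And>\<eta>. 0 < \<eta> \<Longrightarrow> \<exists>Z. asymp_tight M Z \<and> (\<forall>n. Z n \<in> borel_measurable (M n)) \<and>
      (\<forall>n. integrable (M n) (\<lambda>\<omega>. (norm (Y n \<omega> - Z n \<omega>))\<^sup>2)) \<and>
      (\<forall>\<^sub>F n in sequentially. (LINT \<omega>|M n. (norm (Y n \<omega> - Z n \<omega>))\<^sup>2) \<le> \<eta>)"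
  shows "asymp_tight M Y"
  unfolding asymp_tight_def
proof (intro allI impI)
  fix e d :: real assume e: "0 < e" "0 < d"
  \<comment> \<open>The third quantity is the tolerance for which Chebyshev at distance d/2 leaves
    probability e/2.\<close>
  then have e2: "0 < e / 2" "0 < d / 2" "0 < e / 2 * (d / 2)\<^sup>2" by auto
  obtain Z where Z: "asymp_tight M Z" and [measurable]: "\<And>n. Z n \<in> borel_measurable (M n)"
    and int: "\<And>n. integrable (M n) (\<lambda>\<omega>. (norm (Y n \<omega> - Z n \<omega>))\<^sup>2)"
    and small: "\<forall>\<^sub>F n in sequentially. (LINT \<omega>|M n. (norm (Y n \<omega> - Z n \<omega>))\<^sup>2) \<le> e / 2 * (d / 2)\<^sup>2"
    using approx[OF e2(3)] by blast
  obtain F where F: "finite F" "\<forall>\<^sub>F n in sequentially. measure (M n) {\<omega>\<in>space (M n). Z n \<omega> \<notin> (\<Union>x\<in>F. ball x (d/2))} \<le> e/2"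
    using Z e2 unfolding asymp_tight_def by meson
  have "\<forall>\<^sub>F n in sequentially. measure (M n) {\<omega>\<in>space (M n). Y n \<omega> \<notin> (\<Union>x\<in>F. ball x d)} \<le> e"
    using F(2) small
  proof eventually_elim
    case (elim n)
    interpret prob_space "M n" by (rule M)
    let ?A = "{\<omega>\<in>space (M n). Z n \<omega> \<notin> (\<Union>x\<in>F. ball x (d/2))}"
    let ?B = "{\<omega>\<in>space (M n). d / 2 \<le> norm (Y n \<omega> - Z n \<omega>)}"
    have A: "?A \<in> sets (M n)" by (intro measurable_notin_sets borel_open; auto)
    have B: "?B \<in> sets (M n)" by measurable
    note AB = A B
    have "{\<omega>\<in>space (M n). Y n \<omega> \<notin> (\<Union>x\<in>F. ball x d)} \<subseteq> ?A \<union> ?B"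
    proof
      fix \<omega> assume w: "\<omega> \<in> {\<omega>\<in>space (M n). Y n \<omega> \<notin> (\<Union>x\<in>F. ball x d)}"
      show "\<omega> \<in> ?A \<union> ?B"
      proof (rule ccontr)
        assume "\<omega> \<notin> ?A \<union> ?B"
        with w obtain x where x: "x \<in> F" "dist x (Z n \<omega>) < d/2" "dist (Z n \<omega>) (Y n \<omega>) < d/2"
          by (auto simp: dist_norm norm_minus_commute)
        have "dist x (Y n \<omega>) < d" using dist_triangle[of x "Y n \<omega>" "Z n \<omega>"] x by linarith
        then show False using w x(1) by auto
      qed
    qed
    then have "measure (M n) {\<omega>\<in>space (M n). Y n \<omega> \<notin> (\<Union>x\<in>F. ball x d)} \<le> prob (?A \<union> ?B)"
      by (rule finite_measure_mono) (intro sets.Un AB)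
    also have "\<dots> \<le> prob ?A + prob ?B" by (rule measure_Un_le[OF AB])
    also have "prob ?B \<le> (LINT \<omega>|M n. (norm (Y n \<omega> - Z n \<omega>))\<^sup>2) / (d/2)\<^sup>2"
      using int e2 by (intro second_moment_tail) auto
    also have "\<dots> \<le> (e / 2 * (d / 2)\<^sup>2) / (d/2)\<^sup>2" using elim by (intro divide_right_mono) auto
    also have "\<dots> = e / 2" using e by simp
    finally show ?case using elim by linarith
  qed
  with F(1) show "\<exists>F. finite F \<and> (\<forall>\<^sub>F n in sequentially. measure (M n) {\<omega>\<in>space (M n). Y n \<omega> \<notin> (\<Union>x\<in>F. ball x d)} \<le> e)"
    by blast
qed

subsection \<open>Antisymmetric kernels and their degenerate part\<close>

lemma (in prob_space) integrable_bounded: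
  fixes f :: "'a \<Rightarrow> 'b::{banach, second_countable_topology}"
  shows "f \<in> borel_measurable M \<Longrightarrow> (\<And>\<omega>. norm (f \<omega>) \<le> B) \<Longrightarrow> integrable M f"
  by (rule integrable_const_bound[of _ B]) auto

lemma abs_inner_le_mult:
  fixes x y :: "'b::real_inner"
  shows "norm x \<le> B \<Longrightarrow> norm y \<le> C \<Longrightarrow> \<bar>x \<bullet> y\<bar> \<le> B * C"
  by (rule order_trans[OF Cauchy_Schwarz_ineq2]) (auto intro!: mult_mono order_trans[OF norm_ge_zero])

lemma eq_minus_self_imp_zero:
  fixes x :: "'b::real_vector"
  assumes "x = - x" shows "x = 0"
proof -
  have "2 *\<^sub>R x = x + - x" using assms by (simp add: scaleR_2)
  then show ?thesis by simp
qed

text \<open>Isolates the features of sgn(x - y) on which the limit theory rests. Antisymmetry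
  supplies both the zero mean and the vanishing diagonal.\<close>

locale antisymmetric_kernel = prob_space P
  for P :: "'h::{real_inner, banach, second_countable_topology} measure" +
  fixes h :: "'h \<Rightarrow> 'h \<Rightarrow> 'h"
  assumes sets_P: "sets P = sets borel"
    and h_measurable: "case_prod h \<in> borel_measurable (borel \<Otimes>\<^sub>M borel)"
    and h_bound: "norm (h x y) \<le> 1"
    and h_antisym: "h y x = - h x y"
begin

lemma measurable_h[measurable (raw)]:
  "f \<in> borel_measurable M \<Longrightarrow> g \<in> borel_measurable M \<Longrightarrow> (\<lambda>x. h (f x) (g x)) \<in> borel_measurable M"
  using measurable_compose[OF measurable_Pair h_measurable] by auto

lemma measurable_P[measurable_cong]: "sets P = sets borel"
  by (rule sets_P)

lemma h_self: "h x x = 0"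
  by (rule eq_minus_self_imp_zero) (rule h_antisym)

definition psi :: "'h \<Rightarrow> 'h" where
  "psi x = (LINT y|P. h x y)"

lemma psi_measurable[measurable]: "psi \<in> borel_measurable borel"
  unfolding psi_def by measurable

lemma measurable_psi_compose[measurable (raw)]:
  "f \<in> borel_measurable M \<Longrightarrow> (\<lambda>x. psi (f x)) \<in> borel_measurable M"
  by (rule measurable_compose[OF _ psi_measurable])

lemma integrable_h: "integrable P (h x)" "integrable P (\<lambda>x. h x y)"
  by (rule integrable_const_bound[of _ 1]; simp add: h_bound)+

lemma integral_h_left: "(LINT x|P. h x y) = - psi y"
  unfolding psi_def by (subst h_antisym) simp

lemma psi_bound: "norm (psi x) \<le> 1"
  unfolding psi_def
  by (rule order_trans[OF integral_norm_bound])
    (use integral_mono[of P "\<lambda>y. norm (h x y)" "\<lambda>_. 1"] integrable_h h_bound in \<open>simp add: prob_space\<close>)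

lemma integrable_psi: "integrable P psi"
  by (rule integrable_const_bound[of _ 1]) (simp_all add: psi_bound)

lemma expectation_psi: "(LINT x|P. psi x) = 0"
proof -
  interpret PP: pair_prob_space P P ..
  have "integrable (P \<Otimes>\<^sub>M P) (case_prod h)"
    by (rule PP.integrable_const_bound[of _ 1]) (auto simp: h_bound)
  from PP.Fubini_integral[OF this] have "(LINT y|P. - psi y) = (LINT x|P. psi x)"
    by (simp add: integral_h_left psi_def[symmetric])
  then have "(LINT x|P. psi x) = - (LINT x|P. psi x)" by simp
  then show ?thesis by (rule eq_minus_self_imp_zero)
qed

text \<open>The completely degenerate term of the Hoeffding decomposition. The sign of
  \<open>psi y\<close> comes from antisymmetry, by which the second projection is minus the
  first.\<close>

definition remainder :: "'h \<Rightarrow> 'h \<Rightarrow> 'h" where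
  "remainder x y = h x y - psi x + psi y"

lemma measurable_remainder[measurable (raw)]:
  "f \<in> borel_measurable M \<Longrightarrow> g \<in> borel_measurable M \<Longrightarrow> (\<lambda>x. remainder (f x) (g x)) \<in> borel_measurable M"
  unfolding remainder_def
  by (intro borel_measurable_add borel_measurable_diff measurable_h measurable_psi_compose)

lemma remainder_antisym: "remainder y x = - remainder x y"
  unfolding remainder_def by (subst h_antisym) simp

lemma remainder_self: "remainder x x = 0"
  by (simp add: remainder_def h_self)

lemma remainder_bound: "norm (remainder x y) \<le> 3"
proof -
  have "norm (remainder x y) \<le> norm (h x y) + norm (psi x) + norm (psi y)"
    unfolding remainder_def using norm_triangle_ineq[of "h x y - psi x" "psi y"] norm_triangle_ineq4[of "h x y" "psi x"]
    by linarith
  then show ?thesis using h_bound[of x y] psi_bound[of x] psi_bound[of y] by linarith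
qed

lemma remainder_degenerate: "(LINT x|P. remainder x y) = 0" "integrable P (\<lambda>x. remainder x y)"
  using integrable_h(2)[of y] integrable_psi by (simp_all add: remainder_def integral_h_left expectation_psi prob_space)

end

section \<open>Moments over an independent sample\<close>

locale iid_sample = antisymmetric_kernel P h + M: prob_space M
  for P :: "'h::{real_inner, banach, second_countable_topology} measure" and h and M :: "'a measure" +
  fixes Y :: "'i \<Rightarrow> 'a \<Rightarrow> 'h" and I :: "'i set"
  assumes finite_I: "finite I"
    and indep: "M.indep_vars (\<lambda>_. borel) Y I"
    and distr_Y: "i \<in> I \<Longrightarrow> distr M borel (Y i) = P"
begin

lemma measurable_Y[measurable]: "i \<in> I \<Longrightarrow> Y i \<in> borel_measurable M"
  using indep by (auto simp: M.indep_vars_def)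

lemma integral_Y:
  fixes f :: "'h \<Rightarrow> 'b::{banach, second_countable_topology}"
  assumes "i \<in> I" "f \<in> borel_measurable borel"
  shows "(LINT \<omega>|M. f (Y i \<omega>)) = (LINT x|P. f x)"
  using integral_distr[OF measurable_Y[OF assms(1)] assms(2)] distr_Y[OF assms(1)] by simp

text \<open>Plays the role of conditioning: with all other observations frozen, \<open>Y a\<close>
  is integrated out first by Fubini. The others enter as one tuple over \<open>J\<close>, so the
  statement serves for a single further observation as well as for several.\<close>

lemma expectation_fresh_zero:
  fixes F :: "'h \<Rightarrow> ('i \<Rightarrow> 'h) \<Rightarrow> 'b::{banach, second_countable_topology}"
  assumes a: "a \<in> I" and J: "J \<subseteq> I" "a \<notin> J"
    and F: "case_prod F \<in> borel_measurable (borel \<Otimes>\<^sub>M PiM J (\<lambda>_. borel))"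
    and bdd: "\<And>x y. norm (F x y) \<le> B"
    and zero: "\<And>y. (LINT x|P. F x y) = 0"
  shows "(LINT \<omega>|M. F (Y a \<omega>) (restrict (\<lambda>i. Y i \<omega>) J)) = 0"
proof -
  let ?Z = "\<lambda>\<omega>. restrict (\<lambda>i. Y i \<omega>) J"
  let ?X = "\<lambda>\<omega>. restrict (\<lambda>i. Y i \<omega>) {a}"
  have "M.indep_var (PiM {a} (\<lambda>_. borel)) ?X (PiM J (\<lambda>_. borel)) ?Z"
    using a J by (intro M.indep_var_restrict[OF indep]) auto
  then have [measurable]: "?Z \<in> measurable M (PiM J (\<lambda>_. borel))" "?X \<in> measurable M (PiM {a} (\<lambda>_. borel))"
    and eq: "distr M (PiM {a} (\<lambda>_. borel)) ?X \<Otimes>\<^sub>M distr M (PiM J (\<lambda>_. borel)) ?Z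
      = distr M (PiM {a} (\<lambda>_. borel) \<Otimes>\<^sub>M PiM J (\<lambda>_. borel)) (\<lambda>\<omega>. (?X \<omega>, ?Z \<omega>))"
    unfolding M.indep_var_distribution_eq by auto
  define Q1 where "Q1 = distr M (PiM {a} (\<lambda>_. borel)) ?X"
  define Q2 where "Q2 = distr M (PiM J (\<lambda>_. borel)) ?Z"
  interpret Q1: prob_space Q1 unfolding Q1_def by (rule M.prob_space_distr) simp
  interpret Q2: prob_space Q2 unfolding Q2_def by (rule M.prob_space_distr) simp
  interpret Q: pair_prob_space Q1 Q2 ..
  \<comment> \<open>Independence is available between tuples, so the single observation appears as a
    tuple over \<open>{a}\<close> and is read off as \<open>f a\<close>.\<close>
  have F': "(\<lambda>(f, y). F (f a) y) \<in> borel_measurable (PiM {a} (\<lambda>_. borel) \<Otimes>\<^sub>M PiM J (\<lambda>_. borel))"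
  proof -
    have "(\<lambda>z. (fst z a, snd z)) \<in> measurable (PiM {a} (\<lambda>_. borel) \<Otimes>\<^sub>M PiM J (\<lambda>_. borel)) (borel \<Otimes>\<^sub>M PiM J (\<lambda>_. borel))"
      by (intro measurable_Pair measurable_snd measurable_compose[OF measurable_fst measurable_component_singleton]) simp
    from measurable_compose[OF this F] show ?thesis by (simp add: case_prod_beta')
  qed
  have F_section: "(\<lambda>x. F x y) \<in> borel_measurable borel" if "y \<in> space (PiM J (\<lambda>_. borel))" for y
    using measurable_Pair1[OF F that] by simp
  have inner: "(LINT f|Q1. F (f a) y) = 0" if "y \<in> space Q2" for y
  proof -
    have y: "(\<lambda>x. F x y) \<in> borel_measurable borel" using that by (intro F_section) (simp add: Q2_def)
    have "(\<lambda>f. F (f a) y) \<in> borel_measurable (PiM {a} (\<lambda>_. borel))"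
      by (rule measurable_compose[OF measurable_component_singleton[where M="\<lambda>_. borel"] y]) simp
    then have "(LINT f|Q1. F (f a) y) = (LINT \<omega>|M. F (Y a \<omega>) y)"
      unfolding Q1_def by (subst integral_distr) auto
    then show ?thesis using integral_Y[OF a y] zero by simp
  qed
  have "(LINT \<omega>|M. F (Y a \<omega>) (?Z \<omega>)) = (LINT \<omega>|M. (\<lambda>(f, y). F (f a) y) (?X \<omega>, ?Z \<omega>))" by simp
  also have "\<dots> = integral\<^sup>L (distr M (PiM {a} (\<lambda>_. borel) \<Otimes>\<^sub>M PiM J (\<lambda>_. borel)) (\<lambda>\<omega>. (?X \<omega>, ?Z \<omega>))) (\<lambda>(f, y). F (f a) y)"
    using F' by (intro integral_distr[symmetric]) auto
  also have "\<dots> = integral\<^sup>L (Q1 \<Otimes>\<^sub>M Q2) (\<lambda>(f, y). F (f a) y)"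
    unfolding eq[symmetric] Q1_def Q2_def ..
  also have "\<dots> = (LINT y|Q2. LINT f|Q1. F (f a) y)"
  proof (rule Q.integral_snd[symmetric])
    have "sets (Q1 \<Otimes>\<^sub>M Q2) = sets (PiM {a} (\<lambda>_. borel) \<Otimes>\<^sub>M PiM J (\<lambda>_. borel))"
      by (rule sets_pair_measure_cong) (simp_all add: Q1_def Q2_def)
    then show "integrable (Q1 \<Otimes>\<^sub>M Q2) (\<lambda>(f, y). F (f a) y)"
      using F' by (intro Q.integrable_const_bound[of _ B]) (auto simp: bdd cong: measurable_cong_sets)
  qed
  also have "\<dots> = (LINT y|Q2. 0)" by (intro Bochner_Integration.integral_cong refl inner)
  finally show ?thesis by simp
qed

lemma expectation_inner_centered:
  fixes g f :: "'h \<Rightarrow> 'b::{real_inner, banach, second_countable_topology}"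
  assumes "a \<in> I" "b \<in> I" "a \<noteq> b" and [measurable]: "g \<in> borel_measurable borel" "f \<in> borel_measurable borel"
    and B: "\<And>x. norm (g x) \<le> B" "\<And>x. norm (f x) \<le> B" and "(LINT x|P. g x) = 0"
  shows "(LINT \<omega>|M. g (Y a \<omega>) \<bullet> f (Y b \<omega>)) = 0"
proof -
  have "integrable P g" by (rule integrable_const_bound[of _ B]) (auto simp: B)
  then have "(LINT x|P. g x \<bullet> v) = 0" for v using \<open>(LINT x|P. g x) = 0\<close> by simp
  then have "(LINT \<omega>|M. (\<lambda>x y. g x \<bullet> f (y b)) (Y a \<omega>) (restrict (\<lambda>i. Y i \<omega>) {b})) = 0"
    using assms(1-3) by (intro expectation_fresh_zero[where B="B * B"]) (auto intro!: abs_inner_le_mult B)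
  then show ?thesis by simp
qed

lemma linear_second_moment:
  fixes g :: "'h \<Rightarrow> 'b::{real_inner, banach, second_countable_topology}" and w :: "'i \<Rightarrow> real"
  assumes [measurable]: "g \<in> borel_measurable borel"
    and B: "\<And>x. norm (g x) \<le> B" and mean: "(LINT x|P. g x) = 0"
  shows "(LINT \<omega>|M. (norm (\<Sum>i\<in>I. w i *\<^sub>R g (Y i \<omega>)))\<^sup>2) = (\<Sum>i\<in>I. (w i)\<^sup>2) * (LINT x|P. (norm (g x))\<^sup>2)"
    and "integrable M (\<lambda>\<omega>. (norm (\<Sum>i\<in>I. w i *\<^sub>R g (Y i \<omega>)))\<^sup>2)"
proof -
  have int: "integrable M (\<lambda>\<omega>. (w i *\<^sub>R g (Y i \<omega>)) \<bullet> (w j *\<^sub>R g (Y j \<omega>)))" if "i \<in> I" "j \<in> I" for i j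
    using that by (intro M.integrable_bounded[where B="(\<bar>w i\<bar> * B) * (\<bar>w j\<bar> * B)"] )
      (auto simp only: real_norm_def intro!: abs_inner_le_mult, auto intro!: mult_left_mono B)
  have orth: "(LINT \<omega>|M. (w i *\<^sub>R g (Y i \<omega>)) \<bullet> (w j *\<^sub>R g (Y j \<omega>))) = 0" if "i \<in> I" "j \<in> I" "i \<noteq> j" for i j
    using expectation_inner_centered[OF that, of g g B] B mean by simp
  show "integrable M (\<lambda>\<omega>. (norm (\<Sum>i\<in>I. w i *\<^sub>R g (Y i \<omega>)))\<^sup>2)"
    by (rule M.expectation_norm_sum_orthogonal(2)) (use int orth finite_I in auto)
  have "(LINT \<omega>|M. (norm (\<Sum>i\<in>I. w i *\<^sub>R g (Y i \<omega>)))\<^sup>2) = (\<Sum>i\<in>I. LINT \<omega>|M. (norm (w i *\<^sub>R g (Y i \<omega>)))\<^sup>2)"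
    by (rule M.expectation_norm_sum_orthogonal(1)) (use int orth finite_I in auto)
  also have "\<dots> = (\<Sum>i\<in>I. (w i)\<^sup>2 * (LINT x|P. (norm (g x))\<^sup>2))"
    by (intro sum.cong refl) (simp add: power_mult_distrib integral_Y[where f="\<lambda>x. (norm (g x))\<^sup>2"])
  finally show "(LINT \<omega>|M. (norm (\<Sum>i\<in>I. w i *\<^sub>R g (Y i \<omega>)))\<^sup>2) = (\<Sum>i\<in>I. (w i)\<^sup>2) * (LINT x|P. (norm (g x))\<^sup>2)"
    by (simp add: sum_distrib_right)
qed

lemma expectation_remainder:
  assumes "a \<in> I" "b \<in> I"
  shows "(LINT \<omega>|M. remainder (Y a \<omega>) (Y b \<omega>)) = 0"
proof (cases "a = b")
  case False
  have "(LINT \<omega>|M. (\<lambda>x y. remainder x (y b)) (Y a \<omega>) (restrict (\<lambda>i. Y i \<omega>) {b})) = 0"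
    using assms False by (intro expectation_fresh_zero[where B=3]) (auto simp: remainder_bound remainder_degenerate)
  then show ?thesis by simp
qed (simp add: remainder_self)

text \<open>Splitting into \<open>remainder\<close> and two \<open>psi\<close> terms covers a = b
  along with distinct indices: on the diagonal the remainder vanishes and the \<open>psi\<close>
  terms cancel.\<close>

lemma expectation_kernel:
  assumes "a \<in> I" "b \<in> I"
  shows "(LINT \<omega>|M. h (Y a \<omega>) (Y b \<omega>)) = 0"
proof -
  have [measurable]: "Y a \<in> borel_measurable M" "Y b \<in> borel_measurable M" using assms by auto
  have int: "integrable M (\<lambda>\<omega>. remainder (Y a \<omega>) (Y b \<omega>))" "integrable M (\<lambda>\<omega>. psi (Y i \<omega>))" if "i \<in> I" for i
    using that by (intro M.integrable_bounded[where B=3] M.integrable_bounded[where B=1]; simp add: remainder_bound psi_bound)+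
  have "(LINT \<omega>|M. h (Y a \<omega>) (Y b \<omega>)) = (LINT \<omega>|M. remainder (Y a \<omega>) (Y b \<omega>) + psi (Y a \<omega>) - psi (Y b \<omega>))"
    by (intro Bochner_Integration.integral_cong refl) (simp add: remainder_def)
  also have "\<dots> = 0"
    using int[OF assms(1)] int[OF assms(2)] assms
    by (simp add: expectation_remainder integral_Y expectation_psi)
  finally show ?thesis .
qed

text \<open>An index that occurs only once can be integrated out while the other three observations
  are fixed, and degeneracy makes that integral 0.\<close>

lemma expectation_remainder_inner_fresh:
  assumes "a \<in> I" "b \<in> I" "c \<in> I" "d \<in> I" "a \<notin> {b, c, d}"
  shows "(LINT \<omega>|M. remainder (Y a \<omega>) (Y b \<omega>) \<bullet> remainder (Y c \<omega>) (Y d \<omega>)) = 0"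
proof -
  have zero: "(LINT x|P. remainder x y \<bullet> v) = 0" for y v
    using remainder_degenerate by simp
  have "(LINT \<omega>|M. (\<lambda>x y. remainder x (y b) \<bullet> remainder (y c) (y d)) (Y a \<omega>) (restrict (\<lambda>i. Y i \<omega>) {b, c, d})) = 0"
    using assms zero by (intro expectation_fresh_zero[where B="3 * 3"])
      (auto simp only: real_norm_def intro!: abs_inner_le_mult remainder_bound, measurable)
  then show ?thesis by simp
qed

lemma expectation_remainder_inner:
  assumes I: "a \<in> I" "b \<in> I" "c \<in> I" "d \<in> I" and "(c, d) \<noteq> (a, b)" "(c, d) \<noteq> (b, a)"
  shows "(LINT \<omega>|M. remainder (Y a \<omega>) (Y b \<omega>) \<bullet> remainder (Y c \<omega>) (Y d \<omega>)) = 0"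
proof (cases "a = b \<or> c = d")
  case True then show ?thesis by (auto simp: remainder_self)
next
  case False
  \<comment> \<open>If neither \<open>a\<close> nor \<open>b\<close> occurred only once, both would
    lie in \<open>{c, d}\<close>. Being distinct they would exhaust it, so (c, d) would be (a, b) or
    (b, a).\<close>
  then consider "a \<notin> {b, c, d}" | "b \<notin> {a, c, d}" using assms(5,6) by auto
  then show ?thesis
  proof cases
    case 1 with I show ?thesis by (rule expectation_remainder_inner_fresh)
  next
    case 2
    with I have "(LINT \<omega>|M. remainder (Y b \<omega>) (Y a \<omega>) \<bullet> remainder (Y c \<omega>) (Y d \<omega>)) = 0"
      by (intro expectation_remainder_inner_fresh)
    then show ?thesis by (subst remainder_antisym) simp
  qed
qed

text \<open>Only the pairs \<open>(a, b)\<close> and \<open>(b, a)\<close> correlate with \<open>(a, b)\<close>, so the double sum behaves like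
  a single one.\<close>

lemma remainder_sum_second_moment:
  assumes J: "J \<subseteq> I"
  shows "(LINT \<omega>|M. (norm (\<Sum>a\<in>J. \<Sum>b\<in>I. remainder (Y a \<omega>) (Y b \<omega>)))\<^sup>2) \<le> 18 * real (card J) * real (card I)"
proof -
  define A where "A = J \<times> I"
  have fin: "finite A" "finite J" using finite_I finite_subset[OF J finite_I] by (auto simp: A_def)
  define R where "R = (\<lambda>p \<omega>. remainder (Y (fst p) \<omega>) (Y (snd p) \<omega>))"
  have [measurable]: "R p \<in> borel_measurable M" if "p \<in> A" for p
    using that J unfolding A_def R_def by (auto simp: subset_iff)
  have bound: "\<bar>R p \<omega> \<bullet> R q \<omega>\<bar> \<le> 9" for p q \<omega>
    using abs_inner_le_mult[of "R p \<omega>" 3 "R q \<omega>" 3] by (simp add: R_def remainder_bound)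
  have int: "integrable M (\<lambda>\<omega>. R p \<omega> \<bullet> R q \<omega>)" if "p \<in> A" "q \<in> A" for p q
    using that bound by (intro M.integrable_bounded[where B=9]) auto
  have "(\<Sum>a\<in>J. \<Sum>b\<in>I. remainder (Y a \<omega>) (Y b \<omega>)) = (\<Sum>p\<in>A. R p \<omega>)" for \<omega>
    unfolding A_def R_def by (simp add: sum.cartesian_product case_prod_beta)
  then have "(LINT \<omega>|M. (norm (\<Sum>a\<in>J. \<Sum>b\<in>I. remainder (Y a \<omega>) (Y b \<omega>)))\<^sup>2)
      = (LINT \<omega>|M. (\<Sum>p\<in>A. \<Sum>q\<in>A. R q \<omega> \<bullet> R p \<omega>))"
    by (simp add: power2_norm_eq_inner inner_sum_left inner_sum_right)
  also have "\<dots> = (\<Sum>p\<in>A. \<Sum>q\<in>A. LINT \<omega>|M. R q \<omega> \<bullet> R p \<omega>)"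
    using int by (simp add: Bochner_Integration.integral_sum Bochner_Integration.integrable_sum)
  \<comment> \<open>18 = 2 * 3 * 3: at most two pairs q survive for each p, and
    \<open>remainder\<close> has norm at most 3.\<close>
  also have "\<dots> \<le> (\<Sum>p\<in>A. 18)"
  proof (rule sum_mono)
    fix p assume p: "p \<in> A"
    obtain a b where ab: "p = (a, b)" "a \<in> I" "b \<in> I" using p J by (auto simp: A_def)
    have le9: "(LINT \<omega>|M. R q \<omega> \<bullet> R p \<omega>) \<le> 9" if "q \<in> A" for q
      using integral_mono[OF int[OF that p] M.integrable_const[of "9::real"]] bound[of q _ p]
      by (simp add: M.prob_space abs_le_iff)
    have "(\<Sum>q\<in>A. LINT \<omega>|M. R q \<omega> \<bullet> R p \<omega>) = (\<Sum>q\<in>A \<inter> {(a, b), (b, a)}. LINT \<omega>|M. R q \<omega> \<bullet> R p \<omega>)"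
    proof (rule sum.mono_neutral_right[OF fin(1)])
      show "\<forall>q\<in>A - A \<inter> {(a, b), (b, a)}. (LINT \<omega>|M. R q \<omega> \<bullet> R p \<omega>) = 0"
      proof
        fix q assume q: "q \<in> A - A \<inter> {(a, b), (b, a)}"
        obtain c d where "q = (c, d)" by (cases q)
        with q show "(LINT \<omega>|M. R q \<omega> \<bullet> R p \<omega>) = 0"
          using expectation_remainder_inner[of a b c d] ab J
          by (auto simp: R_def A_def inner_commute subset_iff)
      qed
    qed auto
    also have "\<dots> \<le> (\<Sum>q\<in>A \<inter> {(a, b), (b, a)}. 9)" by (intro sum_mono le9) auto
    also have "\<dots> \<le> 18"
    proof -
      have "card (A \<inter> {(a, b), (b, a)}) \<le> card {(a, b), (b, a)}" by (rule card_mono) auto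
      also have "\<dots> \<le> 2" by (rule order_trans[OF card_insert_le_m1]) auto
      finally show ?thesis by simp
    qed
    finally show "(\<Sum>q\<in>A. LINT \<omega>|M. R q \<omega> \<bullet> R p \<omega>) \<le> 18" .
  qed
  also have "\<dots> = 18 * real (card J) * real (card I)" by (simp add: A_def card_cartesian_product)
  finally show ?thesis .
qed

end

subsection \<open>Covariances of conditional expectations\<close>

text \<open>Two versions have equal integrals over all sets of \<open>F\<close>. Uniqueness of
  densities, applied to the measure restricted to \<open>F\<close>, makes them equal almost
  everywhere there, hence also under \<open>M\<close>.\<close>

lemma cond_expectation_AE_unique:
  fixes f g :: "'a \<Rightarrow> 'b::{real_inner, banach, second_countable_topology}"
  assumes M: "prob_space M" and sub: "subalgebra M F" and g: "is_cond_expectation M F f g"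
  shows "AE \<omega> in M. cond_expectation M F f \<omega> = g \<omega>"
    and "cond_expectation M F f \<in> borel_measurable M"
proof -
  define g' where "g' = cond_expectation M F f"
  have g': "is_cond_expectation M F f g'"
    unfolding g'_def cond_expectation_def using someI[of "is_cond_expectation M F f", OF g] .
  then show "cond_expectation M F f \<in> borel_measurable M"
    unfolding is_cond_expectation_def g'_def[symmetric] using measurable_from_subalg[OF sub] by blast
  interpret R: prob_space "restr_to_subalg M F" using sub M by (rule prob_space_restr_to_subalg)
  have int: "integrable (restr_to_subalg M F) k" if "is_cond_expectation M F f k" for k
    using that unfolding is_cond_expectation_def by (intro integrable_in_subalg[OF sub]) auto
  have set_int: "set_lebesgue_integral (restr_to_subalg M F) A k = set_lebesgue_integral M A f"
    if "A \<in> sets F" "is_cond_expectation M F f k" for A k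
  proof -
    have "set_lebesgue_integral (restr_to_subalg M F) A k = set_lebesgue_integral M A k"
      unfolding set_lebesgue_integral_def using that
      by (intro integral_subalgebra2[OF sub]) (auto simp: is_cond_expectation_def)
    then show ?thesis using that by (auto simp: is_cond_expectation_def)
  qed
  have "AE \<omega> in restr_to_subalg M F. g' \<omega> = g \<omega>"
    using int[OF g'] int[OF g]
    by (rule R.density_unique_banach) (simp add: set_int[OF _ g'] set_int[OF _ g] sets_restr_to_subalg[OF sub])
  then show "AE \<omega> in M. cond_expectation M F f \<omega> = g \<omega>"
    unfolding g'_def by (rule AE_restr_to_subalg[OF sub])
qed

context antisymmetric_kernel
begin

abbreviation P3 :: "('h \<times> 'h \<times> 'h) measure" where
  "P3 \<equiv> P \<Otimes>\<^sub>M (P \<Otimes>\<^sub>M P)"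

abbreviation third :: "'h \<times> 'h \<times> 'h \<Rightarrow> 'h" where
  "third \<equiv> (\<lambda>(x, y, z). z)"

lemma space_P: "space P = UNIV"
  using sets_eq_imp_space_eq[OF sets_P] by simp

text \<open>The variable z is outermost so that the inner integrals average over the first two
  coordinates with the conditioning variable fixed.\<close>

lemma integral_P3:
  fixes f :: "'h \<Rightarrow> 'h \<Rightarrow> 'h \<Rightarrow> 'b::{banach, second_countable_topology}"
  assumes [measurable]: "(\<lambda>(x, y, z). f x y z) \<in> borel_measurable P3" and bdd: "\<And>x y z. norm (f x y z) \<le> B"
  shows "(LINT \<omega>|P3. (\<lambda>(x, y, z). f x y z) \<omega>) = (LINT z|P. LINT y|P. LINT x|P. f x y z)"
proof -
  interpret PP: pair_prob_space P P ..
  interpret P3: pair_prob_space P "P \<Otimes>\<^sub>M P" ..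
  have int: "integrable (P \<Otimes>\<^sub>M (P \<Otimes>\<^sub>M P)) (case_prod (\<lambda>x (y, z). f x y z))"
    by (rule P3.integrable_const_bound[of _ B]) (auto simp: bdd)
  have eq: "(\<lambda>w. LINT x|P. (case w of (y, z) \<Rightarrow> f x y z)) = (\<lambda>(y, z). LINT x|P. f x y z)"
    by (simp add: fun_eq_iff)
  have "integrable (P \<Otimes>\<^sub>M P) (\<lambda>(y, z). LINT x|P. f x y z)"
    using P3.integrable_snd[OF int] unfolding eq .
  from PP.integral_snd[OF this] P3.integral_snd[OF int] show ?thesis
    unfolding eq by simp
qed

lemma subalgebra_third: "subalgebra P3 (vimage_algebra (space P3) third borel)"
proof -
  have "third \<in> borel_measurable P3" by measurable
  then show ?thesis
    by (auto simp: subalgebra_def sets_vimage_algebra2 intro!: sets_image_in_sets)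
qed

lemma integral_third:
  fixes f :: "'h \<Rightarrow> 'b::{banach, second_countable_topology}"
  assumes [measurable]: "f \<in> borel_measurable borel" and "\<And>z. norm (f z) \<le> B"
  shows "(LINT \<omega>|P3. f (third \<omega>)) = (LINT z|P. f z)"
  using integral_P3[of "\<lambda>x y z. f z" B] assms by (simp add: prob_space case_prod_beta')

text \<open>Averaging sgn(x - z) over x gives -psi(z). The hypothesis \<open>eq\<close> is phrased
  so that the kernel may involve either the first or the second coordinate.\<close>

lemma cond_expectation_third:
  assumes g[measurable]: "(\<lambda>(x, y, z). g x y z) \<in> borel_measurable P3" and B: "\<And>x y z. norm (g x y z) \<le> 1"
    and eq: "\<And>z. (LINT y|P. LINT x|P. g x y z) = - psi z"
  shows "is_cond_expectation P3 (vimage_algebra (space P3) third borel) (\<lambda>(x, y, z). g x y z) (\<lambda>\<omega>. - psi (third \<omega>))"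
  unfolding is_cond_expectation_def
proof (intro conjI ballI)
  interpret PP: pair_prob_space P P ..
  interpret P3: pair_prob_space P "P \<Otimes>\<^sub>M P" ..
  have third[measurable]: "third \<in> measurable (vimage_algebra (space P3) third borel) borel"
    by (rule measurable_vimage_algebra1) simp
  show "(\<lambda>\<omega>. - psi (third \<omega>)) \<in> borel_measurable (vimage_algebra (space P3) third borel)"
    by measurable
  show "integrable P3 (\<lambda>\<omega>. - psi (third \<omega>))"
    by (rule P3.integrable_const_bound[of _ 1]) (auto simp: psi_bound)
  fix A assume "A \<in> sets (vimage_algebra (space P3) third borel)"
  then obtain S where S[measurable]: "S \<in> sets borel" and A: "A = third -` S \<inter> space P3"
    by (subst (asm) sets_vimage_algebra2) auto
  have ind: "indicator A \<omega> = (indicator S (third \<omega>) :: real)" for \<omega>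
    unfolding A by (simp add: space_pair_measure space_P indicator_def)
  have "set_lebesgue_integral P3 A (\<lambda>(x, y, z). g x y z) = (LINT \<omega>|P3. (\<lambda>(x, y, z). indicator S z *\<^sub>R g x y z) \<omega>)"
    unfolding set_lebesgue_integral_def ind by (simp add: case_prod_beta')
  also have "\<dots> = (LINT z|P. LINT y|P. LINT x|P. indicator S z *\<^sub>R g x y z)"
  proof (rule integral_P3)
    have "(\<lambda>\<omega>. indicator S (third \<omega>) *\<^sub>R (\<lambda>(x, y, z). g x y z) \<omega>) \<in> borel_measurable P3"
      by measurable
    then show "(\<lambda>(x, y, z). indicator S z *\<^sub>R g x y z) \<in> borel_measurable P3"
      by (simp add: case_prod_beta')
    show "norm (indicator S z *\<^sub>R g x y z) \<le> 1" for x y z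
      using B by (auto simp: indicator_def)
  qed
  also have "\<dots> = (LINT z|P. indicator S z *\<^sub>R (- psi z))"
    unfolding eq[symmetric] by simp
  also have "\<dots> = (LINT \<omega>|P3. (\<lambda>z. indicator S z *\<^sub>R (- psi z)) (third \<omega>))"
    by (rule integral_third[symmetric, where B=1]) (auto simp: indicator_def psi_bound)
  also have "\<dots> = set_lebesgue_integral P3 A (\<lambda>\<omega>. - psi (third \<omega>))"
    unfolding set_lebesgue_integral_def ind ..
  finally show "set_lebesgue_integral P3 A (\<lambda>\<omega>. - psi (third \<omega>)) = set_lebesgue_integral P3 A (\<lambda>(x, y, z). g x y z)" ..
qed

text \<open>Both conditional expectations are -psi of the third coordinate: their means vanish, and
  the two minus signs cancel in the tensor product.\<close>

lemma Cov_cond_expectation_third: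
  defines "F \<equiv> vimage_algebra (space P3) third borel"
  shows "Cov P3 (cond_expectation P3 F (\<lambda>(x, y, z). h x z)) (cond_expectation P3 F (\<lambda>(x, y, z). h y z)) w
    = (LINT z|P. (w \<bullet> psi z) *\<^sub>R psi z)"
proof -
  interpret PP: pair_prob_space P P ..
  interpret P3: pair_prob_space P "P \<Otimes>\<^sub>M P" ..
  have sub: "subalgebra P3 F" unfolding F_def by (rule subalgebra_third)
  have ps: "prob_space P3" by (rule P3.prob_space_axioms)
  have X: "is_cond_expectation P3 F (\<lambda>(x, y, z). h x z) (\<lambda>\<omega>. - psi (third \<omega>))"
    unfolding F_def by (rule cond_expectation_third) (measurable, auto simp: h_bound integral_h_left prob_space)
  have Y: "is_cond_expectation P3 F (\<lambda>(x, y, z). h y z) (\<lambda>\<omega>. - psi (third \<omega>))"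
    unfolding F_def by (rule cond_expectation_third) (measurable, auto simp: h_bound integral_h_left prob_space)
  define A where "A = cond_expectation P3 F (\<lambda>(x, y, z). h x z)"
  define B where "B = cond_expectation P3 F (\<lambda>(x, y, z). h y z)"
  have A: "AE \<omega> in P3. A \<omega> = - psi (third \<omega>)" and [measurable]: "A \<in> borel_measurable P3"
    unfolding A_def using cond_expectation_AE_unique[OF ps sub X] by auto
  have B: "AE \<omega> in P3. B \<omega> = - psi (third \<omega>)" and [measurable]: "B \<in> borel_measurable P3"
    unfolding B_def using cond_expectation_AE_unique[OF ps sub Y] by auto
  have "(LINT \<omega>|P3. A \<omega>) = (LINT \<omega>|P3. - psi (third \<omega>))"
    using A by (intro integral_cong_AE) auto
  also have "\<dots> = (LINT z|P. - psi z)" by (rule integral_third[of "\<lambda>z. - psi z" 1]) (auto simp: psi_bound)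
  finally have EA: "(LINT \<omega>|P3. A \<omega>) = 0" by (simp add: expectation_psi)
  have "(LINT \<omega>|P3. tensor (A \<omega>) (B \<omega>) w) = (LINT \<omega>|P3. (w \<bullet> psi (third \<omega>)) *\<^sub>R psi (third \<omega>))"
  proof (rule integral_cong_AE)
    show "AE \<omega> in P3. tensor (A \<omega>) (B \<omega>) w = (w \<bullet> psi (third \<omega>)) *\<^sub>R psi (third \<omega>)"
      using A B by eventually_elim (simp add: tensor_def)
  qed (unfold tensor_def, measurable)
  also have "\<dots> = (LINT z|P. (w \<bullet> psi z) *\<^sub>R psi z)"
  proof (rule integral_third)
    show "norm ((w \<bullet> psi z) *\<^sub>R psi z) \<le> (norm w * 1) * 1" for z
      unfolding norm_scaleR real_norm_def
      by (intro mult_mono order_trans[OF Cauchy_Schwarz_ineq2] psi_bound) auto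
  qed measurable
  finally show ?thesis
    unfolding Cov_def A_def[symmetric] B_def[symmetric] EA by (simp add: tensor_def)
qed

end

subsection \<open>The central limit theorem for the rank statistic\<close>

lemma exp_minus_approx:
  fixes x :: real
  assumes "0 \<le> x"
  shows "\<bar>exp (- x) - (1 - x)\<bar> \<le> x\<^sup>2"
proof -
  have "exp (- x) \<le> 1 / (1 + x)"
    using exp_ge_add_one_self[of x] assms by (simp add: exp_minus field_simps)
  also have "\<dots> \<le> 1 - x + x\<^sup>2"
  proof (subst pos_divide_le_eq)
    \<comment> \<open>The product on the right equals 1 + x^3.\<close>
    show "1 \<le> (1 - x + x\<^sup>2) * (1 + x)"
      using zero_le_power[OF assms, of 3] by (simp add: power2_eq_square power3_eq_cube algebra_simps)
  qed (use assms in simp)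
  finally show ?thesis using exp_ge_add_one_self[of "- x"] zero_le_power2[of x] by linarith
qed

text \<open>Lindeberg's comparison with a uniform bound d. The term d/6 is the third-order Taylor
  remainder, where |\<xi>|^3 is at most d \<xi>^2; the term d^2/4 comes from replacing 1 - v/2 by
  exp(-v/2), where v is at most d^2.\<close>

lemma (in prob_space) char_sum_bounded_approx:
  assumes I: "finite I" and ind: "indep_vars (\<lambda>_. borel) \<xi> I"
    and bound: "\<And>i \<omega>. i \<in> I \<Longrightarrow> \<bar>\<xi> i \<omega>\<bar> \<le> d" and d: "0 \<le> d"
    and mean: "\<And>i. i \<in> I \<Longrightarrow> expectation (\<xi> i) = 0"
  defines "s \<equiv> \<Sum>i\<in>I. expectation (\<lambda>\<omega>. (\<xi> i \<omega>)\<^sup>2)"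
  shows "cmod (char (distr M borel (\<lambda>\<omega>. \<Sum>i\<in>I. \<xi> i \<omega>)) 1 - exp (- s / 2)) \<le> (d / 6 + d\<^sup>2 / 4) * s"
proof -
  define v where "v = (\<lambda>i. expectation (\<lambda>\<omega>. (\<xi> i \<omega>)\<^sup>2))"
  have meas[measurable]: "\<xi> i \<in> borel_measurable M" if "i \<in> I" for i
    using ind that by (auto simp: indep_vars_def)
  have v0: "0 \<le> v i" for i unfolding v_def by simp
  have int: "integrable M (\<lambda>\<omega>. (\<xi> i \<omega>)^k)" if "i \<in> I" for i k
    using that bound[OF that] by (intro integrable_const_bound[of _ "d^k"]) (auto simp: power_abs power_mono)
  have step: "cmod (char (distr M borel (\<xi> i)) 1 - exp (- v i / 2)) \<le> (d / 6 + d\<^sup>2 / 4) * v i" if i: "i \<in> I" for i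
  proof -
    interpret D: real_distribution "distr M borel (\<xi> i)" using i by (intro real_distribution_distr) simp
    have "cmod (char (distr M borel (\<xi> i)) 1 - (1 - 1\<^sup>2 * v i / 2)) \<le>
        (1\<^sup>2 / 6) * D.expectation (\<lambda>x. min (6 * x\<^sup>2) (\<bar>1\<bar> * \<bar>x\<bar> ^ 3))"
      by (rule D.char_approx3)
        (use i int[OF i, of 1] int[OF i, of 2] mean[OF i] in \<open>auto simp: integrable_distr_eq integral_distr v_def\<close>)
    also have "D.expectation (\<lambda>x. min (6 * x\<^sup>2) (\<bar>1\<bar> * \<bar>x\<bar> ^ 3)) = expectation (\<lambda>\<omega>. min (6 * (\<xi> i \<omega>)\<^sup>2) (\<bar>\<xi> i \<omega>\<bar> ^ 3))"
      using i by (simp add: integral_distr)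
    also have "\<dots> \<le> expectation (\<lambda>\<omega>. d * (\<xi> i \<omega>)\<^sup>2)"
    proof (rule integral_mono)
      show "integrable M (\<lambda>\<omega>. min (6 * (\<xi> i \<omega>)\<^sup>2) (\<bar>\<xi> i \<omega>\<bar> ^ 3))"
        using i int[OF i, of 2] int[OF i, of 3] integrable_abs[OF int[OF i, of 3]]
        by (intro Bochner_Integration.integrable_min) (auto simp: power_abs)
      show "integrable M (\<lambda>\<omega>. d * (\<xi> i \<omega>)\<^sup>2)" using int[OF i, of 2] by simp
      fix \<omega>
      have "\<bar>\<xi> i \<omega>\<bar> ^ 3 = \<bar>\<xi> i \<omega>\<bar> * (\<xi> i \<omega>)\<^sup>2" by (simp add: power3_eq_cube power2_eq_square)
      also have "\<dots> \<le> d * (\<xi> i \<omega>)\<^sup>2" using bound[OF i] by (intro mult_right_mono) auto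
      finally show "min (6 * (\<xi> i \<omega>)\<^sup>2) (\<bar>\<xi> i \<omega>\<bar> ^ 3) \<le> d * (\<xi> i \<omega>)\<^sup>2" by simp
    qed
    also have "\<dots> = d * v i" by (simp add: v_def)
    finally have 1: "cmod (char (distr M borel (\<xi> i)) 1 - (1 - v i / 2)) \<le> d / 6 * v i" by simp
    have "v i \<le> expectation (\<lambda>\<omega>. d\<^sup>2)"
      unfolding v_def using int[OF i, of 2] bound[OF i] d
      by (intro integral_mono) (auto simp: abs_le_square_iff[symmetric])
    then have vd: "v i \<le> d\<^sup>2" by (simp add: prob_space)
    have "cmod (exp (- v i / 2) - (1 - v i / 2)) = \<bar>exp (- (v i / 2)) - (1 - v i / 2)\<bar>"
      unfolding norm_of_real[symmetric, where 'a=complex] by simp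
    also have "\<dots> \<le> (v i / 2)\<^sup>2" using v0[of i] by (intro exp_minus_approx) simp
    also have "\<dots> = v i * v i / 4" by (simp add: power2_eq_square)
    also have "\<dots> \<le> d\<^sup>2 * v i / 4" using vd v0[of i] by (intro divide_right_mono mult_right_mono) auto
    finally have 2: "cmod (exp (- v i / 2) - (1 - v i / 2)) \<le> d\<^sup>2 / 4 * v i" by simp
    have "cmod (char (distr M borel (\<xi> i)) 1 - exp (- v i / 2)) \<le>
      cmod (char (distr M borel (\<xi> i)) 1 - (1 - v i / 2)) + cmod (exp (- v i / 2) - (1 - v i / 2))"
      using norm_triangle_ineq4[of "char (distr M borel (\<xi> i)) 1 - (1 - v i / 2)" "exp (- v i / 2) - (1 - v i / 2)"] by simp
    with 1 2 show ?thesis by (simp add: distrib_right)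
  qed
  have "exp (- s / 2) = exp (\<Sum>i\<in>I. - v i / 2)"
    by (simp add: s_def v_def sum_negf sum_divide_distrib)
  also have "\<dots> = (\<Prod>i\<in>I. exp (- v i / 2))" using I by (rule exp_sum)
  finally have "complex_of_real (exp (- s / 2)) = (\<Prod>i\<in>I. complex_of_real (exp (- v i / 2)))" by simp
  moreover have "char (distr M borel (\<lambda>\<omega>. \<Sum>i\<in>I. \<xi> i \<omega>)) 1 = (\<Prod>i\<in>I. char (distr M borel (\<xi> i)) 1)"
    using ind by (rule char_distr_sum)
  \<comment> \<open>All factors have modulus at most 1, so the errors of the factors simply add
    up.\<close>
  moreover have "cmod ((\<Prod>i\<in>I. char (distr M borel (\<xi> i)) 1) - (\<Prod>i\<in>I. complex_of_real (exp (- v i / 2))))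
      \<le> (\<Sum>i\<in>I. cmod (char (distr M borel (\<xi> i)) 1 - complex_of_real (exp (- v i / 2))))"
  proof (rule norm_prod_diff)
    fix i assume i: "i \<in> I"
    interpret D: real_distribution "distr M borel (\<xi> i)" using i by (intro real_distribution_distr) simp
    show "cmod (char (distr M borel (\<xi> i)) 1) \<le> 1" by (rule D.cmod_char_le_1)
    show "cmod (complex_of_real (exp (- v i / 2))) \<le> 1" using v0[of i] by simp
  qed
  moreover have "(\<Sum>i\<in>I. cmod (char (distr M borel (\<xi> i)) 1 - complex_of_real (exp (- v i / 2)))) \<le> (\<Sum>i\<in>I. (d / 6 + d\<^sup>2 / 4) * v i)"
    by (rule sum_mono) (use step in simp)
  moreover have "(\<Sum>i\<in>I. (d / 6 + d\<^sup>2 / 4) * v i) = (d / 6 + d\<^sup>2 / 4) * s"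
    by (simp add: s_def v_def sum_distrib_left)
  ultimately show ?thesis by simp
qed

section \<open>Random vectors in the product Hilbert space\<close>

lemma norm_vec_squared: "(norm (x :: 'b::real_inner ^ 'k::finite))\<^sup>2 = (\<Sum>k\<in>UNIV. (norm (x $ k))\<^sup>2)"
  by (simp add: power2_norm_eq_inner inner_vec_def)

lemma bounded_linear_axis: "bounded_linear (axis k :: 'b::real_inner \<Rightarrow> 'b ^ 'k::finite)"
proof (rule bounded_linear_intro[where K=1])
  show "axis k (x + y) = axis k x + (axis k y :: 'b ^ 'k)" for x y by (simp add: vec_eq_iff axis_def)
  show "axis k (r *\<^sub>R x) = r *\<^sub>R (axis k x :: 'b ^ 'k)" for r x by (simp add: vec_eq_iff axis_def)
  fix x :: 'b
  have "(norm (axis k x :: 'b ^ 'k))\<^sup>2 = (\<Sum>j\<in>UNIV. if j = k then (norm x)\<^sup>2 else 0)"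
    unfolding norm_vec_squared by (intro sum.cong) (auto simp: axis_def)
  then show "norm (axis k x :: 'b ^ 'k) \<le> norm x * 1" by simp
qed

text \<open>Writes a vector as a finite sum of bounded linear images of its components, which
  reduces measurability and integrability to the components.\<close>

lemma vec_lambda_eq_sum_axis: "(\<chi> k. f k) = (\<Sum>k\<in>UNIV. axis k (f k :: 'b::real_inner) :: 'b ^ 'k::finite)"
  by (simp add: vec_eq_iff axis_def)

lemma borel_measurable_vec_lambda[measurable (raw)]:
  fixes f :: "'k::finite \<Rightarrow> 'a \<Rightarrow> 'b::{real_inner, second_countable_topology}"
  assumes "\<And>k. f k \<in> borel_measurable M"
  shows "(\<lambda>\<omega>. \<chi> k. f k \<omega>) \<in> borel_measurable M"
  unfolding vec_lambda_eq_sum_axis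
proof (rule borel_measurable_sum)
  fix k
  have "(axis k :: 'b \<Rightarrow> 'b ^ 'k) \<in> borel_measurable borel"
    by (rule borel_measurable_continuous_onI[OF linear_continuous_on[OF bounded_linear_axis]])
  from measurable_compose[OF assms this] show "(\<lambda>\<omega>. axis k (f k \<omega>) :: 'b ^ 'k) \<in> borel_measurable M" .
qed

lemma has_bochner_integral_vec_lambda:
  fixes f :: "'k::finite \<Rightarrow> 'a \<Rightarrow> 'b::{real_inner, banach, second_countable_topology}"
  assumes "\<And>k. has_bochner_integral M (f k) (x k)"
  shows "has_bochner_integral M (\<lambda>\<omega>. \<chi> k. f k \<omega>) (\<chi> k. x k)"
  unfolding vec_lambda_eq_sum_axis
  by (rule has_bochner_integral_sum) (rule has_bochner_integral_bounded_linear[OF bounded_linear_axis assms])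

lemma (in prob_space) expectation_le_sqrt_second_moment:
  assumes "integrable M X" "integrable M (\<lambda>\<omega>. (X \<omega>)\<^sup>2 :: real)"
  shows "expectation X \<le> sqrt (expectation (\<lambda>\<omega>. (X \<omega>)\<^sup>2))"
  using variance_eq[OF assms] variance_positive[of X] by (intro real_le_rsqrt) simp

lemma cos_diff_le: "\<bar>cos x - cos y\<bar> \<le> \<bar>x - y\<bar>" for x y :: real
proof -
  have "\<bar>cos x - cos y\<bar> = 2 * (\<bar>sin ((x + y) / 2)\<bar> * \<bar>sin ((y - x) / 2)\<bar>)"
    unfolding cos_diff_cos by (simp add: abs_mult)
  also have "\<dots> \<le> 2 * (1 * \<bar>(y - x) / 2\<bar>)"
    by (intro mult_left_mono mult_mono abs_sin_le_one abs_sin_x_le_abs_x) auto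
  finally show ?thesis by (simp add: abs_minus_commute)
qed

section \<open>The k-sample model and its weights\<close>

locale k_samples = antisymmetric_kernel P h
  for P :: "'h::{real_inner, banach, second_countable_topology} measure" and h +
  fixes M :: "nat \<Rightarrow> 'a measure" and X :: "nat \<Rightarrow> 'k::finite \<Rightarrow> nat \<Rightarrow> 'a \<Rightarrow> 'h"
    and N :: "nat \<Rightarrow> 'k \<Rightarrow> nat" and lam :: "'k \<Rightarrow> real"
  assumes M_prob: "prob_space (M n)"
    and X_indep: "prob_space.indep_vars (M n) (\<lambda>_. borel) (\<lambda>(k, i). X n k i) (SIGMA k:UNIV. {1..N n k})"
    and X_distr: "i \<in> {1..N n k} \<Longrightarrow> distr (M n) borel (X n k i) = P"
    and N_sum: "(\<Sum>k\<in>UNIV. N n k) = n"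
    and lam_pos: "0 < lam k"
    and N_lim: "(\<lambda>n. real (N n k) / real n) \<longlonglongrightarrow> lam k"
begin

definition Ix :: "nat \<Rightarrow> ('k \<times> nat) set" where
  "Ix n = (SIGMA k:UNIV. {1..N n k})"

definition Y :: "nat \<Rightarrow> 'k \<times> nat \<Rightarrow> 'a \<Rightarrow> 'h" where
  "Y n = (\<lambda>(k, i). X n k i)"

lemma sample: "iid_sample P h (M n) (Y n) (Ix n)"
proof -
  interpret M: prob_space "M n" by (rule M_prob)
  show ?thesis
  proof unfold_locales
    show "finite (Ix n)" by (simp add: Ix_def)
    show "M.indep_vars (\<lambda>_. borel) (Y n) (Ix n)"
      unfolding Ix_def Y_def by (rule X_indep)
    show "distr (M n) borel (Y n i) = P" if "i \<in> Ix n" for i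
      using that X_distr by (auto simp: Ix_def Y_def)
  qed
qed

lemma sum_Ix: "(\<Sum>p\<in>Ix n. f (fst p)) = (\<Sum>l\<in>UNIV. real (N n l) *\<^sub>R (f l :: 'b::real_vector))"
proof -
  have "(\<Sum>p\<in>Ix n. f (fst p)) = (\<Sum>(l, i)\<in>(SIGMA l:UNIV. {1..N n l}). f l)"
    by (simp add: Ix_def case_prod_beta')
  also have "\<dots> = (\<Sum>l\<in>UNIV. \<Sum>i\<in>{1..N n l}. f l)"
    by (rule sum.Sigma[symmetric]) auto
  finally show ?thesis by (simp add: sum_constant_scaleR)
qed

lemma card_Ix: "card (Ix n) = n"
  unfolding Ix_def using N_sum[of n] by (simp add: card_SigmaI)

definition ratio :: "nat \<Rightarrow> 'k \<Rightarrow> real" where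
  "ratio n k = real (N n k) / real n"

text \<open>\<open>coef n k l\<close> is the weight that \<open>psi\<close> of an observation of group \<open>l\<close> carries in component \<open>k\<close> of
  the statistic; \<open>proj\<close> is the limit of these weights after scaling by the square root of the size
  of group \<open>l\<close>.\<close>

definition coef :: "nat \<Rightarrow> 'k \<Rightarrow> 'k \<Rightarrow> real" where
  "coef n k l = ((if k = l then 1 / sqrt (ratio n k) else 0) - sqrt (ratio n k)) / sqrt n"

definition proj :: "'k \<Rightarrow> 'k \<Rightarrow> real" where
  "proj k l = (if k = l then 1 else 0) - sqrt (lam k * lam l)"

lemma coef_eq:
  assumes "0 < n"
  shows "coef n k l = (if k = l then 1 / sqrt (N n k) else 0) - sqrt (N n k) / n"
  using assms by (simp add: coef_def ratio_def real_sqrt_divide diff_divide_distrib)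

lemma lam_sum: "(\<Sum>k\<in>UNIV. lam k) = 1"
proof (rule LIMSEQ_unique)
  show "(\<lambda>n. \<Sum>k\<in>UNIV. real (N n k) / real n) \<longlonglongrightarrow> (\<Sum>k\<in>UNIV. lam k)"
    by (intro tendsto_sum N_lim)
  have "(\<Sum>k\<in>UNIV. real (N n k) / real n) = 1" if "0 < n" for n
  proof -
    have "(\<Sum>k\<in>UNIV. real (N n k)) = real n" using N_sum[of n] by (metis of_nat_sum)
    then show ?thesis using that by (simp add: sum_divide_distrib[symmetric])
  qed
  then have "\<forall>\<^sub>F n in sequentially. (\<Sum>k\<in>UNIV. real (N n k) / real n) = 1"
    by (auto simp: eventually_sequentially intro: exI[of _ 1])
  then show "(\<lambda>n. \<Sum>k\<in>UNIV. real (N n k) / real n) \<longlonglongrightarrow> 1"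
    by (rule tendsto_eventually)
qed

lemma ratio_lim: "(\<lambda>n. ratio n k) \<longlonglongrightarrow> lam k"
  unfolding ratio_def by (rule N_lim)

text \<open>This is the negligibility of single summands that makes the error in
  \<open>char_sum_bounded_approx\<close> vanish. Positivity of \<open>lam k\<close> keeps
  1/sqrt(ratio) under control.\<close>

lemma coef_lim: "(\<lambda>n. coef n k l) \<longlonglongrightarrow> 0"
proof -
  have "(\<lambda>n. ((if k = l then 1 / sqrt (ratio n k) else 0) - sqrt (ratio n k)) * (1 / sqrt (real n)))
    \<longlonglongrightarrow> ((if k = l then 1 / sqrt (lam k) else 0) - sqrt (lam k)) * 0"
  proof (intro tendsto_mult tendsto_diff)
    show "(\<lambda>n. if k = l then 1 / sqrt (ratio n k) else 0) \<longlonglongrightarrow> (if k = l then 1 / sqrt (lam k) else 0)"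
      using lam_pos[of k] by (auto intro!: tendsto_intros ratio_lim)
    show "(\<lambda>n. sqrt (ratio n k)) \<longlonglongrightarrow> sqrt (lam k)" by (intro tendsto_intros ratio_lim)
    show "(\<lambda>n. 1 / sqrt (real n)) \<longlonglongrightarrow> 0"
      using tendsto_real_sqrt[OF lim_1_over_n] by (simp add: real_sqrt_divide)
  qed
  then show ?thesis by (simp add: coef_def)
qed

lemma coef_scaled_lim: "(\<lambda>n. sqrt (N n l) * coef n k l) \<longlonglongrightarrow> proj k l"
proof -
  have "(\<lambda>n. sqrt (ratio n l) * ((if k = l then 1 / sqrt (ratio n k) else 0) - sqrt (ratio n k)))
    \<longlonglongrightarrow> sqrt (lam l) * ((if k = l then 1 / sqrt (lam k) else 0) - sqrt (lam k))"
  proof (intro tendsto_mult tendsto_diff)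
    show "(\<lambda>n. if k = l then 1 / sqrt (ratio n k) else 0) \<longlonglongrightarrow> (if k = l then 1 / sqrt (lam k) else 0)"
      using lam_pos[of k] by (auto intro!: tendsto_intros ratio_lim)
  qed (intro tendsto_intros ratio_lim)+
  moreover have "sqrt (lam l) * ((if k = l then 1 / sqrt (lam k) else 0) - sqrt (lam k)) = proj k l"
    using lam_pos[of l] by (auto simp: proj_def real_sqrt_mult algebra_simps)
  moreover have "sqrt (N n l) * coef n k l = sqrt (ratio n l) * ((if k = l then 1 / sqrt (ratio n k) else 0) - sqrt (ratio n k))" for n
    by (simp add: coef_def ratio_def real_sqrt_divide)
  ultimately show ?thesis by simp
qed

lemma coef_square_sum_lim:
  "(\<lambda>n. \<Sum>p\<in>Ix n. coef n k (fst p) * coef n k' (fst p)) \<longlonglongrightarrow> (\<Sum>l\<in>UNIV. proj k l * proj k' l)"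
proof -
  have "(\<Sum>p\<in>Ix n. coef n k (fst p) * coef n k' (fst p))
      = (\<Sum>l\<in>UNIV. (sqrt (N n l) * coef n k l) * (sqrt (N n l) * coef n k' l))" for n
    unfolding sum_Ix[where f="\<lambda>l. coef n k l * coef n k' l"]
    by (intro sum.cong refl) (simp add: power2_eq_square[symmetric] algebra_simps)
  then show ?thesis
    by (simp only:) (intro tendsto_sum tendsto_mult coef_scaled_lim)
qed

text \<open>As a matrix, \<open>proj\<close> is I - s s^T with s having entries sqrt(lam k). By
  \<open>lam_sum\<close> the vector s has norm 1, so \<open>proj\<close> is an orthogonal
  projection.\<close>

lemma proj_mult: "(\<Sum>l\<in>UNIV. proj k l * proj k' l) = proj k k'"
proof -
  have "proj k l * proj k' l = (if l = k then proj k' k else 0) - (if l = k' then sqrt (lam k * lam k') else 0)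
      + sqrt (lam k * lam k') * lam l" for l
    using lam_pos[of l] lam_pos[of k] lam_pos[of k']
    by (auto simp: proj_def algebra_simps real_sqrt_mult)
  then have "(\<Sum>l\<in>UNIV. proj k l * proj k' l) = proj k' k - sqrt (lam k * lam k') + sqrt (lam k * lam k') * (\<Sum>l\<in>UNIV. lam l)"
    by (simp add: sum.distrib sum_subtractf sum_distrib_left)
  then show ?thesis by (simp add: lam_sum proj_def mult.commute eq_commute)
qed

section \<open>The linear part: characteristic functions and tightness\<close>

text \<open>Kept generic in \<open>g\<close>, since tightness compares \<open>psi\<close> with
  centered simple functions under the same weights.\<close>

definition Lin :: "nat \<Rightarrow> ('h \<Rightarrow> 'b::real_inner) \<Rightarrow> 'a \<Rightarrow> 'b ^ 'k" where
  "Lin n g \<omega> = (\<chi> k. \<Sum>p\<in>Ix n. coef n k (fst p) *\<^sub>R g (Y n p \<omega>))"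

lemma Lin_measurable[measurable]:
  fixes g :: "'h \<Rightarrow> 'b::{real_inner, second_countable_topology}"
  assumes [measurable]: "g \<in> borel_measurable borel"
  shows "Lin n g \<in> borel_measurable (M n)"
proof -
  interpret S: iid_sample P h "M n" "Y n" "Ix n" by (rule sample)
  show ?thesis unfolding Lin_def by measurable
qed

definition coef_bound :: real where
  "coef_bound = (SUP n. \<Sum>k\<in>UNIV. \<Sum>p\<in>Ix n. (coef n k (fst p))\<^sup>2)"

text \<open>The sums converge, hence are bounded, so the supremum in \<open>coef_bound\<close> is a
  genuine one.\<close>

lemma coef_square_sum_le: "(\<Sum>k\<in>UNIV. \<Sum>p\<in>Ix n. (coef n k (fst p))\<^sup>2) \<le> coef_bound"
  unfolding coef_bound_def
proof (rule cSUP_upper)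
  have "convergent (\<lambda>n. \<Sum>k\<in>UNIV. \<Sum>p\<in>Ix n. (coef n k (fst p))\<^sup>2)"
    unfolding convergent_def power2_eq_square
    by (rule exI, rule tendsto_sum, rule coef_square_sum_lim)
  then have "Bseq (\<lambda>n. \<Sum>k\<in>UNIV. \<Sum>p\<in>Ix n. (coef n k (fst p))\<^sup>2)"
    by (rule convergent_imp_Bseq)
  then show "bdd_above (range (\<lambda>n. \<Sum>k\<in>UNIV. \<Sum>p\<in>Ix n. (coef n k (fst p))\<^sup>2))"
    by (auto simp: Bseq_def bdd_above_def intro: order_trans[OF abs_ge_self])
qed simp

lemma Lin_second_moment:
  fixes g :: "'h \<Rightarrow> 'b::{real_inner, banach, second_countable_topology}"
  assumes g: "g \<in> borel_measurable borel" "\<And>x. norm (g x) \<le> B" "(LINT x|P. g x) = 0"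
  shows "integrable (M n) (\<lambda>\<omega>. (norm (Lin n g \<omega>))\<^sup>2)"
    and "(LINT \<omega>|M n. (norm (Lin n g \<omega>))\<^sup>2) \<le> coef_bound * (LINT x|P. (norm (g x))\<^sup>2)"
proof -
  interpret S: iid_sample P h "M n" "Y n" "Ix n" by (rule sample)
  note m = S.linear_second_moment[OF g]
  show "integrable (M n) (\<lambda>\<omega>. (norm (Lin n g \<omega>))\<^sup>2)"
    unfolding norm_vec_squared Lin_def vec_lambda_beta by (intro Bochner_Integration.integrable_sum m(2))
  have "(LINT \<omega>|M n. (norm (Lin n g \<omega>))\<^sup>2) = (\<Sum>k\<in>UNIV. \<Sum>p\<in>Ix n. (coef n k (fst p))\<^sup>2) * (LINT x|P. (norm (g x))\<^sup>2)"
    unfolding norm_vec_squared Lin_def vec_lambda_beta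
    by (subst Bochner_Integration.integral_sum) (simp_all add: m sum_distrib_right)
  also have "\<dots> \<le> coef_bound * (LINT x|P. (norm (g x))\<^sup>2)"
    by (intro mult_right_mono coef_square_sum_le) simp
  finally show "(LINT \<omega>|M n. (norm (Lin n g \<omega>))\<^sup>2) \<le> coef_bound * (LINT x|P. (norm (g x))\<^sup>2)" .
qed

lemma coef_bound_nonneg: "0 \<le> coef_bound"
  by (rule order_trans[OF _ coef_square_sum_le[of 0]]) (intro sum_nonneg zero_le_power2)

definition psi_cov :: "'h \<Rightarrow> 'h \<Rightarrow> real" where
  "psi_cov u v = (LINT x|P. (psi x \<bullet> u) * (psi x \<bullet> v))"

lemma integrable_psi_inner: "integrable P (\<lambda>x. (psi x \<bullet> u) * (psi x \<bullet> v))"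
proof (rule integrable_const_bound[of _ "norm u * norm v"])
  show "AE x in P. norm ((psi x \<bullet> u) * (psi x \<bullet> v)) \<le> norm u * norm v"
  proof (intro AE_I2)
    fix x
    have "\<bar>psi x \<bullet> u\<bar> \<le> norm u" for u
      by (rule order_trans[OF Cauchy_Schwarz_ineq2]) (simp add: mult_left_le_one_le psi_bound)
    then show "norm ((psi x \<bullet> u) * (psi x \<bullet> v)) \<le> norm u * norm v"
      by (simp add: abs_mult mult_mono)
  qed
qed measurable

text \<open>The bilinear form of the block operator with blocks \<open>proj k k'\<close> times the
  covariance of \<open>psi\<close>; \<open>Sigma_op_inner\<close> identifies it with
  \<open>Sigma_op\<close>.\<close>

definition limit_cov :: "'h ^ 'k \<Rightarrow> 'h ^ 'k \<Rightarrow> real" where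
  "limit_cov u v = (\<Sum>k\<in>UNIV. \<Sum>k'\<in>UNIV. proj k k' * psi_cov (u $ k) (v $ k'))"

lemma Lin_cosine_lim:
  "(\<lambda>n. LINT \<omega>|M n. cos (t \<bullet> Lin n psi \<omega> + b)) \<longlonglongrightarrow> cos b * exp (- limit_cov t t / 2)"
proof -
  define \<xi> where "\<xi> = (\<lambda>n p \<omega>. \<Sum>k\<in>UNIV. coef n k (fst p) * (psi (Y n p \<omega>) \<bullet> t $ k))"
  \<comment> \<open>Summing over all groups l, where a single one would do, gives a bound for the
    summands that depends on n alone.\<close>
  define d where "d = (\<lambda>n. \<Sum>k\<in>UNIV. \<Sum>l\<in>UNIV. \<bar>coef n k l\<bar> * norm (t $ k))"
  define s where "s = (\<lambda>n. \<Sum>k\<in>UNIV. \<Sum>k'\<in>UNIV. (\<Sum>p\<in>Ix n. coef n k (fst p) * coef n k' (fst p)) * psi_cov (t $ k) (t $ k'))"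
  define \<phi> where "\<phi> = (\<lambda>n. char (distr (M n) borel (\<lambda>\<omega>. t \<bullet> Lin n psi \<omega>)) 1)"
  have inner_Lin: "t \<bullet> Lin n psi \<omega> = (\<Sum>p\<in>Ix n. \<xi> n p \<omega>)" for n \<omega>
    unfolding \<xi>_def Lin_def inner_vec_def vec_lambda_beta inner_sum_right
    by (subst sum.swap) (simp add: inner_commute)
  have d_lim: "d \<longlonglongrightarrow> 0"
    unfolding d_def by (rule tendsto_eq_intros tendsto_sum tendsto_mult tendsto_rabs coef_lim refl | simp)+
  have d_nonneg: "0 \<le> d n" for n unfolding d_def by (intro sum_nonneg) simp
  have s_lim: "s \<longlonglongrightarrow> limit_cov t t"
    unfolding s_def limit_cov_def
    by (intro tendsto_sum tendsto_mult tendsto_const coef_square_sum_lim[unfolded proj_mult])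
  have approx: "cmod (\<phi> n - exp (- s n / 2)) \<le> (d n / 6 + (d n)\<^sup>2 / 4) * s n" for n
  proof -
    interpret S: iid_sample P h "M n" "Y n" "Ix n" by (rule sample)
    have "S.M.indep_vars (\<lambda>_. borel) (\<xi> n) (Ix n)"
      unfolding \<xi>_def by (rule S.M.indep_vars_compose2[OF S.indep]) measurable
    moreover have "\<bar>\<xi> n p \<omega>\<bar> \<le> d n" for p \<omega>
    proof -
      have "\<bar>\<xi> n p \<omega>\<bar> \<le> (\<Sum>k\<in>UNIV. \<bar>coef n k (fst p)\<bar> * norm (t $ k))"
        unfolding \<xi>_def
      proof (rule order_trans[OF sum_abs sum_mono])
        fix k
        have "\<bar>psi (Y n p \<omega>) \<bullet> t $ k\<bar> \<le> norm (t $ k)"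
          by (rule order_trans[OF Cauchy_Schwarz_ineq2]) (simp add: mult_left_le_one_le psi_bound)
        then show "\<bar>coef n k (fst p) * (psi (Y n p \<omega>) \<bullet> t $ k)\<bar> \<le> \<bar>coef n k (fst p)\<bar> * norm (t $ k)"
          by (simp add: abs_mult mult_left_mono)
      qed
      also have "\<dots> \<le> d n"
        unfolding d_def by (intro sum_mono member_le_sum[where f="\<lambda>l. \<bar>coef n k l\<bar> * norm (t $ k)" for k]) auto
      finally show ?thesis .
    qed
    moreover have "S.M.expectation (\<xi> n p) = 0" if "p \<in> Ix n" for p
    proof -
      have "S.M.expectation (\<xi> n p) = (LINT x|P. (\<Sum>k\<in>UNIV. coef n k (fst p) * (psi x \<bullet> t $ k)))"
        unfolding \<xi>_def by (rule S.integral_Y[OF that]) measurable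
      then show ?thesis using integrable_psi expectation_psi by simp
    qed
    moreover have "(\<Sum>p\<in>Ix n. S.M.expectation (\<lambda>\<omega>. (\<xi> n p \<omega>)\<^sup>2)) = s n"
    proof -
      have "S.M.expectation (\<lambda>\<omega>. (\<xi> n p \<omega>)\<^sup>2) = (\<Sum>k\<in>UNIV. \<Sum>k'\<in>UNIV. coef n k (fst p) * coef n k' (fst p) * psi_cov (t $ k) (t $ k'))"
        if "p \<in> Ix n" for p
      proof -
        have "S.M.expectation (\<lambda>\<omega>. (\<xi> n p \<omega>)\<^sup>2) = (LINT x|P. (\<Sum>k\<in>UNIV. coef n k (fst p) * (psi x \<bullet> t $ k))\<^sup>2)"
          unfolding \<xi>_def by (rule S.integral_Y[OF that]) measurable
        also have "\<dots> = (LINT x|P. (\<Sum>k\<in>UNIV. \<Sum>k'\<in>UNIV. (coef n k (fst p) * coef n k' (fst p)) * ((psi x \<bullet> t $ k) * (psi x \<bullet> t $ k'))))"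
          by (simp add: power2_eq_square sum_product mult_ac)
        also have "\<dots> = (\<Sum>k\<in>UNIV. \<Sum>k'\<in>UNIV. coef n k (fst p) * coef n k' (fst p) * psi_cov (t $ k) (t $ k'))"
          unfolding psi_cov_def using integrable_psi_inner by (simp add: Bochner_Integration.integral_sum Bochner_Integration.integrable_sum)
        finally show ?thesis .
      qed
      then have "(\<Sum>p\<in>Ix n. S.M.expectation (\<lambda>\<omega>. (\<xi> n p \<omega>)\<^sup>2)) =
        (\<Sum>p\<in>Ix n. \<Sum>k\<in>UNIV. \<Sum>k'\<in>UNIV. coef n k (fst p) * coef n k' (fst p) * psi_cov (t $ k) (t $ k'))" by simp
      also have "\<dots> = (\<Sum>k\<in>UNIV. \<Sum>p\<in>Ix n. \<Sum>k'\<in>UNIV. coef n k (fst p) * coef n k' (fst p) * psi_cov (t $ k) (t $ k'))"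
        by (rule sum.swap)
      also have "\<dots> = (\<Sum>k\<in>UNIV. \<Sum>k'\<in>UNIV. \<Sum>p\<in>Ix n. coef n k (fst p) * coef n k' (fst p) * psi_cov (t $ k) (t $ k'))"
        by (intro sum.cong refl sum.swap)
      finally show ?thesis unfolding s_def by (simp add: sum_distrib_right)
    qed
    ultimately show ?thesis
      using S.M.char_sum_bounded_approx[OF S.finite_I, of "\<xi> n" "d n"] d_nonneg
      by (simp add: \<phi>_def inner_Lin)
  qed
  have "(\<lambda>n. (d n / 6 + (d n)\<^sup>2 / 4) * s n) \<longlonglongrightarrow> (0 / 6 + 0\<^sup>2 / 4) * limit_cov t t"
    by (intro tendsto_intros d_lim s_lim) auto
  then have "(\<lambda>n. (d n / 6 + (d n)\<^sup>2 / 4) * s n) \<longlonglongrightarrow> 0" by simp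
  with always_eventually[OF allI, OF approx] have "(\<lambda>n. \<phi> n - exp (- s n / 2)) \<longlonglongrightarrow> 0"
    by (rule Lim_null_comparison)
  moreover have "(\<lambda>n. complex_of_real (exp (- s n / 2))) \<longlonglongrightarrow> complex_of_real (exp (- limit_cov t t / 2))"
    by (intro tendsto_intros s_lim) auto
  ultimately have "(\<lambda>n. (\<phi> n - exp (- s n / 2)) + exp (- s n / 2)) \<longlonglongrightarrow> 0 + complex_of_real (exp (- limit_cov t t / 2))"
    by (rule tendsto_add)
  then have "\<phi> \<longlonglongrightarrow> complex_of_real (exp (- limit_cov t t / 2))" by simp
  then have "(\<lambda>n. Re (iexp b * \<phi> n)) \<longlonglongrightarrow> Re (iexp b * complex_of_real (exp (- limit_cov t t / 2)))"
    by (intro tendsto_intros)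
  moreover have "(LINT \<omega>|M n. cos (t \<bullet> Lin n psi \<omega> + b)) = Re (iexp b * \<phi> n)" for n
    unfolding \<phi>_def using M_prob by (intro prob_space.expectation_cos_eq_char) measurable
  ultimately show ?thesis by (simp add: Re_exp)
qed


lemma Lin_diff: "Lin n f \<omega> - Lin n g \<omega> = Lin n (\<lambda>x. f x - g x) \<omega>"
  by (simp add: Lin_def vec_eq_iff sum_subtractf scaleR_diff_right)

text \<open>The vectors \<open>y\<close> are fixed, so the statistic is a finite sum of scalar
  random variables with bounded second moments times fixed vectors of the product space.\<close>

lemma Lin_tight_finite:
  fixes V :: "'b::{real_inner, banach, second_countable_topology} set"
  assumes V: "finite V" and q: "\<And>y. q y \<in> borel_measurable borel" "\<And>y x. \<bar>q y x\<bar> \<le> B" "\<And>y. (LINT x|P. q y x) = 0"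
  shows "asymp_tight M (\<lambda>n. Lin n (\<lambda>x. \<Sum>y\<in>V. q y x *\<^sub>R y))"
proof -
  define \<beta> where "\<beta> = (\<lambda>z n \<omega>. \<Sum>p\<in>Ix n. coef n (fst z) (fst p) * q (snd z) (Y n p \<omega>))"
  have \<beta>_meas: "\<beta> z n \<in> borel_measurable (M n)" for z n
  proof -
    interpret S: iid_sample P h "M n" "Y n" "Ix n" by (rule sample)
    note [measurable] = q(1)
    show ?thesis unfolding \<beta>_def by measurable
  qed
  have eq: "Lin n (\<lambda>x. \<Sum>y\<in>V. q y x *\<^sub>R y) \<omega> = (\<Sum>z\<in>UNIV \<times> V. \<beta> z n \<omega> *\<^sub>R axis (fst z) (snd z))" for n \<omega>
  proof -
    have "(\<Sum>z\<in>UNIV \<times> V. \<beta> z n \<omega> *\<^sub>R axis (fst z) (snd z)) $ k = (\<Sum>y\<in>V. \<beta> (k, y) n \<omega> *\<^sub>R y)" for k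
    proof -
      have "(\<Sum>z\<in>UNIV \<times> V. \<beta> z n \<omega> *\<^sub>R axis (fst z) (snd z)) $ k = (\<Sum>y\<in>V. \<Sum>k'\<in>UNIV. (\<beta> (k', y) n \<omega> *\<^sub>R axis k' y) $ k)"
        by (subst sum.swap) (simp add: sum.cartesian_product case_prod_beta')
      also have "\<dots> = (\<Sum>y\<in>V. \<Sum>k'\<in>UNIV. if k' = k then \<beta> (k, y) n \<omega> *\<^sub>R y else 0)"
        by (intro sum.cong refl) (simp add: axis_def)
      finally show ?thesis by simp
    qed
    moreover have "Lin n (\<lambda>x. \<Sum>y\<in>V. q y x *\<^sub>R y) \<omega> $ k = (\<Sum>y\<in>V. \<beta> (k, y) n \<omega> *\<^sub>R y)" for k
      unfolding Lin_def vec_lambda_beta \<beta>_def fst_conv snd_conv scaleR_sum_left scaleR_sum_right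
      by (subst sum.swap) simp
    ultimately show ?thesis by (simp add: vec_eq_iff)
  qed
  have "asymp_tight M (\<lambda>n \<omega>. \<beta> z n \<omega> *\<^sub>R (axis (fst z) (snd z) :: 'b ^ 'k))" for z
  proof (rule asymp_tight_scaleR[OF M_prob \<beta>_meas])
    fix n
    interpret S: iid_sample P h "M n" "Y n" "Ix n" by (rule sample)
    note m = S.linear_second_moment[of "q (snd z)" B "\<lambda>p. coef n (fst z) (fst p)"]
    show "integrable (M n) (\<lambda>\<omega>. (\<beta> z n \<omega>)\<^sup>2)"
      using m(2) q by (simp add: \<beta>_def)
    have "(LINT \<omega>|M n. (\<beta> z n \<omega>)\<^sup>2) = (\<Sum>p\<in>Ix n. (coef n (fst z) (fst p))\<^sup>2) * (LINT x|P. (norm (q (snd z) x))\<^sup>2)"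
      using m(1) q by (simp add: \<beta>_def)
    also have "\<dots> \<le> coef_bound * (LINT x|P. (norm (q (snd z) x))\<^sup>2)"
    proof (intro mult_right_mono order_trans[OF _ coef_square_sum_le[of n]])
      show "(\<Sum>p\<in>Ix n. (coef n (fst z) (fst p))\<^sup>2) \<le> (\<Sum>k\<in>UNIV. \<Sum>p\<in>Ix n. (coef n k (fst p))\<^sup>2)"
        by (rule member_le_sum[where f="\<lambda>k. \<Sum>p\<in>Ix n. (coef n k (fst p))\<^sup>2"]) (auto intro: sum_nonneg)
    qed simp
    finally show "(LINT \<omega>|M n. (\<beta> z n \<omega>)\<^sup>2) \<le> coef_bound * (LINT x|P. (norm (q (snd z) x))\<^sup>2)" .
  qed
  then have "asymp_tight M (\<lambda>n \<omega>. \<Sum>z\<in>UNIV \<times> V. \<beta> z n \<omega> *\<^sub>R (axis (fst z) (snd z) :: 'b ^ 'k))"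
    using V \<beta>_meas by (intro asymp_tight_sum M_prob) auto
  then show ?thesis unfolding eq .
qed

lemma Lin_tight: "asymp_tight M (\<lambda>n. Lin n psi)"
proof (rule asymp_tight_approx[OF M_prob])
  show "Lin n psi \<in> borel_measurable (M n)" for n by measurable
  fix \<eta> :: real assume \<eta>: "0 < \<eta>"
  have "psi \<in> borel_measurable P" by measurable
  \<comment> \<open>Base point 0 gives simple functions of norm at most 2, which justifies the
    dominated convergences below.\<close>
  from borel_measurable_implies_sequence_metric[OF this, of 0] obtain F
    where F: "\<And>i. simple_function P (F i)" "\<And>x. (\<lambda>i. F i x) \<longlonglongrightarrow> psi x"
      and F_bound: "\<And>i x. norm (F i x) \<le> 2 * norm (psi x)"
    by (auto simp: space_P)
  have F2: "norm (F i x) \<le> 2" for i x using F_bound[of i x] psi_bound[of x] by linarith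
  have [measurable]: "F i \<in> borel_measurable P" for i using F(1) by (rule borel_measurable_simple_function)
  then have F_meas[measurable]: "F i \<in> borel_measurable borel" for i by measurable
  \<comment> \<open>A simple approximant need not be centered. Subtracting its mean, which tends to
    0, restores the orthogonality behind \<open>Lin_second_moment\<close>.\<close>
  define m where "m = (\<lambda>i. LINT x|P. F i x)"
  have "m \<longlonglongrightarrow> (LINT x|P. psi x)"
    unfolding m_def by (rule integral_dominated_convergence[where w="\<lambda>_. 2"]) (auto simp: F F2)
  then have m_lim: "m \<longlonglongrightarrow> 0" by (simp add: expectation_psi)
  have sq_le: "(norm (x + y))\<^sup>2 \<le> 2 * (norm x)\<^sup>2 + 2 * (norm y)\<^sup>2" for x y :: 'h
    using zero_le_power2[of "norm (x - y)"] unfolding power2_norm_eq_inner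
    by (simp add: inner_add_left inner_add_right inner_diff_left inner_diff_right inner_commute)
  \<comment> \<open>9 = (1 + 2)^2, from the bounds on \<open>psi\<close> and on the
    approximants.\<close>
  have sq9: "(norm (psi x - F i x))\<^sup>2 \<le> 9" for i x
  proof -
    have "norm (psi x - F i x) \<le> 3"
      using norm_triangle_ineq4[of "psi x" "F i x"] F2[of i x] psi_bound[of x] by linarith
    then have "(norm (psi x - F i x))\<^sup>2 \<le> 3\<^sup>2" by (intro power_mono) auto
    then show ?thesis by simp
  qed
  define err where "err = (\<lambda>i. LINT x|P. (norm (psi x - F i x))\<^sup>2)"
  have "err \<longlonglongrightarrow> (LINT x|P. (norm (psi x - psi x))\<^sup>2)"
    unfolding err_def
  proof (rule integral_dominated_convergence[where w="\<lambda>_. 9"])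
    show "AE x in P. (\<lambda>i. (norm (psi x - F i x))\<^sup>2) \<longlonglongrightarrow> (norm (psi x - psi x))\<^sup>2"
      by (intro AE_I2 tendsto_intros F)
    show "AE x in P. norm ((norm (psi x - F i x))\<^sup>2) \<le> 9" for i
      using sq9 by simp
  qed auto
  then have err_lim: "err \<longlonglongrightarrow> 0" by simp
  have "(\<lambda>i. coef_bound * (2 * err i + 2 * (norm (m i))\<^sup>2)) \<longlonglongrightarrow> coef_bound * (2 * 0 + 2 * (norm (0::'h))\<^sup>2)"
    by (intro tendsto_intros err_lim m_lim)
  then have "\<forall>\<^sub>F i in sequentially. coef_bound * (2 * err i + 2 * (norm (m i))\<^sup>2) < \<eta>"
    using \<eta> by (intro order_tendstoD) auto
  then obtain i where i: "coef_bound * (2 * err i + 2 * (norm (m i))\<^sup>2) < \<eta>"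
    by (auto simp: eventually_sequentially)
  define g where "g = (\<lambda>x. F i x - m i)"
  have int_F: "integrable P (F i)" by (rule integrable_const_bound[of _ 2]) (auto simp: F2)
  have g: "g \<in> borel_measurable borel" "(LINT x|P. g x) = 0"
    unfolding g_def using int_F by (auto simp: m_def prob_space)
  have psi_g_eq: "psi x - g x = psi x - F i x + m i" for x by (simp add: g_def)
  have g_bound: "norm (psi x - g x) \<le> 3 + norm (m i)" for x
  proof -
    have "norm (psi x - g x) \<le> norm (psi x - F i x) + norm (m i)"
      using norm_triangle_ineq[of "psi x - F i x" "m i"] by (simp add: psi_g_eq)
    then show ?thesis
      using norm_triangle_ineq4[of "psi x" "F i x"] F2[of i x] psi_bound[of x] by linarith
  qed
  have int_psi_g: "(LINT x|P. psi x - g x) = 0"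
    using integrable_psi int_F g(2) by (simp add: expectation_psi g_def)
  have sq_int: "integrable P (\<lambda>x. (norm (psi x - g x))\<^sup>2)" "integrable P (\<lambda>x. (norm (psi x - F i x))\<^sup>2)"
  proof -
    show "integrable P (\<lambda>x. (norm (psi x - g x))\<^sup>2)"
      using g(1) g_bound by (intro integrable_const_bound[of _ "(3 + norm (m i))\<^sup>2"]) (auto intro!: power_mono)
    show "integrable P (\<lambda>x. (norm (psi x - F i x))\<^sup>2)"
      using sq9 by (intro integrable_const_bound[of _ 9]) auto
  qed
  have "(LINT x|P. (norm (psi x - g x))\<^sup>2) \<le> (LINT x|P. 2 * (norm (psi x - F i x))\<^sup>2 + 2 * (norm (m i))\<^sup>2)"
  proof (rule integral_mono)
    show "(norm (psi x - g x))\<^sup>2 \<le> 2 * (norm (psi x - F i x))\<^sup>2 + 2 * (norm (m i))\<^sup>2" for x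
      using sq_le[of "psi x - F i x" "m i"] by (simp add: psi_g_eq)
  qed (use sq_int in auto)
  also have "\<dots> = 2 * err i + 2 * (norm (m i))\<^sup>2"
    using sq_int by (simp add: err_def prob_space)
  finally have psi_g: "(LINT x|P. (norm (psi x - g x))\<^sup>2) \<le> 2 * err i + 2 * (norm (m i))\<^sup>2" .
  have meas_psi_g: "(\<lambda>x. psi x - g x) \<in> borel_measurable borel" using g(1) by measurable
  define V where "V = range (F i)"
  \<comment> \<open>Centering each indicator separately expresses \<open>g\<close> through fixed
    vectors with centered scalar coefficients, the shape that \<open>Lin_tight_finite\<close> asks
    for.\<close>
  define q where "q = (\<lambda>y x. indicator {x. F i x = y} x - (LINT x|P. indicator {x. F i x = y} x :: real))"
  have "finite V" using simple_functionD(1)[OF F(1)[of i]] by (simp add: V_def space_P)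
  have set_meas: "{x. F i x = y} \<in> sets borel" for y by measurable
  then have int_ind: "integrable P (\<lambda>x. indicator {x. F i x = y} x :: real)" for y
    by (intro integrable_const_bound[of _ 1]) (auto simp: indicator_def)
  have g_eq: "g x = (\<Sum>y\<in>V. q y x *\<^sub>R y)" for x
  proof -
    have F_eq: "F i x = (\<Sum>y\<in>V. indicator {x. F i x = y} x *\<^sub>R y)" for x
    proof -
      have "(\<Sum>y\<in>V. indicator {x. F i x = y} x *\<^sub>R y) = (\<Sum>y\<in>V. if y = F i x then y else 0)"
        by (intro sum.cong) (auto simp: indicator_def)
      then show ?thesis using \<open>finite V\<close> by (simp add: V_def)
    qed
    have "m i = (LINT x|P. (\<Sum>y\<in>V. indicator {x. F i x = y} x *\<^sub>R y))"
      unfolding m_def by (intro Bochner_Integration.integral_cong refl F_eq)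
    also have "\<dots> = (\<Sum>y\<in>V. (LINT x|P. indicator {x. F i x = y} x) *\<^sub>R y)"
      using int_ind by (subst Bochner_Integration.integral_sum) auto
    finally have m_eq: "m i = (\<Sum>y\<in>V. (LINT x|P. indicator {x. F i x = y} x) *\<^sub>R y)" .
    have "(\<Sum>y\<in>V. q y x *\<^sub>R y) = (\<Sum>y\<in>V. indicator {x. F i x = y} x *\<^sub>R y)
        - (\<Sum>y\<in>V. (LINT x|P. indicator {x. F i x = y} x) *\<^sub>R y)"
      by (simp only: q_def scaleR_diff_left sum_subtractf)
    then show ?thesis by (simp only: g_def F_eq[of x, symmetric] m_eq[symmetric])
  qed
  have "asymp_tight M (\<lambda>n. Lin n (\<lambda>x. \<Sum>y\<in>V. q y x *\<^sub>R y))"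
  proof (rule Lin_tight_finite[OF \<open>finite V\<close>])
    show "q y \<in> borel_measurable borel" for y unfolding q_def using set_meas by measurable
    show "(LINT x|P. q y x) = 0" for y unfolding q_def using int_ind by (simp add: prob_space)
    show "\<bar>q y x\<bar> \<le> 2" for y x
    proof -
      have "\<bar>LINT x|P. indicator {x. F i x = y} x :: real\<bar> \<le> (LINT x|P. 1)"
        by (rule order_trans[OF integral_abs_bound integral_mono]) (use int_ind in \<open>auto simp: indicator_def\<close>)
      then have "\<bar>LINT x|P. indicator {x. F i x = y} x :: real\<bar> \<le> 1" by (simp add: prob_space)
      moreover have "\<bar>indicator {x. F i x = y} x :: real\<bar> \<le> 1" by (simp add: indicator_def)
      ultimately show ?thesis unfolding q_def by linarith
    qed
  qed
  then have tight: "asymp_tight M (\<lambda>n. Lin n g)" unfolding g_eq[abs_def, symmetric] .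
  show "\<exists>Z. asymp_tight M Z \<and> (\<forall>n. Z n \<in> borel_measurable (M n)) \<and>
      (\<forall>n. integrable (M n) (\<lambda>\<omega>. (norm (Lin n psi \<omega> - Z n \<omega>))\<^sup>2)) \<and>
      (\<forall>\<^sub>F n in sequentially. (LINT \<omega>|M n. (norm (Lin n psi \<omega> - Z n \<omega>))\<^sup>2) \<le> \<eta>)"
  proof (intro exI[of _ "\<lambda>n. Lin n g"] conjI allI always_eventually)
    note m = Lin_second_moment[OF meas_psi_g g_bound int_psi_g]
    show "asymp_tight M (\<lambda>n. Lin n g)" by (rule tight)
    show "Lin n g \<in> borel_measurable (M n)" for n using g(1) by (rule Lin_measurable)
    show "integrable (M n) (\<lambda>\<omega>. (norm (Lin n psi \<omega> - Lin n g \<omega>))\<^sup>2)" for n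
      unfolding Lin_diff by (rule m(1))
    show "(LINT \<omega>|M n. (norm (Lin n psi \<omega> - Lin n g \<omega>))\<^sup>2) \<le> \<eta>" for n
      unfolding Lin_diff
      using m(2)[of n] mult_left_mono[OF psi_g coef_bound_nonneg] i by linarith
  qed
qed

section \<open>The statistic and its degenerate remainder\<close>

definition Jx :: "nat \<Rightarrow> 'k \<Rightarrow> ('k \<times> nat) set" where
  "Jx n k = {p\<in>Ix n. fst p = k}"

text \<open>The rank statistic for a general kernel, over the pooled index set. The factor is
  sqrt(N) * (1/N) * (1/n) simplified, and is 0 for an empty group.\<close>

definition stat :: "nat \<Rightarrow> 'a \<Rightarrow> 'h ^ 'k" where
  "stat n \<omega> = (\<chi> k. (1 / (sqrt (N n k) * n)) *\<^sub>R (\<Sum>a\<in>Jx n k. \<Sum>b\<in>Ix n. h (Y n a \<omega>) (Y n b \<omega>)))"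

definition Rem :: "nat \<Rightarrow> 'a \<Rightarrow> 'h ^ 'k" where
  "Rem n \<omega> = (\<chi> k. (1 / (sqrt (N n k) * n)) *\<^sub>R (\<Sum>a\<in>Jx n k. \<Sum>b\<in>Ix n. remainder (Y n a \<omega>) (Y n b \<omega>)))"

lemma Jx_eq: "Jx n k = Pair k ` {1..N n k}"
  by (auto simp: Jx_def Ix_def)

lemma card_Jx: "card (Jx n k) = N n k"
  unfolding Jx_eq by (simp add: card_image inj_on_def)

lemma finite_Ix: "finite (Ix n)"
  by (simp add: Ix_def)

lemma stat_eq: "stat n \<omega> = Lin n psi \<omega> + Rem n \<omega>"
proof (cases "n = 0")
  \<comment> \<open>For n = 0 the divisions by zero make all weights 0, so both sides
    vanish.\<close>
  case True
  then show ?thesis by (simp add: stat_def Lin_def Rem_def coef_def vec_eq_iff)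
next
  case False
  have "stat n \<omega> $ k = Lin n psi \<omega> $ k + Rem n \<omega> $ k" for k
  proof -
    define c where "c = 1 / (sqrt (N n k) * n)"
    have h_eq: "(\<Sum>a\<in>Jx n k. \<Sum>b\<in>Ix n. h (Y n a \<omega>) (Y n b \<omega>))
        = (\<Sum>a\<in>Jx n k. \<Sum>b\<in>Ix n. remainder (Y n a \<omega>) (Y n b \<omega>))
        + (\<Sum>a\<in>Jx n k. \<Sum>b\<in>Ix n. psi (Y n a \<omega>) - psi (Y n b \<omega>))"
      unfolding sum.distrib[symmetric] remainder_def by (intro sum.cong refl) simp
    have "stat n \<omega> $ k = Rem n \<omega> $ k + c *\<^sub>R (\<Sum>a\<in>Jx n k. \<Sum>b\<in>Ix n. psi (Y n a \<omega>) - psi (Y n b \<omega>))"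
      unfolding stat_def Rem_def vec_lambda_beta c_def h_eq scaleR_add_right ..
    \<comment> \<open>Each \<open>psi\<close> of a group member is counted once for every one of the
      n partners, and each pooled \<open>psi\<close> once for every one of the N members of the
      group.\<close>
    also have "(\<Sum>a\<in>Jx n k. \<Sum>b\<in>Ix n. psi (Y n a \<omega>) - psi (Y n b \<omega>))
        = real n *\<^sub>R (\<Sum>a\<in>Jx n k. psi (Y n a \<omega>)) - real (N n k) *\<^sub>R (\<Sum>b\<in>Ix n. psi (Y n b \<omega>))"
      by (simp add: sum_subtractf sum_constant_scaleR card_Ix card_Jx scaleR_sum_right)
    also have "c *\<^sub>R \<dots> = (1 / sqrt (N n k)) *\<^sub>R (\<Sum>a\<in>Jx n k. psi (Y n a \<omega>)) - (sqrt (N n k) / n) *\<^sub>R (\<Sum>b\<in>Ix n. psi (Y n b \<omega>))"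
    proof -
      have "c * real n = 1 / sqrt (N n k)" using False by (simp add: c_def)
      moreover have "c * real (N n k) = sqrt (N n k) / n"
        by (simp add: c_def) (metis divide_divide_eq_left of_nat_0_le_iff real_div_sqrt)
      ultimately show ?thesis by (simp add: scaleR_diff_right)
    qed
    also have "\<dots> = Lin n psi \<omega> $ k"
    proof -
      have "Lin n psi \<omega> $ k = (\<Sum>p\<in>Ix n. (if fst p = k then (1 / sqrt (N n k)) *\<^sub>R psi (Y n p \<omega>) else 0) - (sqrt (N n k) / n) *\<^sub>R psi (Y n p \<omega>))"
        unfolding Lin_def vec_lambda_beta using False
        by (intro sum.cong refl) (auto simp: coef_eq scaleR_diff_left)
      moreover have "(1 / sqrt (N n k)) *\<^sub>R (\<Sum>a\<in>Jx n k. psi (Y n a \<omega>))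
          = (\<Sum>p\<in>Ix n. if fst p = k then (1 / sqrt (N n k)) *\<^sub>R psi (Y n p \<omega>) else 0)"
        unfolding Jx_def scaleR_sum_right by (rule sum.inter_filter[OF finite_Ix])
      ultimately show ?thesis by (simp only: sum_subtractf scaleR_sum_right[symmetric])
    qed
    finally show ?thesis by simp
  qed
  then show ?thesis by (simp add: vec_eq_iff)
qed

lemma stat_has_bochner_integral: "has_bochner_integral (M n) (stat n) 0"
proof -
  interpret S: iid_sample P h "M n" "Y n" "Ix n" by (rule sample)
  have kernel: "has_bochner_integral (M n) (\<lambda>\<omega>. h (Y n a \<omega>) (Y n b \<omega>)) 0" if "a \<in> Ix n" "b \<in> Ix n" for a b
    using S.expectation_kernel[OF that] that
    by (auto simp: has_bochner_integral_iff h_bound intro!: S.M.integrable_bounded[where B=1])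
  have "has_bochner_integral (M n) (\<lambda>\<omega>. (1 / (sqrt (N n k) * n)) *\<^sub>R (\<Sum>a\<in>Jx n k. \<Sum>b\<in>Ix n. h (Y n a \<omega>) (Y n b \<omega>)))
      ((1 / (sqrt (N n k) * n)) *\<^sub>R (\<Sum>a\<in>Jx n k. \<Sum>b\<in>Ix n. 0))" for k
    by (intro has_bochner_integral_scaleR_right has_bochner_integral_sum kernel) (auto simp: Jx_def)
  from has_bochner_integral_vec_lambda[OF this] show ?thesis
    by (simp add: stat_def[abs_def] vec_eq_iff zero_vec_def)
qed


lemma Rem_measurable[measurable]: "Rem n \<in> borel_measurable (M n)"
proof -
  interpret S: iid_sample P h "M n" "Y n" "Ix n" by (rule sample)
  have "(\<lambda>\<omega>. \<Sum>a\<in>Jx n k. \<Sum>b\<in>Ix n. remainder (Y n a \<omega>) (Y n b \<omega>)) \<in> borel_measurable (M n)" for k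
    by (intro borel_measurable_sum measurable_remainder S.measurable_Y) (auto simp: Jx_def)
  then show ?thesis unfolding Rem_def by measurable
qed

lemma stat_measurable[measurable]: "stat n \<in> borel_measurable (M n)"
  using stat_has_bochner_integral[of n] by (simp add: has_bochner_integral_iff borel_measurable_integrable)

lemma Rem_second_moment:
  "integrable (M n) (\<lambda>\<omega>. (norm (Rem n \<omega>))\<^sup>2)"
  "(LINT \<omega>|M n. (norm (Rem n \<omega>))\<^sup>2) \<le> 18 * real CARD('k) / real n"
proof -
  interpret S: iid_sample P h "M n" "Y n" "Ix n" by (rule sample)
  define T where "T = (\<lambda>k \<omega>. \<Sum>a\<in>Jx n k. \<Sum>b\<in>Ix n. remainder (Y n a \<omega>) (Y n b \<omega>))"
  define c where "c = (\<lambda>k. 1 / (sqrt (N n k) * n))"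
  have [measurable]: "T k \<in> borel_measurable (M n)" for k
    unfolding T_def by (intro borel_measurable_sum measurable_remainder S.measurable_Y) (auto simp: Jx_def)
  have bound: "norm (T k \<omega>) \<le> (\<Sum>a\<in>Jx n k. \<Sum>b\<in>Ix n. 3)" for k \<omega>
    unfolding T_def by (intro sum_norm_le remainder_bound)
  have int: "integrable (M n) (\<lambda>\<omega>. (norm (T k \<omega>))\<^sup>2)" for k
    using bound[of k] by (intro S.M.integrable_bounded[where B="(\<Sum>a\<in>Jx n k. \<Sum>b\<in>Ix n. 3)\<^sup>2"])
      (auto intro!: power_mono simp del: sum_constant)
  have norm_eq: "(norm (Rem n \<omega>))\<^sup>2 = (\<Sum>k\<in>UNIV. (c k)\<^sup>2 * (norm (T k \<omega>))\<^sup>2)" for \<omega>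
    unfolding norm_vec_squared Rem_def T_def c_def vec_lambda_beta norm_scaleR power_mult_distrib power2_abs real_norm_def ..
  show "integrable (M n) (\<lambda>\<omega>. (norm (Rem n \<omega>))\<^sup>2)"
    unfolding norm_eq using int by simp
  have "(LINT \<omega>|M n. (norm (Rem n \<omega>))\<^sup>2) = (\<Sum>k\<in>UNIV. (c k)\<^sup>2 * (LINT \<omega>|M n. (norm (T k \<omega>))\<^sup>2))"
    unfolding norm_eq using int by simp
  also have "\<dots> \<le> (\<Sum>k\<in>(UNIV :: 'k set). 18 / real n)"
  proof (rule sum_mono)
    fix k
    have "Jx n k \<subseteq> Ix n" by (auto simp: Jx_def)
    from S.remainder_sum_second_moment[OF this]
    have "(c k)\<^sup>2 * (LINT \<omega>|M n. (norm (T k \<omega>))\<^sup>2) \<le> (c k)\<^sup>2 * (18 * real (N n k) * real n)"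
      unfolding T_def card_Ix card_Jx by (intro mult_left_mono) auto
    also have "\<dots> \<le> 18 / real n"
    proof -
      \<comment> \<open>The group size cancels, leaving 18/n for each component; an empty group
        contributes 0.\<close>
      have "(c k)\<^sup>2 = 1 / (real (N n k) * (real n)\<^sup>2)" by (simp add: c_def power_divide power_mult_distrib)
      then show ?thesis by (cases "N n k = 0"; cases "n = 0") (simp_all add: power2_eq_square)
    qed
    finally show "(c k)\<^sup>2 * (LINT \<omega>|M n. (norm (T k \<omega>))\<^sup>2) \<le> 18 / real n" .
  qed
  also have "\<dots> = 18 * real CARD('k) / real n" by simp
  finally show "(LINT \<omega>|M n. (norm (Rem n \<omega>))\<^sup>2) \<le> 18 * real CARD('k) / real n" .
qed

lemma Rem_second_moment_lim: "(\<lambda>n. 18 * real CARD('k) / real n) \<longlonglongrightarrow> 0"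
  by (rule lim_const_over_n)

lemma stat_tight: "asymp_tight M stat"
proof (rule asymp_tight_approx[OF M_prob stat_measurable])
  fix \<eta> :: real assume "0 < \<eta>"
  then have "\<forall>\<^sub>F n in sequentially. 18 * real CARD('k) / real n < \<eta>"
    by (rule order_tendstoD[OF Rem_second_moment_lim])
  then have "\<forall>\<^sub>F n in sequentially. (LINT \<omega>|M n. (norm (Rem n \<omega>))\<^sup>2) \<le> \<eta>"
    by eventually_elim (rule order_trans[OF Rem_second_moment(2) less_imp_le])
  then show "\<exists>Z. asymp_tight M Z \<and> (\<forall>n. Z n \<in> borel_measurable (M n)) \<and>
      (\<forall>n. integrable (M n) (\<lambda>\<omega>. (norm (stat n \<omega> - Z n \<omega>))\<^sup>2)) \<and>
      (\<forall>\<^sub>F n in sequentially. (LINT \<omega>|M n. (norm (stat n \<omega> - Z n \<omega>))\<^sup>2) \<le> \<eta>)"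
    using Lin_tight Rem_second_moment(1)
    by (intro exI[of _ "\<lambda>n. Lin n psi"]) (simp add: stat_eq Lin_measurable)
qed

text \<open>The cosine is 1-Lipschitz, so the remainder costs at most norm(t) times its first
  absolute moment, hence at most norm(t) times the root of its second moment.\<close>

lemma stat_cosine_lim:
  "(\<lambda>n. LINT \<omega>|M n. cos (t \<bullet> stat n \<omega> + b)) \<longlonglongrightarrow> cos b * exp (- limit_cov t t / 2)"
proof -
  have "(\<lambda>n. (LINT \<omega>|M n. cos (t \<bullet> stat n \<omega> + b)) - (LINT \<omega>|M n. cos (t \<bullet> Lin n psi \<omega> + b))) \<longlonglongrightarrow> 0"
  proof (rule Lim_null_comparison)
    have "(\<lambda>n. norm t * sqrt (18 * real CARD('k) / real n)) \<longlonglongrightarrow> norm t * sqrt 0"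
      by (intro tendsto_intros Rem_second_moment_lim)
    then show "(\<lambda>n. norm t * sqrt (18 * real CARD('k) / real n)) \<longlonglongrightarrow> 0" by simp
    show "\<forall>\<^sub>F n in sequentially. norm ((LINT \<omega>|M n. cos (t \<bullet> stat n \<omega> + b)) - (LINT \<omega>|M n. cos (t \<bullet> Lin n psi \<omega> + b)))
        \<le> norm t * sqrt (18 * real CARD('k) / real n)"
    proof (intro always_eventually allI)
      fix n
      interpret M: prob_space "M n" by (rule M_prob)
      have int: "integrable (M n) (\<lambda>\<omega>. cos (t \<bullet> Z \<omega> + b))" if [measurable]: "Z \<in> borel_measurable (M n)" for Z
        by (rule M.integrable_const_bound[of _ 1]) auto
      have int_Rem: "integrable (M n) (\<lambda>\<omega>. norm (Rem n \<omega>))"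
        using Rem_measurable Rem_second_moment(1) by (rule M.integrable_of_square)
      have "norm (M.expectation (\<lambda>\<omega>. cos (t \<bullet> stat n \<omega> + b)) - M.expectation (\<lambda>\<omega>. cos (t \<bullet> Lin n psi \<omega> + b)))
          = norm (M.expectation (\<lambda>\<omega>. cos (t \<bullet> stat n \<omega> + b) - cos (t \<bullet> Lin n psi \<omega> + b)))"
        by (subst Bochner_Integration.integral_diff) (auto intro!: int)
      also have "\<dots> \<le> M.expectation (\<lambda>\<omega>. norm (cos (t \<bullet> stat n \<omega> + b) - cos (t \<bullet> Lin n psi \<omega> + b)))"
        by (rule integral_norm_bound)
      also have "\<dots> \<le> M.expectation (\<lambda>\<omega>. norm t * norm (Rem n \<omega>))"
      proof (rule integral_mono)
        show "integrable (M n) (\<lambda>\<omega>. norm (cos (t \<bullet> stat n \<omega> + b) - cos (t \<bullet> Lin n psi \<omega> + b)))"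
          by (intro integrable_norm Bochner_Integration.integrable_diff int) auto
        show "integrable (M n) (\<lambda>\<omega>. norm t * norm (Rem n \<omega>))" using int_Rem by simp
        fix \<omega>
        have "norm (cos (t \<bullet> stat n \<omega> + b) - cos (t \<bullet> Lin n psi \<omega> + b)) \<le> \<bar>t \<bullet> Rem n \<omega>\<bar>"
          using cos_diff_le[of "t \<bullet> stat n \<omega> + b" "t \<bullet> Lin n psi \<omega> + b"] by (simp add: stat_eq inner_add_right)
        also have "\<dots> \<le> norm t * norm (Rem n \<omega>)" by (rule Cauchy_Schwarz_ineq2)
        finally show "norm (cos (t \<bullet> stat n \<omega> + b) - cos (t \<bullet> Lin n psi \<omega> + b)) \<le> norm t * norm (Rem n \<omega>)" .
      qed
      also have "\<dots> = norm t * M.expectation (\<lambda>\<omega>. norm (Rem n \<omega>))" by simp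
      also have "\<dots> \<le> norm t * sqrt (18 * real CARD('k) / real n)"
        by (rule mult_left_mono[OF order_trans[OF M.expectation_le_sqrt_second_moment[OF int_Rem Rem_second_moment(1)]
                real_sqrt_le_mono[OF Rem_second_moment(2)]]]) simp
      finally show "norm (M.expectation (\<lambda>\<omega>. cos (t \<bullet> stat n \<omega> + b)) - M.expectation (\<lambda>\<omega>. cos (t \<bullet> Lin n psi \<omega> + b)))
        \<le> norm t * sqrt (18 * real CARD('k) / real n)" .
    qed
  qed
  from tendsto_add[OF this Lin_cosine_lim[of t b]] show ?thesis by simp
qed

lemma stat_weakly_converges:
  assumes S: "\<And>u. S u \<bullet> u = limit_cov u u" and G: "gaussian_law 0 S G"
  shows "weakly_converges (\<lambda>n. distr (M n) borel (stat n)) G"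
proof (rule weakly_converges_if_tight_and_cosines[OF M_prob stat_measurable _ _ stat_tight])
  show "prob_space G" "sets G = sets borel" using G by (auto simp: gaussian_law_def)
  show "(\<lambda>n. LINT \<omega>|M n. cos (t \<bullet> stat n \<omega> + b)) \<longlonglongrightarrow> (LINT x|G. cos (t \<bullet> x + b))" for t b
    unfolding gaussian_law_cosine[OF G] S by (rule stat_cosine_lim)
qed

text \<open>Since \<open>proj\<close> is a symmetric idempotent, the limit covariance is that of a single random vector:
  draw \<open>l\<close> uniformly and \<open>x\<close> from \<open>P\<close>, and take \<open>sqrt CARD('k) * proj k l *\<^sub>R psi x\<close> in component \<open>k\<close>.\<close>

lemma gaussian_limit_exists:
  assumes S: "\<And>u v. S u \<bullet> v = limit_cov u v"
  shows "\<exists>G. gaussian_law 0 S G"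
proof -
  define U where "U = uniform_count_measure (UNIV :: 'k set)"
  interpret U: prob_space U unfolding U_def by (rule prob_space_uniform_count_measure) auto
  interpret Q: pair_prob_space U P ..
  define \<Psi> where "\<Psi> = (\<lambda>(l, x). (\<chi> k. (sqrt CARD('k) * proj k l) *\<^sub>R psi x) :: 'h ^ 'k)"
  have sets_U: "sets U = sets (count_space UNIV)" by (simp add: U_def sets_uniform_count_measure)
  have proj_meas: "(\<lambda>l. proj k l) \<in> borel_measurable U" for k
    by (subst measurable_cong_sets[OF sets_U refl]) simp
  have meas[measurable]: "\<Psi> \<in> borel_measurable (U \<Otimes>\<^sub>M P)"
    unfolding \<Psi>_def case_prod_beta'
    by (intro borel_measurable_vec_lambda borel_measurable_scaleR borel_measurable_times borel_measurable_const
        measurable_compose[OF measurable_fst proj_meas] measurable_psi_compose)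
      (use measurable_snd[of U P] in \<open>simp add: measurable_cong_sets[OF refl sets_P]\<close>)
  \<comment> \<open>Summing over l as well makes the bound independent of the drawn group.\<close>
  define B where "B = (\<Sum>k\<in>UNIV. \<Sum>l\<in>UNIV. (sqrt CARD('k) * proj k l)\<^sup>2)"
  have bdd: "norm (\<Psi> z) \<le> sqrt B" for z
  proof -
    obtain l x where z: "z = (l, x)" by (cases z)
    have "(norm (\<Psi> z))\<^sup>2 = (\<Sum>k\<in>UNIV. (sqrt CARD('k) * proj k l)\<^sup>2 * (norm (psi x))\<^sup>2)"
      by (simp add: z \<Psi>_def norm_vec_squared power_mult_distrib)
    also have "\<dots> \<le> (\<Sum>k\<in>UNIV. (sqrt CARD('k) * proj k l)\<^sup>2 * 1)"
      by (intro sum_mono mult_left_mono) (auto simp: psi_bound power_le_one)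
    also have "\<dots> \<le> B"
      unfolding B_def mult_1_right
      by (intro sum_mono member_le_sum[where f="\<lambda>l. (sqrt CARD('k) * proj k l)\<^sup>2" for k]) auto
    finally show ?thesis by (rule real_le_rsqrt)
  qed
  have cov: "Q.expectation (\<lambda>z. (\<Psi> z \<bullet> u) * (\<Psi> z \<bullet> v)) = limit_cov u v" for u v
  proof -
    have int: "integrable (U \<Otimes>\<^sub>M P) (\<lambda>z. (\<Psi> z \<bullet> u) * (\<Psi> z \<bullet> v))"
    proof (rule Q.integrable_const_bound[of _ "(sqrt B * norm u) * (sqrt B * norm v)"])
      show "AE z in U \<Otimes>\<^sub>M P. norm ((\<Psi> z \<bullet> u) * (\<Psi> z \<bullet> v)) \<le> (sqrt B * norm u) * (sqrt B * norm v)"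
      proof (intro AE_I2)
        fix z
        have le: "\<bar>\<Psi> z \<bullet> w\<bar> \<le> sqrt B * norm w" for w
          by (rule order_trans[OF Cauchy_Schwarz_ineq2 mult_right_mono[OF bdd]]) simp
        show "norm ((\<Psi> z \<bullet> u) * (\<Psi> z \<bullet> v)) \<le> (sqrt B * norm u) * (sqrt B * norm v)"
          unfolding real_norm_def abs_mult by (rule mult_mono'[OF le le abs_ge_zero abs_ge_zero])
      qed
    qed measurable
    have inner_\<Psi>: "\<Psi> (l, x) \<bullet> u = (\<Sum>k\<in>UNIV. (sqrt CARD('k) * proj k l) * (psi x \<bullet> u $ k))" for l x u
      by (simp add: \<Psi>_def inner_vec_def)
    have "(LINT x|P. (\<Psi> (l, x) \<bullet> u) * (\<Psi> (l, x) \<bullet> v))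
        = CARD('k) * (\<Sum>k\<in>UNIV. \<Sum>k'\<in>UNIV. (proj k l * proj k' l) * psi_cov (u $ k) (v $ k'))" for l
    proof -
      have "(\<Psi> (l, x) \<bullet> u) * (\<Psi> (l, x) \<bullet> v)
          = (\<Sum>k\<in>UNIV. \<Sum>k'\<in>UNIV. (CARD('k) * (proj k l * proj k' l)) * ((psi x \<bullet> u $ k) * (psi x \<bullet> v $ k')))" for x
        unfolding inner_\<Psi> sum_product by (intro sum.cong refl) (simp add: mult_ac)
      then have "(LINT x|P. (\<Psi> (l, x) \<bullet> u) * (\<Psi> (l, x) \<bullet> v))
          = (\<Sum>k\<in>UNIV. \<Sum>k'\<in>UNIV. (CARD('k) * (proj k l * proj k' l)) * psi_cov (u $ k) (v $ k'))"
        using integrable_psi_inner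
        by (simp add: psi_cov_def Bochner_Integration.integral_sum Bochner_Integration.integrable_sum)
      then show ?thesis by (simp add: sum_distrib_left mult.assoc)
    qed
    then have "Q.expectation (\<lambda>z. (\<Psi> z \<bullet> u) * (\<Psi> z \<bullet> v))
        = (LINT l|U. CARD('k) * (\<Sum>k\<in>UNIV. \<Sum>k'\<in>UNIV. (proj k l * proj k' l) * psi_cov (u $ k) (v $ k')))"
      using Q.integral_fst'[OF int] by simp
    \<comment> \<open>The uniform weight 1/CARD('k) cancels against the two factors sqrt CARD('k)
      built into \<open>\<Psi>\<close>.\<close>
    also have "\<dots> = (\<Sum>l\<in>UNIV. \<Sum>k\<in>UNIV. \<Sum>k'\<in>UNIV. (proj k l * proj k' l) * psi_cov (u $ k) (v $ k'))"
      unfolding U_def by (subst integral_uniform_count_measure) (auto simp: sum_distrib_left[symmetric])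
    also have "\<dots> = (\<Sum>k\<in>UNIV. \<Sum>l\<in>UNIV. \<Sum>k'\<in>UNIV. (proj k l * proj k' l) * psi_cov (u $ k) (v $ k'))"
      by (rule sum.swap)
    also have "\<dots> = (\<Sum>k\<in>UNIV. \<Sum>k'\<in>UNIV. \<Sum>l\<in>UNIV. (proj k l * proj k' l) * psi_cov (u $ k) (v $ k'))"
      by (intro sum.cong refl sum.swap)
    also have "\<dots> = limit_cov u v"
      unfolding limit_cov_def by (simp only: sum_distrib_right[symmetric] proj_mult)
    finally show ?thesis .
  qed
  obtain a :: "nat \<Rightarrow> 'h ^ 'k" where a: "summable (\<lambda>j. (norm (a j))\<^sup>2)"
    "\<And>u v. (\<lambda>j. (a j \<bullet> u) * (a j \<bullet> v)) sums Q.expectation (\<lambda>z. (\<Psi> z \<bullet> u) * (\<Psi> z \<bullet> v))"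
    using Q.covariance_factorization[OF meas bdd] by blast
  have "(\<lambda>j. (a j \<bullet> u) * (a j \<bullet> v)) sums (S u \<bullet> v)" for u v
    using a(2)[of u v] by (simp only: cov S)
  from gaussian_law_exists[OF a(1) this] show ?thesis by blast
qed

end

section \<open>Specialization to the spatial sign\<close>

lemma borel_measurable_sgn_diff:
  "(\<lambda>(x, y). sgn (x - y :: 'h::{real_inner, second_countable_topology})) \<in> borel_measurable (borel \<Otimes>\<^sub>M borel)"
proof -
  have "(\<lambda>z. inverse (norm (fst z - snd z)) *\<^sub>R (fst z - snd z :: 'h)) \<in> borel_measurable (borel \<Otimes>\<^sub>M borel)"
    by measurable
  moreover have "(\<lambda>(x, y). sgn (x - y)) = (\<lambda>z. inverse (norm (fst z - snd z)) *\<^sub>R (fst z - snd z :: 'h))"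
    by (auto simp: sgn_div_norm)
  ultimately show ?thesis by simp
qed

lemma antisymmetric_kernel_sgn:
  fixes P :: "'h::{real_inner, banach, second_countable_topology} measure"
  assumes "prob_space P" "sets P = sets borel"
  shows "antisymmetric_kernel P (\<lambda>x y. sgn (x - y))"
proof -
  interpret prob_space P by fact
  show ?thesis
  proof
    show "sgn (y - x) = - sgn (x - y)" for x y :: 'h by (simp add: sgn_minus[symmetric])
    show "norm (sgn (x - y)) \<le> 1" for x y :: 'h by (simp add: norm_sgn)
  qed (use assms borel_measurable_sgn_diff in auto)
qed

text \<open>With equal distributions each bracket in \<open>Sigma_block\<close> is C - C - C = -C.
  The weights sum to 1, so a block equals the indicator of k = k' minus sqrt(lam k * lam k'), times
  C. Block (k, k') feeds the output component k', whence the exchange of sums at the end.\<close>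

lemma (in k_samples) Sigma_op_inner:
  assumes h: "h = (\<lambda>x y. sgn (x - y))"
  shows "Sigma_op (\<lambda>_. P) lam u \<bullet> v = limit_cov u v"
proof -
  define C where "C = (\<lambda>w. LINT z|P. (w \<bullet> psi z) *\<^sub>R psi z)"
  have C_op: "C_op (\<lambda>_. P) i j k w = C w" for i j k :: 'k and w
    using Cov_cond_expectation_third[of w] unfolding C_op_def Let_def C_def h
    by (simp add: case_prod_beta')
  have block: "Sigma_block (\<lambda>_. P) lam k k' w = proj k k' *\<^sub>R C w" for k k' w
  proof -
    have 1: "(\<Sum>l\<in>UNIV. lam l *\<^sub>R (C w - C w - C w)) = - C w"
      by (simp add: scaleR_sum_left[symmetric] lam_sum sum_negf)
    have 2: "(\<Sum>l\<^sub>1\<in>UNIV. \<Sum>l\<^sub>2\<in>UNIV. (lam l\<^sub>1 * lam l\<^sub>2) *\<^sub>R C w) = C w"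
      by (simp add: scaleR_sum_left[symmetric] sum_product[symmetric] lam_sum)
    show ?thesis
      unfolding Sigma_block_def C_op 1 2 by (simp add: proj_def scaleR_diff_left)
  qed
  have C_inner: "C u \<bullet> v = psi_cov u v" for u v
  proof -
    have "integrable P (\<lambda>z. (u \<bullet> psi z) *\<^sub>R psi z)"
    proof (rule integrable_const_bound[of _ "norm u * 1 * 1"])
      show "AE z in P. norm ((u \<bullet> psi z) *\<^sub>R psi z) \<le> norm u * 1 * 1"
        unfolding norm_scaleR real_norm_def
        by (intro AE_I2 mult_mono order_trans[OF Cauchy_Schwarz_ineq2] mult_left_mono psi_bound) auto
    qed measurable
    from integral_inner_left[OF this, of v] show ?thesis
      by (simp add: C_def psi_cov_def inner_commute)
  qed
  have "Sigma_op (\<lambda>_. P) lam u \<bullet> v = (\<Sum>k'\<in>UNIV. \<Sum>k\<in>UNIV. proj k k' * psi_cov (u $ k) (v $ k'))"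
    unfolding Sigma_op_def inner_vec_def vec_lambda_beta block inner_sum_left by (simp add: C_inner)
  also have "\<dots> = limit_cov u v" unfolding limit_cov_def by (rule sum.swap)
  finally show ?thesis .
qed

lemma (in k_samples) stat_eq_U_stat:
  assumes h: "h = (\<lambda>x y. sgn (x - y))"
  shows "stat n \<omega> = U_stat (N n) (\<lambda>k i. X n k i \<omega>)"
proof -
  have "stat n \<omega> $ k = U_stat (N n) (\<lambda>k i. X n k i \<omega>) $ k" for k
  proof -
    have Ix: "(\<Sum>b\<in>Ix n. f b) = (\<Sum>l\<in>UNIV. \<Sum>j=1..N n l. f (l, j))" for f :: "_ \<Rightarrow> 'h"
      unfolding Ix_def by (subst sum.Sigma) (auto simp: case_prod_beta')
    have Jx: "(\<Sum>a\<in>Jx n k. f a) = (\<Sum>i=1..N n k. f (k, i))" for f :: "_ \<Rightarrow> 'h"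
      unfolding Jx_eq by (subst sum.reindex) (auto simp: inj_on_def)
    \<comment> \<open>This also holds for an empty group, where both sides are 0.\<close>
    have sqrt: "sqrt (N n k) * (1 / real (N n k)) = 1 / sqrt (N n k)"
      by (cases "N n k = 0") (auto simp: field_simps)
    have "U_stat (N n) (\<lambda>k i. X n k i \<omega>) $ k
        = (sqrt (N n k) * (1 / real (N n k)) * (1 / real n)) *\<^sub>R (\<Sum>i=1..N n k. \<Sum>l\<in>UNIV. \<Sum>j=1..N n l. sgn (X n k i \<omega> - X n l j \<omega>))"
      by (simp only: U_stat_def rank_mean_def rank_fun_def vec_lambda_beta N_sum scaleR_sum_right[symmetric] scaleR_scaleR mult.assoc)
    moreover have "stat n \<omega> $ k = (1 / (sqrt (N n k) * real n)) *\<^sub>R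
        (\<Sum>i=1..N n k. \<Sum>l\<in>UNIV. \<Sum>j=1..N n l. h (X n k i \<omega>) (X n l j \<omega>))"
      by (simp only: stat_def vec_lambda_beta Ix Jx Y_def case_prod_conv)
    moreover have "h x y = sgn (x - y)" for x y by (simp add: h)
    ultimately show ?thesis unfolding sqrt by simp
  qed
  then show ?thesis by (simp add: vec_eq_iff)
qed

text \<open>The existence clause ensures that the convergence claim for every Gaussian law
  \<open>G\<close> with this covariance is not vacuous.\<close>

theorem corollary2p2:
  fixes P :: "'k::finite \<Rightarrow> 'h::{real_inner, banach, second_countable_topology} measure"
    and M :: "nat \<Rightarrow> 'a measure"
    and X :: "nat \<Rightarrow> 'k \<Rightarrow> nat \<Rightarrow> 'a \<Rightarrow> 'h"
    and N :: "nat \<Rightarrow> 'k \<Rightarrow> nat"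
    and lam :: "'k \<Rightarrow> real"
  assumes K: "CARD('k) \<ge> 2"
    and P_prob: "\<And>k. prob_space (P k)"
    and P_borel: "\<And>k. sets (P k) = sets borel"
    and P_nonatomic: "\<And>k x. measure (P k) {x} = 0"
    and M_prob: "\<And>n. prob_space (M n)"
    and X_indep: "\<And>n. prob_space.indep_vars (M n) (\<lambda>_. borel) (\<lambda>(k, i). X n k i)
                        (SIGMA k:UNIV. {1..N n k})"
    and X_distr: "\<And>n k i. i \<in> {1..N n k} \<Longrightarrow> distr (M n) borel (X n k i) = P k"
    and N_sum: "\<And>n. (\<Sum>k\<in>UNIV. N n k) = n"
    and lam_range: "\<And>k. 0 < lam k \<and> lam k < 1"
    and N_lim: "\<And>k. (\<lambda>n. real (N n k) / real n) \<longlonglongrightarrow> lam k"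
    and null: "\<And>k l. P k = P l"
  shows "(\<forall>n. has_bochner_integral (M n) (\<lambda>\<omega>. U_stat (N n) (\<lambda>k i. X n k i \<omega>)) 0) \<and>
    (\<exists>G. gaussian_law 0 (Sigma_op P lam) G) \<and>
    (\<forall>G. gaussian_law 0 (Sigma_op P lam) G \<longrightarrow>
      weakly_converges (\<lambda>n. distr (M n) borel (\<lambda>\<omega>. U_stat (N n) (\<lambda>k i. X n k i \<omega>))) G) \<and>
    (\<forall>(Q :: 'w measure) W. prob_space Q \<longrightarrow> W \<in> borel_measurable Q \<longrightarrow>
      gaussian_law 0 (Sigma_op P lam) (distr Q borel W) \<longrightarrow>
      weak_conv_m (\<lambda>n. distr (M n) borel (\<lambda>\<omega>. SS_stat (N n) (\<lambda>k i. X n k i \<omega>)))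
                  (distr Q borel (\<lambda>\<omega>. (norm (W \<omega>))\<^sup>2)))"
proof -
  \<comment> \<open>Any index will do, since the hypothesis \<open>null\<close> makes all
    \<open>P k\<close> equal.\<close>
  define k0 :: 'k where "k0 = undefined"
  define P0 where "P0 = P k0"
  define h :: "'h \<Rightarrow> 'h \<Rightarrow> 'h" where "h = (\<lambda>x y. sgn (x - y))"
  define U where "U = (\<lambda>n \<omega>. U_stat (N n) (\<lambda>k i. X n k i \<omega>))"
  define S where "S = Sigma_op P lam"
  have P_eq: "P = (\<lambda>_. P0)" unfolding P0_def by (rule ext) (rule null)
  interpret antisymmetric_kernel P0 h
    unfolding h_def P0_def by (rule antisymmetric_kernel_sgn[OF P_prob P_borel])
  interpret k_samples P0 h M X N lam
  proof (intro k_samples.intro k_samples_axioms.intro antisymmetric_kernel_axioms)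
    show "distr (M n) borel (X n k i) = P0" if "i \<in> {1..N n k}" for n k i
      using X_distr[OF that] by (simp only: P_eq)
    show "0 < lam k" for k using lam_range by simp
  qed (rule M_prob X_indep N_sum N_lim)+
  have stat_U: "stat n = U n" for n
    unfolding U_def by (rule ext, rule stat_eq_U_stat) (rule h_def)
  have S: "S u \<bullet> v = limit_cov u v" for u v
    unfolding S_def P_eq by (rule Sigma_op_inner) (rule h_def)
  have U_meas[measurable]: "U n \<in> borel_measurable (M n)" for n
    using stat_measurable[of n] unfolding stat_U .
  have weak: "weakly_converges (\<lambda>n. distr (M n) borel (U n)) G" if "gaussian_law 0 S G" for G
    using stat_weakly_converges[OF S that] unfolding stat_U .
  have "weak_conv_m (\<lambda>n. distr (M n) borel (\<lambda>\<omega>. (norm (U n \<omega>))\<^sup>2)) (distr Q borel (\<lambda>\<omega>. (norm (W \<omega>))\<^sup>2))"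
    if Q: "prob_space Q" and W[measurable]: "W \<in> borel_measurable Q" and G: "gaussian_law 0 S (distr Q borel W)"
    for Q :: "'w measure" and W
  proof (subst weakly_converges_real_iff[symmetric])
    show "real_distribution (distr (M n) borel (\<lambda>\<omega>. (norm (U n \<omega>))\<^sup>2))" for n
      by (rule prob_space.real_distribution_distr[OF M_prob]) measurable
    show "real_distribution (distr Q borel (\<lambda>\<omega>. (norm (W \<omega>))\<^sup>2))"
      by (rule prob_space.real_distribution_distr[OF Q]) measurable
    show "weakly_converges (\<lambda>n. distr (M n) borel (\<lambda>\<omega>. (norm (U n \<omega>))\<^sup>2)) (distr Q borel (\<lambda>\<omega>. (norm (W \<omega>))\<^sup>2))"
      unfolding weakly_converges_def
    proof (intro allI impI)
      fix f :: "real \<Rightarrow> real" assume f: "continuous_on UNIV f" "bounded (range f)"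
      then have [measurable]: "f \<in> borel_measurable borel" by (intro borel_measurable_continuous_onI)
      \<comment> \<open>Continuous mapping: composing a test function on the line with the squared
        norm gives a test function on the product space.\<close>
      have "continuous_on UNIV (\<lambda>x :: 'h ^ 'k. f ((norm x)\<^sup>2))"
        using f(1) by (intro continuous_on_compose2[OF f(1)] continuous_intros) auto
      moreover have "bounded (range (\<lambda>x :: 'h ^ 'k. f ((norm x)\<^sup>2)))"
        using f(2) by (rule bounded_subset) auto
      ultimately have "(\<lambda>n. LINT x|distr (M n) borel (U n). f ((norm x)\<^sup>2)) \<longlonglongrightarrow> (LINT x|distr Q borel W. f ((norm x)\<^sup>2))"
        using weak[OF G] unfolding weakly_converges_def by blast
      then show "(\<lambda>n. LINT x|distr (M n) borel (\<lambda>\<omega>. (norm (U n \<omega>))\<^sup>2). f x) \<longlonglongrightarrow> (LINT x|distr Q borel (\<lambda>\<omega>. (norm (W \<omega>))\<^sup>2). f x)"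
        by (simp add: integral_distr)
    qed
  qed
  moreover have "has_bochner_integral (M n) (U n) 0" for n
    using stat_has_bochner_integral[of n] unfolding stat_U .
  moreover have "\<exists>G. gaussian_law 0 S G" by (rule gaussian_limit_exists[OF S])
  ultimately have "(\<forall>n. has_bochner_integral (M n) (U n) 0) \<and> (\<exists>G. gaussian_law 0 S G) \<and>
    (\<forall>G. gaussian_law 0 S G \<longrightarrow> weakly_converges (\<lambda>n. distr (M n) borel (U n)) G) \<and>
    (\<forall>(Q :: 'w measure) W. prob_space Q \<longrightarrow> W \<in> borel_measurable Q \<longrightarrow>
      gaussian_law 0 S (distr Q borel W) \<longrightarrow>
      weak_conv_m (\<lambda>n. distr (M n) borel (\<lambda>\<omega>. (norm (U n \<omega>))\<^sup>2)) (distr Q borel (\<lambda>\<omega>. (norm (W \<omega>))\<^sup>2)))"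
    using weak by blast
  then show ?thesis unfolding U_def SS_stat_def S_def .
qed

end
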